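(* Let $G:\mathbb{R}^D\to\mathbb{R}$ be a $\sigma$-strongly convex function with minimizer $x^\star$, and let $X(t)$ be the delayed coordinate gradient descent process associated with the orthogonal decomposition $\mathbb{R}^D=\bigoplus_{k=1}^m E_k$, intensities $p_k>0$, delays $\tau_k\ge0$, step sizes $\eta_k>0$ and $\{0,1\}$-valued variables $\varepsilon_k(t)$, as described in the context, under the regularity assumptions on $G$ (constants $L_k$, $M_{k,\ell}$) and the assumptions on the variables $\varepsilon_k(t)$ (constants $\varepsilon_k>0$) listed in the context. Assume that the step sizes are given by $\eta_k=\frac{K_k}{p_kL_k}$ where for all $k\in[m]$, $$K_k\le\frac{p_k}{1+\sum_{\ell\sim k}p_\ell\left(\frac{\tau_kM_{k,\ell}+e\,\tau_\ell M_{\ell,k}}{\sqrt{L_kL_\ell}}\right)},$$ and let $\gamma\in\mathbb{R}_+$ be such that $$\gamma<\min\Big(\sigma\min_{k\in[m]}\frac{\varepsilon_kK_k}{L_k},\ \frac1{\tau_{\max}}\Big),\qquad \tau_{\max}:=\max_{k\in[m]}\tau_k.$$ Then for any $T>0$, $$\frac{\int_0^Te^{\gamma t}\,\mathbb{E}\big[G(X(t))-G(x^\star)\big]\,dt}{\int_0^Te^{\gamma t}\,\big(G(X(0))-G(x^\star)\big)\,dt}\ \le\ e^{-\frac{\gamma T}{2}}\ \frac{1+\frac{\tau_{\max}}{T}}{1-\gamma\tau_{\max}}.$$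
   Context: Setting. $E_1,\dots,E_m$ are mutually orthogonal subspaces of $\mathbb{R}^D$ with $\mathbb{R}^D=\bigoplus_{k=1}^mE_k$. For $x\in\mathbb{R}^D$, $x_k$ is the orthogonal projection of $x$ on $E_k$, and $\nabla_kG:=(\nabla G)_k$. For $k,\ell\in[m]=\{1,\dots,m\}$, write $k\sim\ell$ (adjacent) if and only if $\nabla_k\nabla_\ell G$ is not identically equal to $0$; note that $k\sim k$. The constant $e$ is $\exp(1)$, and $1/\tau_{\max}=+\infty$ if $\tau_{\max}=0$. Process. $(\mathcal{P}_k)_{k\in[m]}$ are independent Poisson point processes on $\mathbb{R}^+$ with intensities $p_k>0$. $X(t)$ is the jump process with deterministic $X(0)$, $X(t)=X(0)$ for $t\le0$, and $$dX_k(t)=-\varepsilon_k(t)\,\eta_k\,\nabla_kG\big(X(t-\tau_k)\big)\,\mathcal{P}_k(dt),\qquad k\in[m],$$ where $\mathcal{P}_k(dt)$ is the counting measure (sum of Dirac masses) at the points of $\mathcal{P}_k$; i.e. at each point $t\in\mathcal{P}_k$ the component $X_k$ jumps by $-\varepsilon_k(t)\eta_k\nabla_kG(X(t-\tau_k))$ (with $X(t-\tau_k)$ read as the left limit $X(t-)$ if $\tau_k=0$), and nothing else changes. Regularity assumptions. $G$ is $\sigma$-strongly convex ($\sigma>0$) and $L_k$-smooth on $E_k$: for all $x\in\mathbb{R}^D$, $h\in E_k$, $G(x+h)\le G(x)+\langle\nabla_kG(x),h\rangle+\frac{L_k}{2}\|h\|^2$. Moreover there are non-negative numbers $M_{k,\ell}$,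 $M_{\ell,k}$ for $k\sim\ell$ (not necessarily equal) such that for all $k\in[m]$ and $x,y\in\mathbb{R}^D$, $$\|\nabla_kG(x)-\nabla_kG(y)\|\le\sum_{\ell\sim k}M_{k,\ell}\|x_\ell-y_\ell\|.$$ Assumptions on $\varepsilon_k(t)$. Each $\varepsilon_k(t)\in\{0,1\}$ is measurable with respect to $\sigma\big(\mathcal{P}_\ell\cap[t-\tau_k,t),\ \ell\in[m]\big)$; there is a constant $\varepsilon_k>0$ with $\mathbb{E}[\varepsilon_k(t)]\ge\varepsilon_k$ for all $t$; and, with $N_\ell(t-\tau_k,t)=|\mathcal{P}_\ell\cap[t-\tau_k,t]|$, for all $k,\ell\in[m]$, $$\mathbb{E}[\varepsilon_k(t)N_\ell(t-\tau_k,t)]\le\mathbb{E}[\varepsilon_k(t)]\,\mathbb{E}[N_\ell(t-\tau_k,t)].$$ The conclusion is meant when $G(X(0))\ne G(x^\star)$.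
   Formalization: The variables ε_k(t) are additionally assumed jointly measurable in time and randomness (predictable for the filtration of the Poisson processes); measurability at each fixed t alone does not make E[G(X(t))] well defined, and the bound can then fail. *)

theory Defs
  imports "HOL-Probability.Probability"
begin

section \<open>Orthogonal decompositions and functions\<close>

definition orth_proj :: "'a::euclidean_space set \<Rightarrow> 'a \<Rightarrow> 'a" where
  "orth_proj S x = (THE y. y \<in> S \<and> x - y \<in> S\<^sup>\<bottom>)"

text \<open>Spanning together with mutual orthogonality makes the sum direct. Zero summands are allowed.\<close>

definition orthogonal_decomposition :: "nat \<Rightarrow> (nat \<Rightarrow> 'a::euclidean_space set) \<Rightarrow> bool" where
  "orthogonal_decomposition m E \<longleftrightarrow>
     (\<forall>k\<in>{1..m}. subspace (E k)) \<and>
     (\<forall>k\<in>{1..m}. \<forall>l\<in>{1..m}. k \<noteq> l \<longrightarrow> (\<forall>x\<in>E k. \<forall>y\<in>E l. orthogonal x y)) \<and>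
     span (\<Union>k\<in>{1..m}. E k) = UNIV"

definition grad :: "('a::euclidean_space \<Rightarrow> real) \<Rightarrow> 'a \<Rightarrow> 'a" where
  "grad G x = (THE D. GDERIV G x :> D)"

definition block_grad ::
  "(nat \<Rightarrow> 'a::euclidean_space set) \<Rightarrow> ('a \<Rightarrow> real) \<Rightarrow> nat \<Rightarrow> 'a \<Rightarrow> 'a" where
  "block_grad E G k x = orth_proj (E k) (grad G x)"

text \<open>
  Blocks \<open>k\<close> and \<open>l\<close> are adjacent unless the derivative, along \<open>E k\<close>, of the \<open>l\<close>-th block of the
  gradient exists and is zero at every point. If \<open>G\<close> is twice differentiable this says
  that the block \<open>(k, l)\<close> of the Hessian does not vanish identically, but no second-order
  differentiability is needed for the definition to make sense.
\<close>

definition adj ::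
  "(nat \<Rightarrow> 'a::euclidean_space set) \<Rightarrow> ('a \<Rightarrow> real) \<Rightarrow> nat \<Rightarrow> nat \<Rightarrow> bool" where
  "adj E G k l \<longleftrightarrow>
     \<not> (\<forall>x. ((\<lambda>h. block_grad E G l (x + h)) has_derivative (\<lambda>h. 0)) (at 0 within E k))"

definition strongly_convex :: "real \<Rightarrow> ('a::euclidean_space \<Rightarrow> real) \<Rightarrow> bool" where
  "strongly_convex \<sigma> G \<longleftrightarrow>
     (\<forall>x y. \<forall>u\<in>{0..1}. G ((1 - u) *\<^sub>R x + u *\<^sub>R y)
        \<le> (1 - u) * G x + u * G y - \<sigma> / 2 * u * (1 - u) * (norm (x - y))\<^sup>2)"

definition block_smooth ::
  "(nat \<Rightarrow> 'a::euclidean_space set) \<Rightarrow> ('a \<Rightarrow> real) \<Rightarrow> nat \<Rightarrow> real \<Rightarrow> bool" where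
  "block_smooth E G k L \<longleftrightarrow>
     (\<forall>x. \<forall>h\<in>E k. G (x + h) \<le> G x + block_grad E G k x \<bullet> h + L / 2 * (norm h)\<^sup>2)"


section \<open>Poisson point processes\<close>

text \<open>
  A simple point process is given by its random set of points. It is observed through the numbers
  of points in bounded Borel sets, which are finite.
\<close>

definition poisson_point_process :: "'w measure \<Rightarrow> real \<Rightarrow> ('w \<Rightarrow> real set) \<Rightarrow> bool" where
  "poisson_point_process \<Omega> p P \<longleftrightarrow>
     (\<forall>\<omega>\<in>space \<Omega>. P \<omega> \<subseteq> {0..} \<and> (\<forall>B. bounded B \<longrightarrow> finite (P \<omega> \<inter> B))) \<and>
     (\<forall>B\<in>sets borel. bounded B \<longrightarrow>
        (\<lambda>\<omega>. card (P \<omega> \<inter> B)) \<in> measurable \<Omega> (count_space UNIV)) \<and>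
     (\<forall>B\<in>sets borel. bounded B \<and> B \<subseteq> {0..} \<longrightarrow> (\<forall>n.
        measure \<Omega> {\<omega>\<in>space \<Omega>. card (P \<omega> \<inter> B) = n}
          = (p * measure lborel B) ^ n / fact n * exp (- (p * measure lborel B)))) \<and>
     (\<forall>(B :: nat \<Rightarrow> real set) n.
        (\<forall>i<n. B i \<in> sets borel \<and> bounded (B i)) \<and> disjoint_family_on B {..<n} \<longrightarrow>
        prob_space.indep_vars \<Omega> (\<lambda>_. count_space UNIV) (\<lambda>i \<omega>. card (P \<omega> \<inter> B i)) {..<n})"

text \<open>The sigma-algebra generated by the processes \<open>P l\<close>, \<open>l \<in> I\<close>, restricted to the time set \<open>S\<close>.\<close>

definition points_sigma ::
  "'w measure \<Rightarrow> (nat \<Rightarrow> 'w \<Rightarrow> real set) \<Rightarrow> nat set \<Rightarrow> real set \<Rightarrow> 'w measure" where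
  "points_sigma \<Omega> P I S = sigma (space \<Omega>)
     {{\<omega>\<in>space \<Omega>. card (P l \<omega> \<inter> B) = n} | l B n. l \<in> I \<and> B \<in> sets borel \<and> bounded B \<and> B \<subseteq> S}"

definition independent_poisson_processes ::
  "'w measure \<Rightarrow> nat \<Rightarrow> (nat \<Rightarrow> real) \<Rightarrow> (nat \<Rightarrow> 'w \<Rightarrow> real set) \<Rightarrow> bool" where
  "independent_poisson_processes \<Omega> m p P \<longleftrightarrow>
     (\<forall>k\<in>{1..m}. poisson_point_process \<Omega> (p k) (P k)) \<and>
     prob_space.indep_sets \<Omega> (\<lambda>k. sets (points_sigma \<Omega> P {k} UNIV)) {1..m}"

text \<open>
  The predictable sigma-algebra on \<open>[0, \<infinity>) \<times> \<Omega>\<close> of the filtration generated by \<open>P 1, \<dots>, P m\<close>.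
  Integrands against \<open>P k(dt)\<close> have to be measurable in \<open>(t, \<omega>)\<close> jointly. Measurability
  at each fixed time does not control the values at the random points of \<open>P k\<close>, since each
  fixed time is almost surely not a point.
\<close>

definition predictable_sigma ::
  "'w measure \<Rightarrow> nat \<Rightarrow> (nat \<Rightarrow> 'w \<Rightarrow> real set) \<Rightarrow> (real \<times> 'w) measure" where
  "predictable_sigma \<Omega> m P = sigma ({0..} \<times> space \<Omega>)
     ({{0} \<times> A | A. A \<in> sets (points_sigma \<Omega> P {1..m} {..0})} \<union>
      {{s<..t} \<times> A | s t A. 0 \<le> s \<and> s \<le> t \<and> A \<in> sets (points_sigma \<Omega> P {1..m} {..s})})"


section \<open>Delayed coordinate gradient descent\<close>

definition delayed :: "real \<Rightarrow> (real \<Rightarrow> 'a::euclidean_space) \<Rightarrow> real \<Rightarrow> 'a" where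
  "delayed \<tau> x t = (if \<tau> = 0 then Lim (at_left t) x else x (t - \<tau>))"

text \<open>
  The stochastic differential equation in integrated form: the sum over the finitely many points
  of \<open>P k\<close> in \<open>(0, t]\<close> is the integral against the counting measure \<open>P k(dt)\<close>.
\<close>

definition delayed_coordinate_descent ::
  "'w measure \<Rightarrow> nat \<Rightarrow> (nat \<Rightarrow> 'a::euclidean_space set) \<Rightarrow> ('a \<Rightarrow> real) \<Rightarrow> (nat \<Rightarrow> 'w \<Rightarrow> real set) \<Rightarrow>
   (nat \<Rightarrow> real) \<Rightarrow> (nat \<Rightarrow> real) \<Rightarrow> (nat \<Rightarrow> real \<Rightarrow> 'w \<Rightarrow> real) \<Rightarrow> 'a \<Rightarrow> (real \<Rightarrow> 'w \<Rightarrow> 'a) \<Rightarrow> bool" where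
  "delayed_coordinate_descent \<Omega> m E G P \<tau> \<eta> \<xi> x0 X \<longleftrightarrow>
     (\<forall>\<omega>\<in>space \<Omega>.
        (\<forall>t\<le>0. X t \<omega> = x0) \<and>
        (\<forall>t>0. \<forall>k\<in>{1..m}.
           orth_proj (E k) (X t \<omega>) = orth_proj (E k) x0
             - (\<Sum>s\<in>P k \<omega> \<inter> {0<..t}.
                  (\<xi> k s \<omega> * \<eta> k) *\<^sub>R block_grad E G k (delayed (\<tau> k) (\<lambda>r. X r \<omega>) s))))"

end

theory Submission
  imports Defs
begin

text \<open>
  At its points, block \<open>k\<close> moves by \<open>- \<xi> \<eta> D\<close>, where \<open>D\<close> is the \<open>k\<close>-th block of the gradient at the
  delayed position. By block smoothness a jump changes \<open>G\<close> by at most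
  \<open>\<xi> \<eta> (- (1 - L \<eta> / 2) |D|\<^sup>2 + |g - D| |D|)\<close>, where \<open>g\<close> is the current block gradient, and \<open>|g - D|\<close> is
  at most the sum of the jumps of the adjacent blocks during the delay. Everything is integrated
  with the compensation formula for predictable integrands. The delayed gradient is independent of
  the points in the delay window, on which \<open>\<xi>\<close> depends, so the negative correlation of \<open>\<xi>\<close> with the
  point counts bounds the first part of Young's inequality; the second part is a time integral of
  \<open>\<xi> |D|\<^sup>2\<close> over the window, and exchanging integrals costs a factor \<open>\<tau> exp (\<gamma> \<tau>) \<le> exp 1 * \<tau>\<close> against the
  weight \<open>exp (\<gamma> t)\<close>. The step size condition leaves half of the descent term. The
  Polyak-Lojasiewicz inequality turns it into \<open>- \<Gamma>\<close> times the weighted integral of the gap up to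
  \<open>T - \<tau>max\<close>, with \<open>\<gamma> < \<Gamma>\<close>, whence
  \<open>exp (\<gamma> T) gap T \<le> gap 0 + \<gamma> \<integral> exp (\<gamma> t) gap t dt\<close> over the last delay window. Integrating over \<open>T\<close> gives
  \<open>\<integral> exp (\<gamma> t) gap t dt \<le> T gap 0 / (1 - \<gamma> \<tau>max)\<close>.
\<close>

section \<open>Orthogonal projections and gradients\<close>

text \<open>Nothing is assumed about measurability of \<open>X\<close>, which is only a pathwise
  solution of the recursion. The compensation formula needs predictable integrands, so the jumps are
  exhibited as limits of Picard iterates; these stabilise at each time because only finitely many
  points precede it. Integrability is not given either, and the number of jumps is unbounded: a jump
  time enlarges the distance to \<open>xstar\<close> by at most a fixed factor \<open>a\<close>, and
  \<open>a ^ count\<close> has a finite mean because Poisson counts have all exponential moments.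
  The crude Lipschitz constant \<open>C\<close> serves these qualitative purposes and never enters
  the rate. A product of \<open>D k s\<close> with a jump inside its delay window mixes dependent
  factors; Young's inequality is used because it separates them into squares that can be treated one
  at a time. The factor exp (- \<gamma> T / 2) arises at the very end, when T is compared with the
  integral of exp (\<gamma> t), which Jensen's inequality bounds below by T exp (\<gamma> T /
  2).\<close>

lemma orth_proj_eqI:
  fixes S :: "'a::euclidean_space set"
  assumes "subspace S" "y \<in> S" "\<And>h. h \<in> S \<Longrightarrow> (x - y) \<bullet> h = 0"
  shows "orth_proj S x = y"
  unfolding orth_proj_def
proof (rule the_equality)
  show "y \<in> S \<and> x - y \<in> S\<^sup>\<bottom>"
    using assms by (auto simp: orthogonal_comp_def orthogonal_def inner_commute)
next
  fix z assume z: "z \<in> S \<and> x - z \<in> S\<^sup>\<bottom>"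
  have d: "z - y \<in> S"
    using z assms by (simp add: subspace_diff)
  have "(x - z) \<bullet> (z - y) = 0"
    using z d by (auto simp: orthogonal_comp_def orthogonal_def inner_commute)
  moreover have "(x - y) \<bullet> (z - y) = 0" using assms(3) d by auto
  ultimately have "(z - y) \<bullet> (z - y) = 0" by (simp add: inner_diff_left)
  then show "z = y" by simp
qed

lemma
  fixes S :: "'a::euclidean_space set"
  assumes "subspace S"
  shows orth_proj_in: "orth_proj S x \<in> S"
    and inner_orth_proj_diff: "h \<in> S \<Longrightarrow> (x - orth_proj S x) \<bullet> h = 0"
proof -
  obtain y z where yz: "y \<in> span S" "\<And>w. w \<in> span S \<Longrightarrow> orthogonal z w" "x = y + z"
    using orthogonal_subspace_decomp_exists[of S x] by metis
  have "orth_proj S x = y"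
    using assms yz by (intro orth_proj_eqI) (auto simp: span_eq_iff[THEN iffD2] orthogonal_def)
  then show "orth_proj S x \<in> S" "h \<in> S \<Longrightarrow> (x - orth_proj S x) \<bullet> h = 0"
    using assms yz by (auto simp: span_eq_iff[THEN iffD2] orthogonal_def)
qed

lemma inner_orth_proj:
  fixes S :: "'a::euclidean_space set"
  assumes "subspace S" "h \<in> S"
  shows "orth_proj S x \<bullet> h = x \<bullet> h"
  using inner_orth_proj_diff[OF assms, of x] by (simp add: inner_diff_left)

lemma linear_orth_proj:
  fixes S :: "'a::euclidean_space set"
  assumes S: "subspace S"
  shows "linear (orth_proj S)"
proof (rule linearI)
  fix x y :: 'a and c :: real
  show "orth_proj S (x + y) = orth_proj S x + orth_proj S y"
    using S by (intro orth_proj_eqI)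
      (auto simp: subspace_add orth_proj_in inner_add_left inner_diff_left inner_orth_proj)
  show "orth_proj S (c *\<^sub>R x) = c *\<^sub>R orth_proj S x"
    using S by (intro orth_proj_eqI)
      (auto simp: subspace_scale orth_proj_in inner_diff_left inner_orth_proj)
qed

lemma norm_orth_proj_le:
  fixes S :: "'a::euclidean_space set"
  assumes S: "subspace S"
  shows "norm (orth_proj S x) \<le> norm x"
proof -
  have "(norm (orth_proj S x))\<^sup>2 = x \<bullet> orth_proj S x"
    using inner_orth_proj[OF S orth_proj_in[OF S, of x], of x] by (simp add: power2_norm_eq_inner)
  also have "\<dots> \<le> norm x * norm (orth_proj S x)" by (rule norm_cauchy_schwarz)
  finally have "norm (orth_proj S x) * norm (orth_proj S x) \<le> norm x * norm (orth_proj S x)"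
    by (simp add: power2_eq_square)
  then show ?thesis
    by (cases "norm (orth_proj S x) = 0") (auto simp: mult_le_cancel_right)
qed

section \<open>Gradients and strong convexity\<close>

lemma GDERIV_unique:
  assumes "GDERIV f x :> D" "GDERIV f x :> D'"
  shows "D = D'"
proof -
  have "(\<lambda>h. h \<bullet> D) = (\<lambda>h. h \<bullet> D')"
    using assms has_derivative_unique unfolding gderiv_def by blast
  then have "(D - D') \<bullet> D = (D - D') \<bullet> D'" by metis
  then have "(D - D') \<bullet> (D - D') = 0" by (simp add: inner_diff_right)
  then show ?thesis by simp
qed

lemma has_derivative_grad:
  fixes G :: "'a::euclidean_space \<Rightarrow> real"
  assumes "G differentiable (at x)"
  shows "(G has_derivative (\<lambda>h. grad G x \<bullet> h)) (at x)"
proof -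
  obtain D where D: "(G has_derivative D) (at x)"
    using assms unfolding differentiable_def by blast
  then have lin: "linear D" using has_derivative_linear by blast
  have "D = (\<lambda>h. h \<bullet> adjoint D 1)"
    using adjoint_works[OF lin, of _ 1] by (auto simp: fun_eq_iff)
  then have g: "GDERIV G x :> adjoint D 1"
    using D unfolding gderiv_def by simp
  then have "grad G x = adjoint D 1"
    unfolding grad_def by (rule the_equality) (use g GDERIV_unique in blast)
  then show ?thesis using g unfolding gderiv_def by (simp add: inner_commute)
qed

lemma has_real_derivative_along:
  fixes G :: "'a::euclidean_space \<Rightarrow> real"
  assumes "\<And>x. G differentiable (at x)"
  shows "((\<lambda>t. G (x + t *\<^sub>R v)) has_real_derivative (grad G (x + t *\<^sub>R v) \<bullet> v)) (at t)"
proof -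
  have "((\<lambda>t. x + t *\<^sub>R v) has_derivative (\<lambda>h. h *\<^sub>R v)) (at t)"
    by (auto intro!: derivative_eq_intros)
  from has_derivative_compose[OF this has_derivative_grad[OF assms]]
  show ?thesis
    unfolding has_field_derivative_def by (simp add: mult.commute[of _ "grad G _ \<bullet> v"])
qed

text \<open>Dividing the strong convexity inequality by \<open>u\<close> and letting
  \<open>u\<close> tend to 0 from the right turns the difference quotient along the segment into the
  directional derivative; the quadratic term keeps its full factor because \<open>1 - u\<close>
  tends to 1.\<close>

lemma strongly_convex_grad_le:
  fixes G :: "'a::euclidean_space \<Rightarrow> real"
  assumes diff: "\<And>x. G differentiable (at x)" and sc: "strongly_convex \<sigma> G"
  shows "G x + grad G x \<bullet> (y - x) + \<sigma> / 2 * (norm (x - y))\<^sup>2 \<le> G y"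
proof -
  let ?g = "\<lambda>u. G (x + u *\<^sub>R (y - x))"
  have "((\<lambda>u. (?g u - ?g 0) / (u - 0)) \<longlongrightarrow> grad G (x + 0 *\<^sub>R (y - x)) \<bullet> (y - x)) (at 0)"
    using has_real_derivative_along[OF diff, of x "y - x" 0] unfolding has_field_derivative_iff by simp
  then have "((\<lambda>u. (?g u - G x) / u) \<longlongrightarrow> grad G x \<bullet> (y - x)) (at_right 0)"
    by (simp add: filterlim_at_split)
  moreover have "((\<lambda>u. G y - G x - \<sigma> / 2 * (1 - u) * (norm (x - y))\<^sup>2) \<longlongrightarrow>
      G y - G x - \<sigma> / 2 * (1 - 0) * (norm (x - y))\<^sup>2) (at_right 0)"
    by (intro tendsto_intros)
  moreover have "\<forall>\<^sub>F u in at_right 0. (?g u - G x) / u \<le> G y - G x - \<sigma> / 2 * (1 - u) * (norm (x - y))\<^sup>2"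
    unfolding eventually_at_right_field
  proof (intro exI[of _ 1] conjI allI impI)
    fix u :: real assume u: "0 < u" "u < 1"
    have "(1 - u) *\<^sub>R x + u *\<^sub>R y = x + u *\<^sub>R (y - x)" by (simp add: algebra_simps)
    then have "?g u \<le> (1 - u) * G x + u * G y - \<sigma> / 2 * u * (1 - u) * (norm (x - y))\<^sup>2"
      using sc[unfolded strongly_convex_def, rule_format, of u x y] u by auto
    then show "(?g u - G x) / u \<le> G y - G x - \<sigma> / 2 * (1 - u) * (norm (x - y))\<^sup>2"
      using u by (simp add: field_simps)
  qed simp
  ultimately have "grad G x \<bullet> (y - x) \<le> G y - G x - \<sigma> / 2 * (1 - 0) * (norm (x - y))\<^sup>2"
    by (intro tendsto_le[OF trivial_limit_at_right_real])
  then show ?thesis by simp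
qed

lemma polyak_lojasiewicz:
  fixes G :: "'a::euclidean_space \<Rightarrow> real"
  assumes diff: "\<And>x. G differentiable (at x)" and sc: "strongly_convex \<sigma> G" and "\<sigma> > 0"
  shows "2 * \<sigma> * (G x - G y) \<le> (norm (grad G x))\<^sup>2"
proof -
  have "G x - G y \<le> grad G x \<bullet> (x - y) - \<sigma> / 2 * (norm (x - y))\<^sup>2"
    using strongly_convex_grad_le[OF diff sc, of x y] by (simp add: inner_diff_right)
  also have "\<dots> \<le> norm (grad G x) * norm (x - y) - \<sigma> / 2 * (norm (x - y))\<^sup>2"
    using norm_cauchy_schwarz by auto
  finally have "2 * \<sigma> * (G x - G y) \<le> 2 * \<sigma> * (norm (grad G x) * norm (x - y) - \<sigma> / 2 * (norm (x - y))\<^sup>2)"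
    using \<open>\<sigma> > 0\<close> by (intro mult_left_mono) auto
  \<comment> \<open>Completing the square: the bound is quadratic in \<open>norm (x - y)\<close> and
    maximal at norm (grad G x) / \<sigma>, so the distance to \<open>y\<close> drops out.\<close>
  also have "\<dots> = (norm (grad G x))\<^sup>2 - (norm (grad G x) - \<sigma> * norm (x - y))\<^sup>2"
    by (simp add: power2_eq_square algebra_simps)
  finally show ?thesis by (smt (verit) zero_le_power2)
qed

section \<open>Orthogonal block decompositions\<close>

locale orthogonal_blocks =
  fixes m :: nat and E :: "nat \<Rightarrow> 'a::euclidean_space set"
  assumes decomp: "orthogonal_decomposition m E"
begin

lemma subspace_block: "k \<in> {1..m} \<Longrightarrow> subspace (E k)"
  using decomp unfolding orthogonal_decomposition_def by blast

text \<open>A Euclidean space has a nonzero basis vector, which an empty family of blocks could not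
  span. Positivity keeps the maximum of the delays and the minimum of the rates away from an empty
  index set.\<close>

lemma m_pos: "m > 0"
proof (rule ccontr)
  assume "\<not> m > 0"
  then have "span (\<Union>k\<in>{1..m}. E k) = {0}" by simp
  then have "(UNIV :: 'a set) = {0}"
    using decomp unfolding orthogonal_decomposition_def by simp
  moreover obtain b :: 'a where "b \<in> Basis" using nonempty_Basis by blast
  ultimately show False using nonzero_Basis by blast
qed

lemma orth_proj_block:
  assumes "k \<in> {1..m}" "l \<in> {1..m}" "h \<in> E l"
  shows "orth_proj (E k) h = (if k = l then h else 0)"
proof (rule orth_proj_eqI)
  show "subspace (E k)" using assms subspace_block by auto
  show "(if k = l then h else 0) \<in> E k" using assms subspace_block subspace_0 by auto
  show "(h - (if k = l then h else 0)) \<bullet> h' = 0" if "h' \<in> E k" for h'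
    using decomp assms that unfolding orthogonal_decomposition_def orthogonal_def by auto
qed

text \<open>The remainder \<open>z\<close> is orthogonal to every block, hence to their span, which
  is the whole space and contains \<open>z\<close> itself.\<close>

lemma sum_orth_proj: "(\<Sum>k\<in>{1..m}. orth_proj (E k) x) = x"
proof -
  define z where "z = x - (\<Sum>k\<in>{1..m}. orth_proj (E k) x)"
  have "z \<bullet> h = 0" if l: "l \<in> {1..m}" "h \<in> E l" for l h
  proof -
    have "(\<Sum>k\<in>{1..m}. orth_proj (E k) x) \<bullet> h = (\<Sum>k\<in>{1..m}. if k = l then x \<bullet> h else 0)"
      unfolding inner_sum_left
    proof (rule sum.cong)
      fix k assume k: "k \<in> {1..m}"
      have "orth_proj (E k) x \<in> E k" using k subspace_block orth_proj_in by auto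
      then show "orth_proj (E k) x \<bullet> h = (if k = l then x \<bullet> h else 0)"
        using decomp k l inner_orth_proj[OF subspace_block]
        unfolding orthogonal_decomposition_def orthogonal_def by auto
    qed simp
    also have "\<dots> = x \<bullet> h" using l by simp
    finally show ?thesis by (simp add: z_def inner_diff_left)
  qed
  then have "orthogonal z y" if "y \<in> (\<Union>k\<in>{1..m}. E k)" for y
    using that by (auto simp: orthogonal_def)
  then have "orthogonal z z"
    using orthogonal_to_span[of z "\<Union>k\<in>{1..m}. E k" z] decomp
    unfolding orthogonal_decomposition_def by blast
  then have "z = 0" by (simp add: orthogonal_self)
  then show ?thesis by (simp add: z_def)
qed

lemma eq_if_orth_proj_eq:
  assumes "\<And>k. k \<in> {1..m} \<Longrightarrow> orth_proj (E k) x = orth_proj (E k) y"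
  shows "x = y"
  using sum_orth_proj[of x] sum_orth_proj[of y] assms by (metis (no_types, lifting) sum.cong)

lemma norm_sq_eq_sum_orth_proj: "(norm x)\<^sup>2 = (\<Sum>k\<in>{1..m}. (norm (orth_proj (E k) x))\<^sup>2)"
proof -
  have "(norm x)\<^sup>2 = (\<Sum>k\<in>{1..m}. orth_proj (E k) x \<bullet> x)"
    unfolding power2_norm_eq_inner inner_sum_left[symmetric] sum_orth_proj ..
  also have "\<dots> = (\<Sum>k\<in>{1..m}. (norm (orth_proj (E k) x))\<^sup>2)"
  proof (rule sum.cong)
    fix k assume k: "k \<in> {1..m}"
    show "orth_proj (E k) x \<bullet> x = (norm (orth_proj (E k) x))\<^sup>2"
      using inner_orth_proj[OF subspace_block[OF k] orth_proj_in[OF subspace_block[OF k], of x], of x]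
      by (simp add: power2_norm_eq_inner inner_commute)
  qed simp
  finally show ?thesis .
qed

end

lemma (in orthogonal_blocks) not_adj_imp:
  assumes diff: "\<And>x. G differentiable (at x)" and k: "k \<in> {1..m}" and l: "l \<in> {1..m}"
    and nadj: "\<not> adj E G k l"
  shows "\<not> adj E G l k"
proof -
  have const: "block_grad E G l (x + h) = block_grad E G l x" if h: "h \<in> E k" for x h
  proof -
    \<comment> \<open>The definition gives a zero derivative at displacement zero within
      \<open>E k\<close>, but from every base point. Taking \<open>x + t *\<^sub>R h\<close> as base
      point covers every \<open>t\<close>, so the block gradient is constant along the line.\<close>
    have "((\<lambda>t. block_grad E G l (x + t *\<^sub>R h)) has_derivative (\<lambda>_. 0)) (at t within UNIV)" for t
    proof -
      have "((\<lambda>y. block_grad E G l ((x + t *\<^sub>R h) + y)) has_derivative (\<lambda>_. 0)) (at 0 within E k)"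
        using nadj unfolding adj_def by blast
      then have "((\<lambda>y. block_grad E G l ((x + t *\<^sub>R h) + y)) has_derivative (\<lambda>_. 0))
          (at ((t - t) *\<^sub>R h) within range (\<lambda>s. (s - t) *\<^sub>R h))"
        using h subspace_block[OF k]
        by (auto simp: subspace_scale intro: has_derivative_subset)
      moreover have "((\<lambda>s. (s - t) *\<^sub>R h) has_derivative (\<lambda>s. s *\<^sub>R h)) (at t)"
        by (auto intro!: derivative_eq_intros)
      ultimately have "((\<lambda>s. block_grad E G l ((x + t *\<^sub>R h) + (s - t) *\<^sub>R h)) has_derivative (\<lambda>_. 0)) (at t)"
        by (rule has_derivative_in_compose[rotated])
      then show ?thesis by (simp add: algebra_simps)
    qed
    then have "block_grad E G l (x + 1 *\<^sub>R h) = block_grad E G l (x + 0 *\<^sub>R h)"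
      by (intro has_derivative_zero_unique[OF convex_UNIV, where f="\<lambda>t. block_grad E G l (x + t *\<^sub>R h)"]) auto
    then show ?thesis by simp
  qed
  \<comment> \<open>Constancy of the \<open>l\<close>-th block along \<open>E k\<close> makes the
    increment of \<open>G\<close> in direction \<open>h\<close> insensitive to moves in
    \<open>E l\<close>.\<close>
  have second: "G (x + h + v) - G (x + v) = G (x + h) - G x" if "h \<in> E k" "v \<in> E l" for x h v
  proof -
    have "((\<lambda>t. G (x + h + t *\<^sub>R v) - G (x + t *\<^sub>R v)) has_real_derivative 0) (at t)" for t
    proof -
      have "grad G (x + h + t *\<^sub>R v) \<bullet> v - grad G (x + t *\<^sub>R v) \<bullet> v
        = block_grad E G l ((x + t *\<^sub>R v) + h) \<bullet> v - block_grad E G l (x + t *\<^sub>R v) \<bullet> v"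
        using inner_orth_proj[OF subspace_block[OF l] that(2)]
        by (simp add: block_grad_def algebra_simps)
      also have "\<dots> = 0" using const[OF that(1)] by simp
      finally show ?thesis
        using DERIV_diff[OF has_real_derivative_along[OF diff, of "x+h" v t] has_real_derivative_along[OF diff, of x v t]]
        by simp
    qed
    then have "G (x + h + 1 *\<^sub>R v) - G (x + 1 *\<^sub>R v) = G (x + h + 0 *\<^sub>R v) - G (x + 0 *\<^sub>R v)"
      by (intro DERIV_isconst_all[where f="\<lambda>t. G (x + h + t *\<^sub>R v) - G (x + t *\<^sub>R v)"]) auto
    then show ?thesis by simp
  qed
  have const': "block_grad E G k (x + v) = block_grad E G k x" if v: "v \<in> E l" for x v
  proof -
    \<comment> \<open>The change \<open>d\<close> of the block gradient serves as its own test
      direction: it lies in \<open>E k\<close>, and differentiating the vanishing second difference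
      along it gives \<open>d \<bullet> d = 0\<close>.\<close>
    define d where "d = block_grad E G k (x + v) - block_grad E G k x"
    have dk: "d \<in> E k"
      using subspace_block[OF k] by (simp add: d_def block_grad_def subspace_diff orth_proj_in)
    have "((\<lambda>t. G (x + v + t *\<^sub>R d) - G (x + t *\<^sub>R d)) has_real_derivative
        (grad G (x + v + 0 *\<^sub>R d) \<bullet> d - grad G (x + 0 *\<^sub>R d) \<bullet> d)) (at 0)"
      by (intro DERIV_diff has_real_derivative_along diff)
    moreover have "(\<lambda>t. G (x + v + t *\<^sub>R d) - G (x + t *\<^sub>R d)) = (\<lambda>t. G (x + v) - G x)"
    proof
      fix t
      show "G (x + v + t *\<^sub>R d) - G (x + t *\<^sub>R d) = G (x + v) - G x"
        using second[OF subspace_scale[OF subspace_block[OF k] dk] v, of x t]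
        by (simp add: add.assoc add.commute[of v])
    qed
    ultimately have "((\<lambda>t::real. G (x + v) - G x) has_real_derivative
        (grad G (x + v) \<bullet> d - grad G x \<bullet> d)) (at 0)"
      by simp
    then have "grad G (x + v) \<bullet> d - grad G x \<bullet> d = 0"
      by (rule DERIV_unique[OF _ DERIV_const])
    then have "d \<bullet> d = 0"
      using inner_orth_proj[OF subspace_block[OF k] dk] by (simp add: d_def[unfolded block_grad_def] inner_diff_left)
    then show ?thesis by (simp add: d_def)
  qed
  show ?thesis
    unfolding adj_def not_not
  proof
    fix x
    show "((\<lambda>h. block_grad E G k (x + h)) has_derivative (\<lambda>h. 0)) (at 0 within E l)"
      by (rule has_derivative_transform[OF _ _ has_derivative_const[of "block_grad E G k x"]])
         (use const' subspace_0[OF subspace_block[OF l]] in auto)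
  qed
qed

lemma (in orthogonal_blocks) adj_commute:
  assumes "\<And>x. G differentiable (at x)" "k \<in> {1..m}" "l \<in> {1..m}"
  shows "adj E G k l \<longleftrightarrow> adj E G l k"
  using not_adj_imp assms by metis

section \<open>Independence over disjoint time sets\<close>

lemma (in prob_space) indep_sets_reindex:
  assumes inj: "inj_on h I" and indep: "indep_sets F (h ` I)"
  shows "indep_sets (\<lambda>i. F (h i)) I"
proof (rule indep_setsI)
  show "F (h i) \<subseteq> events" if "i \<in> I" for i
    using indep that unfolding indep_sets_def by auto
next
  fix A J assume J: "J \<noteq> {}" "J \<subseteq> I" "finite J" "\<forall>j\<in>J. A j \<in> F (h j)"
  have injJ: "inj_on h J" using inj J(2) by (rule inj_on_subset)
  let ?A = "\<lambda>i. A (inv_into J h i)"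
  have A: "?A (h j) = A j" if "j \<in> J" for j using injJ that by simp
  have "prob (\<Inter>i\<in>h ` J. ?A i) = (\<Prod>i\<in>h ` J. prob (?A i))"
    using J A by (intro indep_setsD[OF indep]) auto
  then show "prob (\<Inter>j\<in>J. A j) = (\<Prod>j\<in>J. prob (A j))"
    using A by (simp add: prod.reindex[OF injJ])
qed

section \<open>Counts of independent Poisson processes\<close>

locale poisson_family = prob_space \<Omega> for \<Omega> :: "'w measure" +
  fixes m :: nat and p :: "nat \<Rightarrow> real" and P :: "nat \<Rightarrow> 'w \<Rightarrow> real set"
  assumes indep_poisson: "independent_poisson_processes \<Omega> m p P"
    and intensity_pos: "\<And>k. k \<in> {1..m} \<Longrightarrow> p k > 0"
begin

abbreviation "F S \<equiv> points_sigma \<Omega> P {1..m} S"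

abbreviation "points l S \<omega> \<equiv> P l \<omega> \<inter> ({0<..} \<inter> S)"

lemma poisson: "k \<in> {1..m} \<Longrightarrow> poisson_point_process \<Omega> (p k) (P k)"
  using indep_poisson unfolding independent_poisson_processes_def by blast

lemmas poissonD = poisson[unfolded poisson_point_process_def]

lemma finite_points: "k \<in> {1..m} \<Longrightarrow> \<omega> \<in> space \<Omega> \<Longrightarrow> bounded B \<Longrightarrow> finite (P k \<omega> \<inter> B)"
  using poissonD[THEN conjunct1, rule_format, of k \<omega>] by simp

lemma points_nonneg: "k \<in> {1..m} \<Longrightarrow> \<omega> \<in> space \<Omega> \<Longrightarrow> P k \<omega> \<subseteq> {0..}"
  using poissonD[THEN conjunct1, rule_format, of k \<omega>] by simp

lemma measurable_card_points:
  "k \<in> {1..m} \<Longrightarrow> B \<in> sets borel \<Longrightarrow> bounded B \<Longrightarrow>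
    (\<lambda>\<omega>. card (P k \<omega> \<inter> B)) \<in> measurable \<Omega> (count_space UNIV)"
  by (rule poissonD[THEN conjunct2, THEN conjunct1, rule_format])

lemma prob_card_points:
  "k \<in> {1..m} \<Longrightarrow> B \<in> sets borel \<Longrightarrow> bounded B \<Longrightarrow> B \<subseteq> {0..} \<Longrightarrow>
    prob {\<omega>\<in>space \<Omega>. card (P k \<omega> \<inter> B) = n}
      = (p k * measure lborel B) ^ n / fact n * exp (- (p k * measure lborel B))"
  by (rule poissonD[THEN conjunct2, THEN conjunct2, THEN conjunct1, rule_format]) auto

text \<open>The definition numbers its sets by an initial segment of the naturals; a bijection
  carries independence to an arbitrary finite index set, such as the tagged atoms used
  below.\<close>

lemma indep_vars_card_points:
  fixes B :: "'i \<Rightarrow> real set"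
  assumes k: "k \<in> {1..m}" and I: "finite I" and B: "\<And>i. i \<in> I \<Longrightarrow> B i \<in> sets borel \<and> bounded (B i)"
    and disj: "disjoint_family_on B I"
  shows "indep_vars (\<lambda>_. count_space UNIV) (\<lambda>i \<omega>. card (P k \<omega> \<inter> B i)) I"
proof -
  obtain h where h: "bij_betw h I {..<card I}"
    using ex_bij_betw_finite_nat[OF I] unfolding atLeast0LessThan by blast
  let ?g = "inv_into I h"
  have g: "?g ` {..<card I} = I" "inj_on ?g {..<card I}"
    using bij_betw_inv_into[OF h] by (auto simp: bij_betw_def)
  have "indep_vars (\<lambda>_. count_space UNIV) (\<lambda>i \<omega>. card (P k \<omega> \<inter> B (?g i))) {..<card I}"
  proof -
    have "\<forall>i<card I. B (?g i) \<in> sets borel \<and> bounded (B (?g i))" using B g by blast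
    moreover have "disjoint_family_on (\<lambda>i. B (?g i)) {..<card I}"
      unfolding disjoint_family_on_def
    proof (intro ballI impI)
      fix i j assume "i \<in> {..<card I}" "j \<in> {..<card I}" "i \<noteq> j"
      then have "?g i \<noteq> ?g j" "?g i \<in> I" "?g j \<in> I" using g by (auto simp: inj_on_def)
      then show "B (?g i) \<inter> B (?g j) = {}" using disj by (auto simp: disjoint_family_on_def)
    qed
    ultimately show ?thesis
      by (intro poissonD[OF k, THEN conjunct2, THEN conjunct2, THEN conjunct2, rule_format]) auto
  qed
  then have "indep_vars (\<lambda>_. count_space UNIV) (\<lambda>i \<omega>. card (P k \<omega> \<inter> B (?g i))) (h ` I)"
    using h by (simp add: bij_betw_def)
  moreover have gh: "?g (h i) = i" if "i \<in> I" for i using h that by (simp add: bij_betw_def)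
  ultimately have "indep_sets (\<lambda>i. {(\<lambda>\<omega>. card (P k \<omega> \<inter> B (?g (h i)))) -` A \<inter> space \<Omega> | A. A \<in> sets (count_space UNIV)}) I"
    using h unfolding indep_vars_def2 bij_betw_def by (intro indep_sets_reindex[where h=h]) auto
  then have "indep_sets (\<lambda>i. {(\<lambda>\<omega>. card (P k \<omega> \<inter> B i)) -` A \<inter> space \<Omega> | A. A \<in> sets (count_space UNIV)}) I"
    by (rule indep_sets_cong[THEN iffD1, rotated -1]) (auto simp: gh)
  then show ?thesis
    unfolding indep_vars_def2 using measurable_card_points[OF k] B by auto
qed

text \<open>Overlapping sets of a finite family are cut into atoms, indexed by the members they lie in.\<close>

definition atom :: "(nat \<Rightarrow> real set) \<Rightarrow> nat \<Rightarrow> nat set \<Rightarrow> real set" where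
  "atom B n J = {x. {i. i < n \<and> x \<in> B i} = J}"

lemma atom_sets:
  assumes "\<And>i. i < n \<Longrightarrow> B i \<in> sets borel" "J \<subseteq> {..<n}"
  shows "atom B n J \<in> sets borel"
proof -
  have "atom B n J = {x. \<forall>i<n. (x \<in> B i) = (i \<in> J)}"
    using assms(2) unfolding atom_def by auto
  also have "\<dots> = {x\<in>space borel. \<forall>i\<in>{..<n}. (x \<in> B i) = (i \<in> J)}" by auto
  also have "\<dots> \<in> sets borel"
  proof (rule sets.sets_Collect_finite_All)
    fix i assume "i \<in> {..<n}"
    then have "B i \<in> sets borel" using assms(1) by auto
    moreover have "{x \<in> space borel. (x \<in> B i) = (i \<in> J)} = (if i \<in> J then B i else - B i)" by auto
    ultimately show "{x \<in> space borel. (x \<in> B i) = (i \<in> J)} \<in> sets borel" by auto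
  qed auto
  finally show ?thesis .
qed

text \<open>The atom of \<open>{}\<close> is the complement of all the sets and is unbounded when
  they are bounded. Every other atom inherits boundedness from the sets, which is why
  \<open>{}\<close> is left out below.\<close>

lemma atom_subset: "J \<noteq> {} \<Longrightarrow> atom B n J \<subseteq> (\<Union>i<n. B i)"
  unfolding atom_def by auto

lemma card_eq_sum_atoms:
  assumes k: "k \<in> {1..m}" and \<omega>: "\<omega> \<in> space \<Omega>" and B: "\<And>i. i < n \<Longrightarrow> bounded (B i)" and i: "i < n"
  shows "card (P k \<omega> \<inter> B i) = (\<Sum>J\<in>{J\<in>Pow {..<n}. i \<in> J}. card (P k \<omega> \<inter> atom B n J))"
proof -
  have *: "P k \<omega> \<inter> B i = (\<Union>J\<in>{J\<in>Pow {..<n}. i \<in> J}. P k \<omega> \<inter> atom B n J)"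
    using i unfolding atom_def by auto
  moreover have "bounded (\<Union>i<n. B i)" using B by auto
  then have "finite (P k \<omega> \<inter> atom B n J)" if "i \<in> J" for J
    using that atom_subset[of J B n] finite_points[OF k \<omega>] bounded_subset by blast
  ultimately show ?thesis
    unfolding * by (intro card_UN_disjoint) (auto simp: atom_def)
qed

text \<open>Independence is given for disjoint sets only, while the \<open>B i\<close> may overlap
  among themselves. Every count is a sum of counts over atoms, and the atoms of one family are
  disjoint from those of the other because \<open>S\<close> and \<open>S'\<close> are disjoint. So
  the two events depend on separate groups of independent variables.\<close>

lemma prob_counts_indep:
  fixes B C :: "nat \<Rightarrow> real set"
  assumes k: "k \<in> {1..m}"
    and B: "\<And>i. i < n \<Longrightarrow> B i \<in> sets borel \<and> bounded (B i) \<and> B i \<subseteq> S"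
    and C: "\<And>i. i < n' \<Longrightarrow> C i \<in> sets borel \<and> bounded (C i) \<and> C i \<subseteq> S'"
    and disj: "S \<inter> S' = {}"
  shows "prob ({\<omega>\<in>space \<Omega>. \<forall>i<n. card (P k \<omega> \<inter> B i) = b i} \<inter> {\<omega>\<in>space \<Omega>. \<forall>i<n'. card (P k \<omega> \<inter> C i) = c i})
    = prob {\<omega>\<in>space \<Omega>. \<forall>i<n. card (P k \<omega> \<inter> B i) = b i} * prob {\<omega>\<in>space \<Omega>. \<forall>i<n'. card (P k \<omega> \<inter> C i) = c i}"
proof -
  \<comment> \<open>The Boolean tag tells the atoms of \<open>B\<close> from those of
    \<open>C\<close>, so that one indexed family \<open>D\<close> holds both.\<close>
  define I1 where "I1 = {True} \<times> (Pow {..<n} - {{}})"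
  define I2 where "I2 = {False} \<times> (Pow {..<n'} - {{}})"
  define D where "D = (\<lambda>(d, J). if d then atom B n J else atom C n' J)"
  define N where "N = (\<lambda>j \<omega>. card (P k \<omega> \<inter> D j))"
  have bB: "bounded (\<Union>i<n. B i)" "bounded (\<Union>i<n'. C i)" using B C by auto
  have D: "D j \<in> sets borel \<and> bounded (D j)" if "j \<in> I1 \<union> I2" for j
  proof (cases "fst j")
    case True
    then have "D j = atom B n (snd j)" "snd j \<subseteq> {..<n}" "snd j \<noteq> {}"
      using that by (auto simp: D_def I1_def I2_def)
    then show ?thesis
      using B atom_sets[of n B "snd j"] atom_subset[of "snd j" B n] bounded_subset[OF bB(1)] by auto
  next
    case False
    then have "D j = atom C n' (snd j)" "snd j \<subseteq> {..<n'}" "snd j \<noteq> {}"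
      using that by (auto simp: D_def I1_def I2_def)
    then show ?thesis
      using C atom_sets[of n' C "snd j"] atom_subset[of "snd j" C n'] bounded_subset[OF bB(2)] by auto
  qed
  have D1: "D j \<subseteq> S" if j: "j \<in> I1" for j
  proof -
    have "D j \<subseteq> (\<Union>i<n. B i)"
    proof -
      obtain J where J: "j = (True, J)" "J \<noteq> {}" using j by (auto simp: I1_def)
      then show ?thesis using atom_subset[OF J(2), of B n] by (simp add: D_def)
    qed
    then show ?thesis using B by blast
  qed
  have D2: "D j \<subseteq> S'" if j: "j \<in> I2" for j
  proof -
    have "D j \<subseteq> (\<Union>i<n'. C i)"
    proof -
      obtain J where J: "j = (False, J)" "J \<noteq> {}" using j by (auto simp: I2_def)
      then show ?thesis using atom_subset[OF J(2), of C n'] by (simp add: D_def)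
    qed
    then show ?thesis using C by blast
  qed
  have disjD: "disjoint_family_on D (I1 \<union> I2)"
    unfolding disjoint_family_on_def
  proof (intro ballI impI)
    fix i j assume ij: "i \<in> I1 \<union> I2" "j \<in> I1 \<union> I2" "i \<noteq> j"
    show "D i \<inter> D j = {}"
    proof (cases "fst i = fst j")
      case True
      then have "snd i \<noteq> snd j" using ij(3) by (simp add: prod_eq_iff)
      then show ?thesis using True unfolding D_def atom_def by (auto split: prod.splits)
    next
      case False
      then have "i \<in> I1 \<and> j \<in> I2 \<or> i \<in> I2 \<and> j \<in> I1" using ij by (auto simp: I1_def I2_def)
      then show ?thesis using D1 D2 disj by blast
    qed
  qed
  have fin: "finite (I1 \<union> I2)" unfolding I1_def I2_def by auto
  have iv: "indep_vars (\<lambda>_. count_space UNIV) N (I1 \<union> I2)"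
    unfolding N_def by (rule indep_vars_card_points[OF k fin D disjD])
  let ?M1 = "PiM I1 (\<lambda>_. count_space UNIV :: nat measure)"
  let ?M2 = "PiM I2 (\<lambda>_. count_space UNIV :: nat measure)"
  define V1 where "V1 = (\<lambda>\<omega>. restrict (\<lambda>i. N i \<omega>) I1)"
  define V2 where "V2 = (\<lambda>\<omega>. restrict (\<lambda>i. N i \<omega>) I2)"
  have iv12: "indep_var ?M1 V1 ?M2 V2"
    unfolding V1_def V2_def by (rule indep_var_restrict[OF iv]) (auto simp: I1_def I2_def)
  \<comment> \<open>The conditions on the counts of the \<open>B i\<close>, rewritten as a
    measurable set of vectors of atom counts; this is the form in which independence of
    \<open>V1\<close> and \<open>V2\<close> applies.\<close>
  define A1 where "A1 = {v\<in>space ?M1. \<forall>i\<in>{..<n}. (\<Sum>J\<in>{J\<in>Pow {..<n}. i \<in> J}. v (True, J)) = b i}"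
  define A2 where "A2 = {v\<in>space ?M2. \<forall>i\<in>{..<n'}. (\<Sum>J\<in>{J\<in>Pow {..<n'}. i \<in> J}. v (False, J)) = c i}"
  have A1: "A1 \<in> sets ?M1"
    unfolding A1_def
  proof (rule sets.sets_Collect_finite_All)
    fix i assume i: "i \<in> {..<n}"
    have "(\<lambda>v. v (True, J)) \<in> measurable ?M1 (count_space UNIV)" if "J \<in> {J\<in>Pow {..<n}. i \<in> J}" for J
      by (rule measurable_component_singleton) (use that in \<open>auto simp: I1_def\<close>)
    then show "{v\<in>space ?M1. (\<Sum>J\<in>{J\<in>Pow {..<n}. i \<in> J}. v (True, J)) = b i} \<in> sets ?M1"
      by measurable
  qed auto
  have A2: "A2 \<in> sets ?M2"
    unfolding A2_def
  proof (rule sets.sets_Collect_finite_All)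
    fix i assume i: "i \<in> {..<n'}"
    have "(\<lambda>v. v (False, J)) \<in> measurable ?M2 (count_space UNIV)" if "J \<in> {J\<in>Pow {..<n'}. i \<in> J}" for J
      by (rule measurable_component_singleton) (use that in \<open>auto simp: I2_def\<close>)
    then show "{v\<in>space ?M2. (\<Sum>J\<in>{J\<in>Pow {..<n'}. i \<in> J}. v (False, J)) = c i} \<in> sets ?M2"
      by measurable
  qed auto
  have *: "prob ((\<lambda>x. (V1 x, V2 x)) -` (A1 \<times> A2) \<inter> space \<Omega>)
      = prob (V1 -` A1 \<inter> space \<Omega>) * prob (V2 -` A2 \<inter> space \<Omega>)"
    by (rule indep_varD[OF iv12 A1 A2])
  have s1: "(\<Sum>J\<in>{J\<in>Pow {..<n}. i \<in> J}. V1 \<omega> (True, J)) = card (P k \<omega> \<inter> B i)"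
    if i: "i < n" and \<omega>: "\<omega> \<in> space \<Omega>" for i \<omega>
  proof -
    have "(\<Sum>J\<in>{J\<in>Pow {..<n}. i \<in> J}. V1 \<omega> (True, J)) = (\<Sum>J\<in>{J\<in>Pow {..<n}. i \<in> J}. card (P k \<omega> \<inter> atom B n J))"
    proof (rule sum.cong[OF refl])
      fix J assume "J \<in> {J\<in>Pow {..<n}. i \<in> J}"
      then have "(True, J) \<in> I1" unfolding I1_def by blast
      then show "V1 \<omega> (True, J) = card (P k \<omega> \<inter> atom B n J)" by (simp add: V1_def N_def D_def)
    qed
    then show ?thesis using card_eq_sum_atoms[OF k \<omega> _ i, of B] B by simp
  qed
  have 1: "V1 -` A1 \<inter> space \<Omega> = {\<omega>\<in>space \<Omega>. \<forall>i<n. card (P k \<omega> \<inter> B i) = b i}"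
  proof (intro set_eqI)
    fix \<omega>
    have "V1 \<omega> \<in> space ?M1" by (simp add: V1_def space_PiM)
    then show "\<omega> \<in> V1 -` A1 \<inter> space \<Omega> \<longleftrightarrow> \<omega> \<in> {\<omega>\<in>space \<Omega>. \<forall>i<n. card (P k \<omega> \<inter> B i) = b i}"
      using s1[of _ \<omega>] by (auto simp: A1_def)
  qed
  have s2: "(\<Sum>J\<in>{J\<in>Pow {..<n'}. i \<in> J}. V2 \<omega> (False, J)) = card (P k \<omega> \<inter> C i)"
    if i: "i < n'" and \<omega>: "\<omega> \<in> space \<Omega>" for i \<omega>
  proof -
    have "(\<Sum>J\<in>{J\<in>Pow {..<n'}. i \<in> J}. V2 \<omega> (False, J)) = (\<Sum>J\<in>{J\<in>Pow {..<n'}. i \<in> J}. card (P k \<omega> \<inter> atom C n' J))"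
    proof (rule sum.cong[OF refl])
      fix J assume "J \<in> {J\<in>Pow {..<n'}. i \<in> J}"
      then have "(False, J) \<in> I2" unfolding I2_def by blast
      then show "V2 \<omega> (False, J) = card (P k \<omega> \<inter> atom C n' J)" by (simp add: V2_def N_def D_def)
    qed
    then show ?thesis using card_eq_sum_atoms[OF k \<omega> _ i, of C] C by simp
  qed
  have 2: "V2 -` A2 \<inter> space \<Omega> = {\<omega>\<in>space \<Omega>. \<forall>i<n'. card (P k \<omega> \<inter> C i) = c i}"
  proof (intro set_eqI)
    fix \<omega>
    have "V2 \<omega> \<in> space ?M2" by (simp add: V2_def space_PiM)
    then show "\<omega> \<in> V2 -` A2 \<inter> space \<Omega> \<longleftrightarrow> \<omega> \<in> {\<omega>\<in>space \<Omega>. \<forall>i<n'. card (P k \<omega> \<inter> C i) = c i}"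
      using s2[of _ \<omega>] by (auto simp: A2_def)
  qed
  have 3: "(\<lambda>x. (V1 x, V2 x)) -` (A1 \<times> A2) \<inter> space \<Omega> = (V1 -` A1 \<inter> space \<Omega>) \<inter> (V2 -` A2 \<inter> space \<Omega>)"
    by auto
  show ?thesis using * unfolding 3 1 2 .
qed

section \<open>Sigma-algebras generated by point counts\<close>

lemma sets_points_sigma:
  "sets (points_sigma \<Omega> P I S) = sigma_sets (space \<Omega>)
     {{\<omega>\<in>space \<Omega>. card (P l \<omega> \<inter> B) = n} | l B n. l \<in> I \<and> B \<in> sets borel \<and> bounded B \<and> B \<subseteq> S}"
  unfolding points_sigma_def by (rule sets_measure_of) auto

lemma space_points_sigma [simp]: "space (points_sigma \<Omega> P I S) = space \<Omega>"
  unfolding points_sigma_def by (rule space_measure_of) auto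

lemma sets_points_sigma_mono:
  "I \<subseteq> I' \<Longrightarrow> S \<subseteq> S' \<Longrightarrow> sets (points_sigma \<Omega> P I S) \<subseteq> sets (points_sigma \<Omega> P I' S')"
  unfolding sets_points_sigma by (intro sigma_sets_mono') blast

lemma sets_points_sigma_subset:
  assumes "I \<subseteq> {1..m}"
  shows "sets (points_sigma \<Omega> P I S) \<subseteq> events"
  unfolding sets_points_sigma
proof (rule sets.sigma_sets_subset, safe)
  fix l n and B :: "real set" assume l: "l \<in> I" "B \<in> sets borel" "bounded B"
  have "(\<lambda>\<omega>. card (P l \<omega> \<inter> B)) -` {n} \<inter> space \<Omega> \<in> events"
    using l assms by (intro measurable_sets[OF measurable_card_points]) auto
  also have "(\<lambda>\<omega>. card (P l \<omega> \<inter> B)) -` {n} \<inter> space \<Omega> = {\<omega>\<in>space \<Omega>. card (P l \<omega> \<inter> B) = n}" by auto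
  finally show "{\<omega>\<in>space \<Omega>. card (P l \<omega> \<inter> B) = n} \<in> events" .
qed

lemma card_points_sigma_sets:
  fixes B :: "real set"
  assumes "l \<in> I" "B \<in> sets borel" "bounded B" "B \<subseteq> S"
  shows "(\<lambda>\<omega>. card (P l \<omega> \<inter> B)) \<in> measurable (points_sigma \<Omega> P I S) (count_space UNIV)"
proof (rule measurable_count_space_eq2_countable[THEN iffD2], intro conjI ballI)
  fix n :: nat
  have "(\<lambda>\<omega>. card (P l \<omega> \<inter> B)) -` {n} \<inter> space (points_sigma \<Omega> P I S) = {\<omega>\<in>space \<Omega>. card (P l \<omega> \<inter> B) = n}"
    by auto
  also have "\<dots> \<in> sets (points_sigma \<Omega> P I S)"
    unfolding sets_points_sigma by (rule sigma_sets.Basic) (use assms in blast)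
  finally show "(\<lambda>\<omega>. card (P l \<omega> \<inter> B)) -` {n} \<inter> space (points_sigma \<Omega> P I S) \<in> sets (points_sigma \<Omega> P I S)" .
qed auto

text \<open>Events about a single count are not closed under intersection; finitely many
  simultaneous conditions form a \<pi>-system that generates the same sigma-algebra.\<close>

definition cylinders :: "nat \<Rightarrow> real set \<Rightarrow> 'w set set" where
  "cylinders k S = {{\<omega>\<in>space \<Omega>. \<forall>i<n. card (P k \<omega> \<inter> B i) = b i} | (n :: nat) B b.
     \<forall>i<n. B i \<in> sets borel \<and> bounded (B i) \<and> B i \<subseteq> S}"

lemma Int_stable_cylinders: "Int_stable (cylinders k S)"
proof (rule Int_stableI)
  fix X Y assume "X \<in> cylinders k S" "Y \<in> cylinders k S"
  then obtain n n' :: nat and B C b c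
    where X: "X = {\<omega>\<in>space \<Omega>. \<forall>i<n. card (P k \<omega> \<inter> B i) = b i}"
        "\<forall>i<n. B i \<in> sets borel \<and> bounded (B i) \<and> B i \<subseteq> S"
      and Y: "Y = {\<omega>\<in>space \<Omega>. \<forall>i<n'. card (P k \<omega> \<inter> C i) = c i}"
        "\<forall>i<n'. C i \<in> sets borel \<and> bounded (C i) \<and> C i \<subseteq> S"
    unfolding cylinders_def by blast
  define D where "D = (\<lambda>i. if i < n then B i else C (i - n))"
  define d where "d = (\<lambda>i. if i < n then b i else c (i - n))"
  have split: "(\<forall>i<n + n'. Q i) \<longleftrightarrow> (\<forall>i<n. Q i) \<and> (\<forall>i<n'. Q (n + i))" for Q
  proof (intro iffI conjI allI impI)
    fix i assume *: "(\<forall>i<n. Q i) \<and> (\<forall>i<n'. Q (n + i))" "i < n + n'"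
    show "Q i"
    proof (cases "i < n")
      case False
      then have "i = n + (i - n)" "i - n < n'" using * by auto
      then show ?thesis using * by metis
    qed (use * in auto)
  qed auto
  have "X \<inter> Y = {\<omega>\<in>space \<Omega>. \<forall>i<n + n'. card (P k \<omega> \<inter> D i) = d i}"
    unfolding X Y split by (auto simp: D_def d_def)
  moreover have "\<forall>i<n + n'. D i \<in> sets borel \<and> bounded (D i) \<and> D i \<subseteq> S"
    unfolding split using X Y by (auto simp: D_def)
  ultimately show "X \<inter> Y \<in> cylinders k S"
    unfolding cylinders_def by blast
qed

lemma cylinders_subset: "cylinders k S \<subseteq> sets (points_sigma \<Omega> P {k} S)"
proof
  fix X assume "X \<in> cylinders k S"
  then obtain n :: nat and B b
    where X: "X = {\<omega>\<in>space \<Omega>. \<forall>i<n. card (P k \<omega> \<inter> B i) = b i}"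
        "\<forall>i<n. B i \<in> sets borel \<and> bounded (B i) \<and> B i \<subseteq> S"
    unfolding cylinders_def by blast
  have "{\<omega>\<in>space (points_sigma \<Omega> P {k} S). \<forall>i\<in>{..<n}. card (P k \<omega> \<inter> B i) = b i} \<in> sets (points_sigma \<Omega> P {k} S)"
  proof (rule sets.sets_Collect_finite_All)
    fix i assume "i \<in> {..<n}"
    then have "{\<omega>\<in>space \<Omega>. card (P k \<omega> \<inter> B i) = b i} \<in> sets (points_sigma \<Omega> P {k} S)"
      unfolding sets_points_sigma using X by (intro sigma_sets.Basic) blast
    then show "{\<omega>\<in>space (points_sigma \<Omega> P {k} S). card (P k \<omega> \<inter> B i) = b i} \<in> sets (points_sigma \<Omega> P {k} S)"
      by simp
  qed auto
  then show "X \<in> sets (points_sigma \<Omega> P {k} S)"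
    unfolding X(1) by (simp only: space_points_sigma Ball_def lessThan_iff)
qed

lemma sets_points_sigma_single: "sets (points_sigma \<Omega> P {k} S) = sigma_sets (space \<Omega>) (cylinders k S)"
proof
  show "sets (points_sigma \<Omega> P {k} S) \<subseteq> sigma_sets (space \<Omega>) (cylinders k S)"
    unfolding sets_points_sigma
  proof (rule sigma_sets_mono', rule subsetI)
    fix X assume "X \<in> {{\<omega>\<in>space \<Omega>. card (P l \<omega> \<inter> B) = n} | l B n.
        l \<in> {k} \<and> B \<in> sets borel \<and> bounded B \<and> B \<subseteq> S}"
    then obtain n and B :: "real set"
      where X: "X = {\<omega>\<in>space \<Omega>. card (P k \<omega> \<inter> B) = n}" and B: "B \<in> sets borel" "bounded B" "B \<subseteq> S"
      by blast
    have "X = {\<omega>\<in>space \<Omega>. \<forall>i<(1::nat). card (P k \<omega> \<inter> B) = n}"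
      unfolding X by simp
    also have "\<dots> \<in> cylinders k S" unfolding cylinders_def using B
      by (intro CollectI exI[of _ "1::nat"] exI[of _ "\<lambda>_. B"] exI[of _ "\<lambda>_. n"]) auto
    finally show "X \<in> cylinders k S" .
  qed
  show "sigma_sets (space \<Omega>) (cylinders k S) \<subseteq> sets (points_sigma \<Omega> P {k} S)"
    using sets.sigma_sets_subset[OF cylinders_subset] by simp
qed

lemma indep_points_sigma_single:
  assumes k: "k \<in> {1..m}" and disj: "S \<inter> S' = {}"
  shows "indep_set (sets (points_sigma \<Omega> P {k} S)) (sets (points_sigma \<Omega> P {k} S'))"
  unfolding sets_points_sigma_single
proof (rule indep_set_sigma_sets)
  have ev: "cylinders k S \<subseteq> events" for S
    by (rule order_trans[OF cylinders_subset sets_points_sigma_subset]) (use k in simp)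
  show "indep_set (cylinders k S) (cylinders k S')"
  proof (rule indep_setI)
    fix X Y assume XY: "X \<in> cylinders k S" "Y \<in> cylinders k S'"
    obtain n :: nat and B b where X: "X = {\<omega>\<in>space \<Omega>. \<forall>i<n. card (P k \<omega> \<inter> B i) = b i}"
        "\<forall>i<n. B i \<in> sets borel \<and> bounded (B i) \<and> B i \<subseteq> S"
      using XY(1) unfolding cylinders_def by blast
    obtain n' :: nat and C c where Y: "Y = {\<omega>\<in>space \<Omega>. \<forall>i<n'. card (P k \<omega> \<inter> C i) = c i}"
        "\<forall>i<n'. C i \<in> sets borel \<and> bounded (C i) \<and> C i \<subseteq> S'"
      using XY(2) unfolding cylinders_def by blast
    show "prob (X \<inter> Y) = prob X * prob Y"
      unfolding X(1) Y(1) by (rule prob_counts_indep[OF k X(2)[rule_format] Y(2)[rule_format] disj])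
  qed (rule ev)+
qed (rule Int_stable_cylinders)+

text \<open>Two sources of independence are combined: different processes are independent on the
  whole time axis, and each process is independent over \<open>S\<close> and \<open>S'\<close>. The
  sigma-algebras are indexed by pairs of a process and a time set, shown to be jointly independent,
  and then collected along the second coordinate.\<close>

lemma indep_points_sigma:
  assumes disj: "S \<inter> S' = {}"
  shows "indep_set (sets (F S)) (sets (F S'))"
proof -
  let ?S = "\<lambda>d. if d then S else S'"
  define H where "H = (\<lambda>(k, d). sets (points_sigma \<Omega> P {k} (?S d)))"
  have "indep_sets H ({1..m} \<times> UNIV)"
  proof (rule indep_setsI)
    show "H i \<subseteq> events" if "i \<in> {1..m} \<times> UNIV" for i
      using that sets_points_sigma_subset[of "{fst i}" "?S (snd i)"] by (auto simp: H_def)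
  next
    fix A J assume J: "J \<noteq> {}" "J \<subseteq> {1..m} \<times> (UNIV :: bool set)" "finite J" "\<forall>j\<in>J. A j \<in> H j"
    \<comment> \<open>Padding with the whole space completes \<open>J\<close> to a full product of
      processes and time sets, whose intersection can be split first by process and then by time
      set.\<close>
    define A' where "A' = (\<lambda>j. if j \<in> J then A j else space \<Omega>)"
    let ?K = "fst ` J"
    have K: "?K \<subseteq> {1..m}" "?K \<noteq> {}" "finite ?K" using J by auto
    have A': "A' (k, d) \<in> sets (points_sigma \<Omega> P {k} (?S d))" for k d
      using J(4)[rule_format, of "(k, d)"] sets.top[of "points_sigma \<Omega> P {k} (?S d)"]
      by (simp add: A'_def H_def)
    have sub: "sets (points_sigma \<Omega> P {k} (?S d)) \<subseteq> sets (points_sigma \<Omega> P {k} UNIV)" for k d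
      by (rule sets_points_sigma_mono) auto
    have "(\<Inter>j\<in>J. A j) = (\<Inter>k\<in>?K. A' (k, True) \<inter> A' (k, False))"
    proof
      have sp: "A j \<subseteq> space \<Omega>" if "j \<in> J" for j
        using J(4) that sets.sets_into_space[of "A j" "points_sigma \<Omega> P {fst j} (?S (snd j))"]
        by (simp add: H_def case_prod_beta)
      obtain j0 where j0: "j0 \<in> J" using J(1) by blast
      show "(\<Inter>j\<in>J. A j) \<subseteq> (\<Inter>k\<in>?K. A' (k, True) \<inter> A' (k, False))"
      proof (rule subsetI)
        fix x assume x: "x \<in> (\<Inter>j\<in>J. A j)"
        then have "x \<in> space \<Omega>" using sp[OF j0] j0 by blast
        then have "x \<in> A' (k, d)" for k d using x by (simp add: A'_def)
        then show "x \<in> (\<Inter>k\<in>?K. A' (k, True) \<inter> A' (k, False))" by simp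
      qed
      show "(\<Inter>k\<in>?K. A' (k, True) \<inter> A' (k, False)) \<subseteq> (\<Inter>j\<in>J. A j)"
      proof (rule subsetI, rule INT_I)
        fix x j assume x: "x \<in> (\<Inter>k\<in>?K. A' (k, True) \<inter> A' (k, False))" and j: "j \<in> J"
        have "x \<in> A' (fst j, True) \<inter> A' (fst j, False)" using x imageI[OF j, of fst] by (rule INT_D)
        then have "x \<in> A' (fst j, snd j)" by (cases "snd j") simp_all
        then show "x \<in> A j" using j by (simp add: A'_def)
      qed
    qed
    also have "prob \<dots> = (\<Prod>k\<in>?K. prob (A' (k, True) \<inter> A' (k, False)))"
    proof (rule indep_setsD)
      show "indep_sets (\<lambda>k. sets (points_sigma \<Omega> P {k} UNIV)) {1..m}"
        using indep_poisson unfolding independent_poisson_processes_def by blast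
      show "\<forall>j\<in>?K. A' (j, True) \<inter> A' (j, False) \<in> sets (points_sigma \<Omega> P {j} UNIV)"
        using A' sub by blast
    qed (use K in auto)
    also have "\<dots> = (\<Prod>k\<in>?K. \<Prod>d\<in>UNIV. prob (A' (k, d)))"
    proof (rule prod.cong)
      fix k assume "k \<in> ?K"
      then have "k \<in> {1..m}" using K by auto
      then have "prob (A' (k, True) \<inter> A' (k, False)) = prob (A' (k, True)) * prob (A' (k, False))"
        using A'[of k True] A'[of k False] by (intro indep_setD[OF indep_points_sigma_single[OF _ disj]]) auto
      then show "prob (A' (k, True) \<inter> A' (k, False)) = (\<Prod>d\<in>UNIV. prob (A' (k, d)))"
        by (simp add: UNIV_bool mult.commute)
    qed simp
    also have "\<dots> = (\<Prod>j\<in>?K \<times> UNIV. prob (A' j))"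
      by (subst prod.cartesian_product) (auto intro!: prod.cong)
    also have "\<dots> = (\<Prod>j\<in>J. prob (A j))"
    proof (rule prod.mono_neutral_cong_right)
      show "J \<subseteq> ?K \<times> UNIV" by force
    qed (use K prob_space in \<open>auto simp: A'_def\<close>)
    finally show "prob (\<Inter>j\<in>J. A j) = (\<Prod>j\<in>J. prob (A j))" .
  qed
  moreover have "(\<Union>d. {1..m} \<times> {d}) = {1..m} \<times> (UNIV :: bool set)" by auto
  ultimately have "indep_sets (\<lambda>d. sigma_sets (space \<Omega>) (\<Union>i\<in>{1..m} \<times> {d}. H i)) (UNIV :: bool set)"
  proof (intro indep_sets_collect_sigma)
    show "Int_stable (H i)" for i
      by (auto simp: H_def Int_stable_def split: prod.splits)
  qed (auto simp: disjoint_family_on_def)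
  then show ?thesis
    unfolding indep_set_def
  proof (rule indep_sets_mono_sets)
    fix d :: bool
    have "sets (F (?S d)) \<subseteq> sigma_sets (space \<Omega>) (\<Union>i\<in>{1..m} \<times> {d}. H i)"
      unfolding sets_points_sigma[of "{1..m}"]
    proof (rule sigma_sets_mono', safe)
      fix l n and B :: "real set" assume B: "l \<in> {1..m}" "B \<in> sets borel" "bounded B" "B \<subseteq> ?S d"
      then have "{\<omega>\<in>space \<Omega>. card (P l \<omega> \<inter> B) = n} \<in> H (l, d)"
        unfolding H_def prod.case sets_points_sigma by (intro sigma_sets.Basic) blast
      then show "{\<omega>\<in>space \<Omega>. card (P l \<omega> \<inter> B) = n} \<in> (\<Union>i\<in>{1..m} \<times> {d}. H i)"
        using B(1) by blast
    qed
    then show "(case d of True \<Rightarrow> sets (F S) | False \<Rightarrow> sets (F S')) \<subseteq> sigma_sets (space \<Omega>) (\<Union>i\<in>{1..m} \<times> {d}. H i)"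
      by (cases d) auto
  qed
qed

lemma subalgebra_F: "subalgebra \<Omega> (F S)"
  unfolding subalgebra_def using sets_points_sigma_subset[OF order_refl] by simp

lemma nn_integral_mult_indep:
  fixes f g :: "'w \<Rightarrow> ennreal"
  assumes disj: "S \<inter> S' = {}" and f: "f \<in> borel_measurable (F S)" and g: "g \<in> borel_measurable (F S')"
  shows "(\<integral>\<^sup>+\<omega>. f \<omega> * g \<omega> \<partial>\<Omega>) = (\<integral>\<^sup>+\<omega>. f \<omega> \<partial>\<Omega>) * (\<integral>\<^sup>+\<omega>. g \<omega> \<partial>\<Omega>)"
proof -
  have meas: "h \<in> borel_measurable \<Omega>" if "h \<in> borel_measurable (F S)" for h :: "'w \<Rightarrow> ennreal" and S
    by (rule measurable_from_subalg[OF subalgebra_F that])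
  have sub: "sigma_sets (space \<Omega>) {h -` A \<inter> space \<Omega> | A. A \<in> sets borel} \<subseteq> sets (F S)"
    if h: "h \<in> borel_measurable (F S)" for h :: "'w \<Rightarrow> ennreal" and S
  proof -
    have "{h -` A \<inter> space (F S) | A. A \<in> sets borel} \<subseteq> sets (F S)"
      using measurable_sets[OF h] by blast
    from sets.sigma_sets_subset[OF this] show ?thesis by simp
  qed
  have "indep_set (sigma_sets (space \<Omega>) {f -` A \<inter> space \<Omega> | A. A \<in> sets borel})
      (sigma_sets (space \<Omega>) {g -` A \<inter> space \<Omega> | A. A \<in> sets borel})"
  proof (rule indep_setI)
    show "prob (a \<inter> b) = prob a * prob b"
      if "a \<in> sigma_sets (space \<Omega>) {f -` A \<inter> space \<Omega> | A. A \<in> sets borel}"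
        "b \<in> sigma_sets (space \<Omega>) {g -` A \<inter> space \<Omega> | A. A \<in> sets borel}" for a b
      by (rule indep_setD[OF indep_points_sigma[OF disj]]) (use that sub[OF f] sub[OF g] in blast)+
  qed (use sub[OF f] sub[OF g] sets_points_sigma_subset[OF order_refl] in blast)+
  then have "indep_var borel f borel g"
    unfolding indep_var_eq using meas[OF f] meas[OF g] by simp
  then have iv: "indep_vars (\<lambda>_. borel) (case_bool f g) UNIV"
    unfolding indep_var_def by (rule indep_vars_cong[THEN iffD1, rotated -1]) (auto split: bool.split)
  have "(\<integral>\<^sup>+\<omega>. (\<Prod>d\<in>UNIV. case_bool f g d \<omega>) \<partial>\<Omega>) = (\<Prod>d\<in>UNIV. \<integral>\<^sup>+\<omega>. case_bool f g d \<omega> \<partial>\<Omega>)"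
    by (rule indep_vars_nn_integral[OF _ iv]) auto
  then show ?thesis by (simp add: UNIV_bool mult.commute)
qed

section \<open>Moments of Poisson counts\<close>

lemma nn_integral_card_points:
  assumes k: "k \<in> {1..m}" and B: "B \<in> sets borel" "bounded B" "B \<subseteq> {0..}"
  shows "(\<integral>\<^sup>+\<omega>. f (card (P k \<omega> \<inter> B)) \<partial>\<Omega>) = (\<Sum>n. f n * ennreal ((p k * measure lborel B) ^ n / fact n * exp (- (p k * measure lborel B))))"
proof -
  have [measurable]: "(\<lambda>\<omega>. card (P k \<omega> \<inter> B)) \<in> measurable \<Omega> (count_space UNIV)"
    by (rule measurable_card_points[OF k B(1,2)])
  let ?N = "\<lambda>n. {\<omega>\<in>space \<Omega>. card (P k \<omega> \<inter> B) = n}"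
  have "(\<integral>\<^sup>+\<omega>. f (card (P k \<omega> \<inter> B)) \<partial>\<Omega>) = (\<integral>\<^sup>+\<omega>. (\<Sum>n. f n * indicator (?N n) \<omega>) \<partial>\<Omega>)"
  proof (rule nn_integral_cong)
    fix \<omega> assume \<omega>: "\<omega> \<in> space \<Omega>"
    have "(\<Sum>n. f n * indicator (?N n) \<omega>) = (\<Sum>n\<in>{card (P k \<omega> \<inter> B)}. f n * indicator (?N n) \<omega>)"
      using \<omega> by (intro suminf_finite) (auto simp: indicator_def)
    then show "f (card (P k \<omega> \<inter> B)) = (\<Sum>n. f n * indicator (?N n) \<omega>)" using \<omega> by simp
  qed
  also have "\<dots> = (\<Sum>n. \<integral>\<^sup>+\<omega>. f n * indicator (?N n) \<omega> \<partial>\<Omega>)"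
    by (rule nn_integral_suminf) measurable
  also have "\<dots> = (\<Sum>n. f n * emeasure \<Omega> (?N n))"
    by (intro suminf_cong nn_integral_cmult_indicator) measurable
  also have "\<dots> = (\<Sum>n. f n * ennreal ((p k * measure lborel B) ^ n / fact n * exp (- (p k * measure lborel B))))"
    unfolding emeasure_eq_measure prob_card_points[OF k B] ..
  finally show ?thesis .
qed

text \<open>The probability generating function of the Poisson distribution. It is finite for every
  \<open>a\<close>, however large, which is what the growth bound on the paths will need.\<close>

lemma nn_integral_power_card:
  assumes k: "k \<in> {1..m}" and B: "B \<in> sets borel" "bounded B" "B \<subseteq> {0..}" and a: "a \<ge> 0"
  shows "(\<integral>\<^sup>+\<omega>. ennreal (a ^ card (P k \<omega> \<inter> B)) \<partial>\<Omega>) = ennreal (exp (p k * measure lborel B * (a - 1)))"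
proof -
  define c where "c = p k * measure lborel B"
  have c: "c \<ge> 0" using intensity_pos[OF k] by (simp add: c_def)
  have "(\<integral>\<^sup>+\<omega>. ennreal (a ^ card (P k \<omega> \<inter> B)) \<partial>\<Omega>) = (\<Sum>n. ennreal (a ^ n) * ennreal (c ^ n / fact n * exp (- c)))"
    unfolding c_def by (rule nn_integral_card_points[OF k B])
  also have "\<dots> = (\<Sum>n. ennreal (exp (- c) * ((a * c) ^ n /\<^sub>R fact n)))"
  proof (intro suminf_cong)
    fix n
    have "ennreal (a ^ n) * ennreal (c ^ n / fact n * exp (- c)) = ennreal (a ^ n * (c ^ n / fact n * exp (- c)))"
      using a c by (intro ennreal_mult[symmetric]) auto
    also have "a ^ n * (c ^ n / fact n * exp (- c)) = exp (- c) * ((a * c) ^ n /\<^sub>R fact n)"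
      by (simp add: power_mult_distrib divide_inverse)
    finally show "ennreal (a ^ n) * ennreal (c ^ n / fact n * exp (- c)) = ennreal (exp (- c) * ((a * c) ^ n /\<^sub>R fact n))" .
  qed
  also have "\<dots> = ennreal (exp (- c) * exp (a * c))"
    using a c by (intro suminf_ennreal_eq sums_mult exp_converges) auto
  also have "exp (- c) * exp (a * c) = exp (c * (a - 1))"
    by (simp add: exp_add[symmetric] algebra_simps)
  finally show ?thesis unfolding c_def .
qed

lemma nn_integral_card:
  assumes k: "k \<in> {1..m}" and B: "B \<in> sets borel" "bounded B" "B \<subseteq> {0..}"
  shows "(\<integral>\<^sup>+\<omega>. ennreal (card (P k \<omega> \<inter> B)) \<partial>\<Omega>) = ennreal (p k * measure lborel B)"
proof -
  define c where "c = p k * measure lborel B"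
  have c: "c \<ge> 0" using intensity_pos[OF k] by (simp add: c_def)
  \<comment> \<open>The mean by an index shift: \<open>Suc n\<close> cancels against the factorial,
    which leaves \<open>c\<close> times the total mass, and the term for 0 vanishes.\<close>
  have "(\<lambda>n. c ^ n /\<^sub>R fact n) sums exp c" by (rule exp_converges)
  then have "(\<lambda>n. exp (- c) * c * (c ^ n /\<^sub>R fact n)) sums (exp (- c) * c * exp c)"
    by (rule sums_mult)
  moreover have "(\<lambda>n. exp (- c) * c * (c ^ n /\<^sub>R fact n)) = (\<lambda>n. real (Suc n) * (c ^ Suc n / fact (Suc n) * exp (- c)))"
    by (auto simp: fun_eq_iff field_simps simp del: of_nat_Suc)
  moreover have "exp (- c) * c * exp c = c" by (simp add: exp_minus)
  ultimately have "(\<lambda>n. real (Suc n) * (c ^ Suc n / fact (Suc n) * exp (- c))) sums c" by simp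
  then have s: "(\<lambda>n. real n * (c ^ n / fact n * exp (- c))) sums c"
    using sums_Suc[of "\<lambda>n. real n * (c ^ n / fact n * exp (- c))" c] by simp
  have "(\<integral>\<^sup>+\<omega>. ennreal (card (P k \<omega> \<inter> B)) \<partial>\<Omega>) = (\<Sum>n. ennreal (real n) * ennreal (c ^ n / fact n * exp (- c)))"
    unfolding c_def by (rule nn_integral_card_points[OF k B])
  also have "\<dots> = (\<Sum>n. ennreal (real n * (c ^ n / fact n * exp (- c))))"
    using c by (intro suminf_cong ennreal_mult[symmetric]) auto
  also have "\<dots> = ennreal c"
    using c s by (intro suminf_ennreal_eq) auto
  finally show ?thesis unfolding c_def .
qed

section \<open>Predictable processes and the compensation formula\<close>

abbreviation "Pred \<equiv> predictable_sigma \<Omega> m P"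

text \<open>Names the generators of \<open>predictable_sigma\<close>. They are closed under
  intersection, so claims about predictable sets can be proved by induction over complements and
  disjoint unions.\<close>

definition pred_rects :: "(real \<times> 'w) set set" where
  "pred_rects = {{0} \<times> A | A. A \<in> sets (F {..0})} \<union>
      {{s<..t} \<times> A | s t A. 0 \<le> s \<and> s \<le> t \<and> A \<in> sets (F {..s})}"

lemma F_into_space: "A \<in> sets (F S) \<Longrightarrow> A \<subseteq> space \<Omega>"
  using sets.sets_into_space[of A "F S"] by simp

lemma F_events: "A \<in> sets (F S) \<Longrightarrow> A \<in> events"
  by (rule subsetD[OF sets_points_sigma_subset[OF order_refl]])

lemma F_mono: "S \<subseteq> S' \<Longrightarrow> A \<in> sets (F S) \<Longrightarrow> A \<in> sets (F S')"
  by (rule subsetD[OF sets_points_sigma_mono[OF order_refl]])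

lemma measurable_F_mono: "S \<subseteq> S' \<Longrightarrow> f \<in> measurable (F S) N \<Longrightarrow> f \<in> measurable (F S') N"
  by (rule measurable_from_subalg[rotated])
    (auto simp: subalgebra_def intro: subsetD[OF sets_points_sigma_mono[OF order_refl]])

lemma pred_rect_cases:
  assumes "Q \<in> pred_rects"
  obtains A where "Q = {0} \<times> A" "A \<in> sets (F {..0})"
    | s t A where "Q = {s<..t} \<times> A" "0 \<le> s" "s \<le> t" "A \<in> sets (F {..s})"
  using assms unfolding pred_rects_def by blast

lemma pred_rects_zero: "A \<in> sets (F {..0}) \<Longrightarrow> {0} \<times> A \<in> pred_rects"
  unfolding pred_rects_def by blast

lemma pred_rects_rect: "0 \<le> s \<Longrightarrow> s \<le> t \<Longrightarrow> A \<in> sets (F {..s}) \<Longrightarrow> {s<..t} \<times> A \<in> pred_rects"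
  unfolding pred_rects_def by blast

lemma pred_rects_Pow: "pred_rects \<subseteq> Pow ({0..} \<times> space \<Omega>)"
proof
  fix Q assume "Q \<in> pred_rects"
  then show "Q \<in> Pow ({0..} \<times> space \<Omega>)"
  proof (cases rule: pred_rect_cases)
    case (1 A)
    then show ?thesis using F_into_space[of A "{..0}"] by auto
  next
    case (2 s t A)
    then show ?thesis using F_into_space[of A "{..s}"] by auto
  qed
qed

lemma sets_Pred: "sets Pred = sigma_sets ({0..} \<times> space \<Omega>) pred_rects"
  unfolding predictable_sigma_def pred_rects_def[symmetric] using pred_rects_Pow by (rule sets_measure_of)

lemma space_Pred [simp]: "space Pred = {0..} \<times> space \<Omega>"
  unfolding predictable_sigma_def pred_rects_def[symmetric] using pred_rects_Pow by (rule space_measure_of)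

lemma Pred_rect: "0 \<le> s \<Longrightarrow> A \<in> sets (F {..s}) \<Longrightarrow> {s<..t} \<times> A \<in> sets Pred"
proof (cases "s \<le> t")
  case True
  assume "0 \<le> s" "A \<in> sets (F {..s})"
  then show ?thesis unfolding sets_Pred using True by (intro sigma_sets.Basic pred_rects_rect)
next
  case False
  then have "{s<..t} = {}" by simp
  then show ?thesis by simp
qed

lemma Pred_zero: "A \<in> sets (F {..0}) \<Longrightarrow> {0} \<times> A \<in> sets Pred"
  unfolding sets_Pred by (intro sigma_sets.Basic pred_rects_zero)

lemma Int_stable_pred_rects: "Int_stable pred_rects"
proof (rule Int_stableI)
  fix Q R assume QR: "Q \<in> pred_rects" "R \<in> pred_rects"
  have empty: "{} \<in> pred_rects"
    using pred_rects_zero[OF sets.empty_sets] by simp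
  from QR(1) show "Q \<inter> R \<in> pred_rects"
  proof (cases rule: pred_rect_cases)
    case Q: (1 A)
    from QR(2) show ?thesis
    proof (cases rule: pred_rect_cases)
      case R: (1 B)
      have "Q \<inter> R = {0} \<times> (A \<inter> B)" using Q R by auto
      then show ?thesis using pred_rects_zero[OF sets.Int[OF Q(2) R(2)]] by simp
    next
      case (2 s t B)
      then have "Q \<inter> R = {}" using Q by auto
      then show ?thesis using empty by simp
    qed
  next
    case Q: (2 s t A)
    from QR(2) show ?thesis
    proof (cases rule: pred_rect_cases)
      case (1 B)
      then have "Q \<inter> R = {}" using Q by auto
      then show ?thesis using empty by simp
    next
      case R: (2 s' t' B)
      show ?thesis
      proof (cases "max s s' \<le> min t t'")
        case True
        have "A \<in> sets (F {..max s s'})" by (rule F_mono[OF _ Q(4)]) auto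
        moreover have "B \<in> sets (F {..max s s'})" by (rule F_mono[OF _ R(4)]) auto
        ultimately have "A \<inter> B \<in> sets (F {..max s s'})" by (rule sets.Int)
        moreover have "Q \<inter> R = {max s s'<..min t t'} \<times> (A \<inter> B)" using Q R by auto
        moreover have "0 \<le> max s s'" using Q by auto
        ultimately show ?thesis using pred_rects_rect[OF _ True] by simp
      next
        case False
        then have "Q \<inter> R = {}" using Q R by auto
        then show ?thesis using empty by simp
      qed
    qed
  qed
qed

section \<open>Joint measurability and left-continuous processes\<close>

lemma Pred_subset_pair: "Q \<in> sets Pred \<Longrightarrow> Q \<in> sets (lborel \<Otimes>\<^sub>M \<Omega>)"
proof -
  have S: "{0::real..} \<times> space \<Omega> \<in> sets (lborel \<Otimes>\<^sub>M \<Omega>)" by (intro pair_measureI) auto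
  assume "Q \<in> sets Pred"
  then have "Q \<in> sigma_sets ({0..} \<times> space \<Omega>) pred_rects" unfolding sets_Pred .
  then show ?thesis
  proof induct
    case (Basic a)
    then show ?case
    proof (cases rule: pred_rect_cases)
      case (1 A)
      then show ?thesis by (auto intro!: pair_measureI F_events)
    next
      case (2 s t A)
      then show ?thesis by (auto intro!: pair_measureI F_events)
    qed
  next
    case (Compl a)
    then show ?case using S by (intro sets.Diff)
  qed auto
qed

text \<open>\<open>Pred\<close> lives on nonnegative times only, while the product with
  \<open>lborel\<close> has all of them; cutting the function off outside \<open>S\<close> makes
  measurability on the larger space meaningful.\<close>

lemma Pred_measurable_pair:
  fixes H :: "real \<times> 'w \<Rightarrow> 'b :: {topological_space, zero}"
  assumes H: "H \<in> borel_measurable Pred" and S: "S \<in> sets borel" "S \<subseteq> {0..}"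
  shows "(\<lambda>x. if fst x \<in> S then H x else 0) \<in> borel_measurable (lborel \<Otimes>\<^sub>M \<Omega>)"
proof (rule measurable_If_restrict_space_iff[THEN iffD2])
  let ?M = "lborel \<Otimes>\<^sub>M \<Omega>"
  have SS: "S \<times> space \<Omega> \<in> sets ?M" using S by (auto intro: pair_measureI)
  have eq: "{x \<in> space ?M. fst x \<in> S} = S \<times> space \<Omega>" "{x. fst x \<in> S} \<inter> space ?M = S \<times> space \<Omega>"
    by (auto simp: space_pair_measure)
  show "{x \<in> space ?M. fst x \<in> S} \<in> sets ?M" unfolding eq by (rule SS)
  have "H \<in> measurable (restrict_space ?M {x. fst x \<in> S}) borel"
  proof (rule measurableI)
    fix B :: "'b set" assume B: "B \<in> sets borel"
    have "H -` B \<inter> space (restrict_space ?M {x. fst x \<in> S}) = (H -` B \<inter> space Pred) \<inter> (S \<times> space \<Omega>)"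
      using S by (auto simp: space_restrict_space space_pair_measure)
    also have "\<dots> \<in> sets ?M"
      using Pred_subset_pair[OF measurable_sets[OF H B]] SS by blast
    finally show "H -` B \<inter> space (restrict_space ?M {x. fst x \<in> S}) \<in> sets (restrict_space ?M {x. fst x \<in> S})"
      using SS eq(2) by (subst sets_restrict_space_iff) (auto simp: space_restrict_space)
  qed simp
  then show "(\<lambda>x. H x) \<in> measurable (restrict_space ?M {x. fst x \<in> S}) borel \<and>
      (\<lambda>x. 0) \<in> measurable (restrict_space ?M {x. \<not> fst x \<in> S}) borel"
    by simp
qed

text \<open>A step process that holds, on each grid interval, the value at the left endpoint has
  preimages that are countable unions of predictable rectangles. Left continuity makes these step
  processes converge pointwise as the mesh shrinks.\<close>

lemma left_continuous_predictable:
  fixes Y :: "real \<Rightarrow> 'w \<Rightarrow> 'b::metric_space"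
  assumes adapted: "\<And>t. 0 \<le> t \<Longrightarrow> Y t \<in> borel_measurable (F {..t})"
    and left: "\<And>t \<omega>. 0 < t \<Longrightarrow> \<omega> \<in> space \<Omega> \<Longrightarrow> ((\<lambda>s. Y s \<omega>) \<longlongrightarrow> Y t \<omega>) (at_left t)"
  shows "(\<lambda>(t, \<omega>). Y t \<omega>) \<in> borel_measurable Pred"
proof (rule borel_measurable_LIMSEQ_metric)
  \<comment> \<open>For positive \<open>t\<close> this is the largest grid point of mesh
    \<open>1 / real (Suc n)\<close> strictly below \<open>t\<close>. Strictness places
    \<open>t\<close> in a cell that is open on the left and closed on the right, the shape of the
    generators. At time 0 no nonnegative grid point lies below, hence the separate case
    \<open>Y 0\<close>.\<close>
  define g where "g = (\<lambda>(n::nat) t. (of_int \<lceil>t * real (Suc n)\<rceil> - 1) / real (Suc n))"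
  let ?Z = "\<lambda>n (t, \<omega>). if t = 0 then Y 0 \<omega> else Y (g n t) \<omega>"
  have g_eq: "g n t = real j / real (Suc n)" if t: "t \<in> {real j / real (Suc n)<..real (Suc j) / real (Suc n)}" for n t j
  proof -
    have "real j < t * real (Suc n)" "t * real (Suc n) \<le> real (Suc j)"
      using t by (auto simp: field_simps simp del: of_nat_Suc)
    then have "\<lceil>t * real (Suc n)\<rceil> = int (Suc j)" by (intro ceiling_unique) auto
    then show ?thesis by (simp add: g_def)
  qed
  show "?Z n \<in> borel_measurable Pred" for n
  proof (rule measurableI)
    fix B :: "'b set" assume B: "B \<in> sets borel"
    let ?Q = "\<lambda>j::nat. {real j / real (Suc n)<..real (Suc j) / real (Suc n)} \<times> (Y (real j / real (Suc n)) -` B \<inter> space \<Omega>)"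
    have "?Z n -` B \<inter> space Pred = ({0} \<times> (Y 0 -` B \<inter> space \<Omega>)) \<union> (\<Union>j. ?Q j)"
    proof (intro set_eqI iffI)
      fix x assume x: "x \<in> ?Z n -` B \<inter> space Pred"
      obtain t \<omega> where tw: "x = (t, \<omega>)" "t \<ge> 0" "\<omega> \<in> space \<Omega>" using x by auto
      show "x \<in> ({0} \<times> (Y 0 -` B \<inter> space \<Omega>)) \<union> (\<Union>j. ?Q j)"
      proof (cases "t = 0")
        case False
        then have "t * real (Suc n) > 0" using tw by simp
        then have c: "\<lceil>t * real (Suc n)\<rceil> \<ge> 1" by simp
        define j where "j = nat (\<lceil>t * real (Suc n)\<rceil> - 1)"
        have "real j < t * real (Suc n)" "t * real (Suc n) \<le> real (Suc j)"
          using c unfolding j_def by (simp_all add: of_nat_nat) linarith+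
        then have tj: "t \<in> {real j / real (Suc n)<..real (Suc j) / real (Suc n)}"
          by (auto simp: field_simps simp del: of_nat_Suc)
        then have "x \<in> ?Q j" using g_eq[OF tj] x tw False by auto
        then show ?thesis by blast
      qed (use x tw in auto)
    next
      fix x assume "x \<in> ({0} \<times> (Y 0 -` B \<inter> space \<Omega>)) \<union> (\<Union>j. ?Q j)"
      then show "x \<in> ?Z n -` B \<inter> space Pred"
      proof
        assume "x \<in> (\<Union>j. ?Q j)"
        then obtain j where j: "x \<in> ?Q j" by blast
        then obtain t \<omega> where tw: "x = (t, \<omega>)" and t: "t \<in> {real j / real (Suc n)<..real (Suc j) / real (Suc n)}"
          and \<omega>: "\<omega> \<in> Y (real j / real (Suc n)) -` B \<inter> space \<Omega>" by blast
        have "0 \<le> real j / real (Suc n)" by simp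
        then have "t > 0" using t by (meson greaterThanAtMost_iff le_less_trans)
        then show ?thesis using tw \<omega> g_eq[OF t] by simp
      qed auto
    qed
    also have "\<dots> \<in> sets Pred"
    proof (intro sets.Un sets.countable_UN subsetI)
      show "{0} \<times> (Y 0 -` B \<inter> space \<Omega>) \<in> sets Pred"
        using measurable_sets[OF adapted[of 0] B] by (intro Pred_zero) auto
      fix Q assume "Q \<in> range ?Q"
      then obtain j where "Q = ?Q j" by blast
      then show "Q \<in> sets Pred"
        using measurable_sets[OF adapted[of "real j / real (Suc n)"] B] by (auto intro!: Pred_rect)
    qed
    finally show "?Z n -` B \<inter> space Pred \<in> sets Pred" .
  qed simp
  fix x assume "x \<in> space Pred"
  then obtain t \<omega> where x: "x = (t, \<omega>)" "0 \<le> t" "\<omega> \<in> space \<Omega>" by auto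
  show "(\<lambda>n. ?Z n x) \<longlonglongrightarrow> (case x of (t, \<omega>) \<Rightarrow> Y t \<omega>)"
  proof (cases "t = 0")
    case False
    then have t: "t > 0" using x by simp
    have lt: "g n t < t" and ge: "t - 1 / real (Suc n) \<le> g n t" for n
    proof -
      have "of_int \<lceil>t * real (Suc n)\<rceil> - 1 < t * real (Suc n)" "t * real (Suc n) \<le> of_int \<lceil>t * real (Suc n)\<rceil>"
        by linarith+
      then show "g n t < t" "t - 1 / real (Suc n) \<le> g n t"
        unfolding g_def by (simp_all add: field_simps del: of_nat_Suc)
    qed
    have "(\<lambda>n. t - 1 / real (Suc n)) \<longlonglongrightarrow> t - 0"
      by (intro tendsto_diff tendsto_const LIMSEQ_Suc[OF lim_1_over_n])
    then have lim: "(\<lambda>n. t - 1 / real (Suc n)) \<longlonglongrightarrow> t" by simp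
    have "(\<lambda>n. g n t) \<longlonglongrightarrow> t"
      by (rule real_tendsto_sandwich[OF _ _ lim tendsto_const[of t]])
        (intro always_eventually allI ge less_imp_le[OF lt])+
    then have "filterlim (\<lambda>n. g n t) (at_left t) sequentially"
      unfolding filterlim_at using lt by (auto intro!: always_eventually simp: less_imp_neq)
    from filterlim_compose[OF left[OF t x(3)] this] show ?thesis using False x by simp
  qed (use x in simp)
qed

text \<open>\<open>D\<close> is an initial segment of the time axis: \<open>{..<t}\<close> or \<open>{..t}\<close>.\<close>

definition initial :: "real set \<Rightarrow> bool" where
  "initial D \<longleftrightarrow> D \<in> sets borel \<and> bdd_above D \<and> (\<forall>x\<in>D. {..x} \<subseteq> D)"

lemma initial_lessThan [simp]: "initial {..<t}" and initial_atMost [simp]: "initial {..t}"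
  unfolding initial_def by auto

lemma initial_bounded: "initial D \<Longrightarrow> bounded ({0<..} \<inter> D)"
proof -
  assume "initial D"
  then obtain M where "\<forall>x\<in>D. x \<le> M" unfolding initial_def bdd_above_def by blast
  then have "{0<..} \<inter> D \<subseteq> {0..M}" by auto
  then show ?thesis using bounded_closed_interval bounded_subset by blast
qed

lemma initial_borel: "initial D \<Longrightarrow> D \<in> sets borel"
  unfolding initial_def by blast

lemma initial_pos:
  assumes "initial D"
  shows "{0<..} \<inter> D \<in> sets borel" "{0<..} \<inter> D \<subseteq> {0..}"
  using sets.Int[OF _ initial_borel[OF assms], of "{0<..}"] by (simp_all add: subset_iff)

text \<open>If \<open>D\<close> meets the interval at all, it contains the whole past of
  \<open>s\<close>, so an event known at time \<open>s\<close> is known from the points in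
  \<open>D\<close>.\<close>

lemma initial_cases:
  assumes "initial D"
  shows "D \<inter> {s<..t} = {} \<or> {..s} \<subseteq> D"
proof (cases "D \<inter> {s<..t} = {}")
  case False
  then obtain x where "x \<in> D" "s < x" by auto
  then have "{..x} \<subseteq> D" "{..s} \<subseteq> {..x}" using assms by (simp_all add: initial_def)
  then show ?thesis by (intro disjI2) (rule subset_trans)
qed simp

lemma finite_points_initial:
  assumes "l \<in> {1..m}" "\<omega> \<in> space \<Omega>" "initial D"
  shows "finite (points l D \<omega>)"
  by (rule finite_points[OF assms(1,2) initial_bounded[OF assms(3)]])

section \<open>Sums of predictable integrands over points\<close>

lemma sum_indicator_rect:
  assumes s: "0 \<le> s" and \<omega>: "\<omega> \<in> space \<Omega>" and l: "l \<in> {1..m}" and D: "initial D"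
  shows "(\<Sum>r\<in>points l D \<omega>. indicator ({s<..t} \<times> A) (r, \<omega>) :: ennreal)
    = indicator A \<omega> * ennreal (card (P l \<omega> \<inter> (D \<inter> {s<..t})))"
proof -
  have "(\<Sum>r\<in>points l D \<omega>. indicator ({s<..t} \<times> A) (r, \<omega>) :: ennreal)
    = (\<Sum>r\<in>points l D \<omega>. if r \<in> {s<..t} then indicator A \<omega> else 0)"
    by (intro sum.cong) (auto simp: indicator_def)
  also have "\<dots> = (\<Sum>r\<in>(points l D \<omega>) \<inter> {s<..t}. indicator A \<omega>)"
    by (rule sum.inter_restrict[OF finite_points_initial[OF l \<omega> D], symmetric])
  also have "(points l D \<omega>) \<inter> {s<..t} = P l \<omega> \<inter> (D \<inter> {s<..t})" using s by auto
  finally show ?thesis by (simp add: mult.commute ennreal_of_nat_eq_real_of_nat)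
qed

lemma sum_indicator_zero:
  "(\<Sum>r\<in>points l D \<omega>. indicator ({0} \<times> A) (r, \<omega>) :: ennreal) = 0"
  by (intro sum.neutral) (auto simp: indicator_def)

lemma sum_indicator_compl:
  assumes Q: "Q \<subseteq> {0..} \<times> space \<Omega>" and l: "l \<in> {1..m}" and \<omega>: "\<omega> \<in> space \<Omega>" and D: "initial D"
  shows "(\<Sum>r\<in>points l D \<omega>. indicator ({0..} \<times> space \<Omega> - Q) (r, \<omega>) :: ennreal)
    = ennreal (card (points l D \<omega>)) - (\<Sum>r\<in>points l D \<omega>. indicator Q (r, \<omega>))"
    (is "?C = ?N - ?S")
proof -
  have "?C + ?S = (\<Sum>r\<in>points l D \<omega>. indicator ({0..} \<times> space \<Omega> - Q) (r, \<omega>) + indicator Q (r, \<omega>))"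
    by (rule sum.distrib[symmetric])
  also have "\<dots> = (\<Sum>r\<in>points l D \<omega>. 1)"
    using \<omega> by (intro sum.cong) (auto simp: indicator_def)
  also have "\<dots> = ?N" by (simp add: ennreal_of_nat_eq_real_of_nat)
  finally have *: "?C + ?S = ?N" .
  have "?S \<noteq> top" using finite_points_initial[OF l \<omega> D] by (simp add: indicator_def)
  then show ?thesis unfolding *[symmetric] by (simp add: ennreal_add_diff_cancel_right)
qed

lemma sum_indicator_UN:
  assumes "disjoint_family A"
  shows "(\<Sum>r\<in>S. indicator (\<Union>i. A i) (r, \<omega>) :: ennreal) = (\<Sum>i. \<Sum>r\<in>S. indicator (A i) (r, \<omega>))"
  by (simp add: suminf_indicator[OF assms, symmetric] suminf_sum)

lemma sum_SUP_apply:
  fixes U :: "nat \<Rightarrow> real \<times> 'w \<Rightarrow> ennreal"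
  assumes "incseq U"
  shows "(\<Sum>r\<in>S. (SUP i. U i) (r, \<omega>)) = (SUP i. \<Sum>r\<in>S. U i (r, \<omega>))"
proof -
  have "incseq (\<lambda>i. U i (r, \<omega>))" for r using assms by (simp add: incseq_def le_fun_def)
  then have "(SUP i. \<Sum>r\<in>S. U i (r, \<omega>)) = (\<Sum>r\<in>S. SUP i. U i (r, \<omega>))" by (rule ennreal_SUP_sum)
  then show ?thesis by (simp add: image_comp)
qed

text \<open>On a predictable rectangle the sum is an indicator times a count of points in
  \<open>D\<close>. Complements are reached by subtracting from the finite total count, and disjoint
  unions and monotone limits pass through the finite sum.\<close>

lemma adapted_sum_ennreal:
  fixes H :: "real \<times> 'w \<Rightarrow> ennreal"
  assumes l: "l \<in> {1..m}" and D: "initial D" and H: "H \<in> borel_measurable Pred"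
  shows "(\<lambda>\<omega>. \<Sum>r\<in>points l D \<omega>. H (r, \<omega>)) \<in> borel_measurable (F D)"
  using H
proof (induct rule: borel_measurable_induct)
  case (cong f g)
  then show ?case
    by (subst measurable_cong[where g="\<lambda>\<omega>. \<Sum>r\<in>points l D \<omega>. g (r, \<omega>)"]) (auto intro!: sum.cong)
next
  case (set A)
  have N: "(\<lambda>\<omega>. ennreal (card (P l \<omega> \<inter> (D \<inter> B)))) \<in> borel_measurable (F D)"
    if "B \<in> sets borel" "bounded (D \<inter> B)" for B
  proof -
    have "(\<lambda>\<omega>. card (P l \<omega> \<inter> (D \<inter> B))) \<in> measurable (F D) (count_space UNIV)"
      using that initial_borel[OF D] by (intro card_points_sigma_sets l) auto
    then show ?thesis by measurable
  qed
  from set have "A \<in> sigma_sets ({0..} \<times> space \<Omega>) pred_rects" unfolding sets_Pred .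
  from Int_stable_pred_rects pred_rects_Pow this show ?case
  proof (induct rule: sigma_sets_induct_disjoint)
    case (basic Q)
    then show ?case
    proof (cases rule: pred_rect_cases)
      case (1 A)
      then show ?thesis by (simp add: sum_indicator_zero)
    next
      case (2 s t A)
      show ?thesis
      proof (cases "D \<inter> {s<..t} = {}")
        case True
        have "(\<Sum>r\<in>points l D \<omega>. indicator Q (r, \<omega>) :: ennreal) = 0" for \<omega>
          using True unfolding 2 by (intro sum.neutral) (auto simp: indicator_def)
        then show ?thesis by simp
      next
        case False
        then have "A \<in> sets (F D)" using initial_cases[OF D, of s t] F_mono[OF _ 2(4)] by simp
        then have "(\<lambda>\<omega>. indicator A \<omega> * ennreal (card (P l \<omega> \<inter> (D \<inter> {s<..t})))) \<in> borel_measurable (F D)"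
          by (intro borel_measurable_times_ennreal borel_measurable_indicator N)
            (auto intro: bounded_subset[of "{s<..t}"])
        then show ?thesis
          unfolding 2 by (subst measurable_cong) (auto simp: sum_indicator_rect[OF 2(2) _ l D])
      qed
    qed
  next
    case (compl Q)
    have "Q \<subseteq> {0..} \<times> space \<Omega>" using compl(1) sets.sets_into_space[of Q Pred] by (simp add: sets_Pred)
    moreover have "(\<lambda>\<omega>. ennreal (card (points l D \<omega>)) - (\<Sum>r\<in>points l D \<omega>. indicator Q (r, \<omega>)))
        \<in> borel_measurable (F D)"
      using N[of "{0<..}"] initial_bounded[OF D] compl(2)
      by (intro borel_measurable_minus_ennreal) (auto simp: Int_commute)
    ultimately show ?case
      by (subst measurable_cong[OF sum_indicator_compl[OF _ l _ D]]) auto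
  next
    case (union A)
    then show ?case unfolding sum_indicator_UN[OF union(1)] by (intro borel_measurable_suminf_order)
  qed simp
next
  case (mult u c)
  then show ?case by (simp add: sum_distrib_left[symmetric])
next
  case (add u v)
  then show ?case by (simp add: sum.distrib)
next
  case (seq U)
  show ?case unfolding sum_SUP_apply[OF seq(4)] by (rule borel_measurable_SUP) (simp, rule seq(3))
qed

lemmas sum_points_measurable = measurable_from_subalg[OF subalgebra_F adapted_sum_ennreal]

text \<open>The Campbell--Mecke compensation formula.\<close>

lemma nn_integral_sum_points:
  fixes H :: "real \<times> 'w \<Rightarrow> ennreal"
  assumes l: "l \<in> {1..m}" and D: "initial D" and H: "H \<in> borel_measurable Pred"
  shows "(\<integral>\<^sup>+\<omega>. (\<Sum>r\<in>points l D \<omega>. H (r, \<omega>)) \<partial>\<Omega>)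
    = ennreal (p l) * (\<integral>\<^sup>+x. (if fst x \<in> {0<..} \<inter> D then H x else 0) \<partial>(lborel \<Otimes>\<^sub>M \<Omega>))"
  using H
proof (induct rule: borel_measurable_induct)
  case (cong f g)
  have "(\<integral>\<^sup>+\<omega>. (\<Sum>r\<in>points l D \<omega>. f (r, \<omega>)) \<partial>\<Omega>) = (\<integral>\<^sup>+\<omega>. (\<Sum>r\<in>points l D \<omega>. g (r, \<omega>)) \<partial>\<Omega>)"
    using cong(3) by (intro nn_integral_cong sum.cong) auto
  moreover have "(\<integral>\<^sup>+x. (if fst x \<in> {0<..} \<inter> D then f x else 0) \<partial>(lborel \<Otimes>\<^sub>M \<Omega>)) =
      (\<integral>\<^sup>+x. (if fst x \<in> {0<..} \<inter> D then g x else 0) \<partial>(lborel \<Otimes>\<^sub>M \<Omega>))"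
    using cong(3) by (intro nn_integral_cong) (auto simp: space_pair_measure)
  ultimately show ?case using cong(4) by simp
next
  case (set A)
  let ?I = "\<lambda>Q. \<integral>\<^sup>+x. (if fst x \<in> {0<..} \<inter> D then indicator Q x else 0) \<partial>(lborel \<Otimes>\<^sub>M \<Omega>)"
  let ?S = "\<lambda>Q. \<integral>\<^sup>+\<omega>. (\<Sum>r\<in>points l D \<omega>. indicator Q (r, \<omega>)) \<partial>\<Omega>"
  have meas: "(\<lambda>x. if fst x \<in> {0<..} \<inter> D then indicator Q x else 0 :: ennreal) \<in> borel_measurable (lborel \<Otimes>\<^sub>M \<Omega>)"
    if "Q \<in> sets Pred" for Q
    using that initial_pos[OF D] by (intro Pred_measurable_pair) auto
  have measS: "(\<lambda>\<omega>. \<Sum>r\<in>points l D \<omega>. indicator Q (r, \<omega>) :: ennreal) \<in> borel_measurable \<Omega>"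
    if "Q \<in> sets Pred" for Q
    using that by (intro sum_points_measurable[OF l D]) auto
  have total: "(\<integral>\<^sup>+\<omega>. ennreal (card (points l D \<omega>)) \<partial>\<Omega>) = ennreal (p l) * ?I ({0..} \<times> space \<Omega>)"
  proof -
    have "?I ({0..} \<times> space \<Omega>) = (\<integral>\<^sup>+x. indicator (({0<..} \<inter> D) \<times> space \<Omega>) x \<partial>(lborel \<Otimes>\<^sub>M \<Omega>))"
      by (intro nn_integral_cong) (auto simp: indicator_def)
    also have "\<dots> = emeasure lborel ({0<..} \<inter> D)"
      using initial_pos[OF D] by (subst nn_integral_indicator) (auto simp: emeasure_pair_measure_Times emeasure_space_1)
    also have "\<dots> = ennreal (measure lborel ({0<..} \<inter> D))"
      using emeasure_bounded_finite[OF initial_bounded[OF D]] by (simp add: emeasure_eq_ennreal_measure)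
    finally show ?thesis
      using initial_pos[OF D] initial_bounded[OF D] intensity_pos[OF l]
      by (subst nn_integral_card[OF l]) (auto simp: ennreal_mult)
  qed
  from set have "A \<in> sigma_sets ({0..} \<times> space \<Omega>) pred_rects" unfolding sets_Pred .
  from Int_stable_pred_rects pred_rects_Pow this show ?case
  proof (induct rule: sigma_sets_induct_disjoint)
    case (basic Q)
    then show ?case
    proof (cases rule: pred_rect_cases)
      case (1 A)
      have "?I Q = (\<integral>\<^sup>+(x :: real \<times> 'w). 0 \<partial>(lborel \<Otimes>\<^sub>M \<Omega>))"
        unfolding 1 by (intro nn_integral_cong) (auto simp: indicator_def)
      then show ?thesis unfolding 1 by (simp add: sum_indicator_zero)
    next
      case (2 s t A)
      let ?B = "D \<inter> {s<..t}"
      have B: "?B \<in> sets borel" "bounded ?B" "?B \<subseteq> {0..}"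
        using initial_borel[OF D] 2(2) by (auto intro: bounded_subset[of "{s<..t}"])
      \<comment> \<open>Here predictability enters: \<open>A\<close> is known from the points up to
        \<open>s\<close>, the count only involves points after \<open>s\<close>, so the two are
        independent and the expectation factorises.\<close>
      have "(\<lambda>\<omega>. card (P l \<omega> \<inter> ?B)) \<in> measurable (F {s<..}) (count_space UNIV)"
        using B by (intro card_points_sigma_sets l) auto
      then have N: "(\<lambda>\<omega>. ennreal (card (P l \<omega> \<inter> ?B))) \<in> borel_measurable (F {s<..})"
        by measurable
      have "?S Q = (\<integral>\<^sup>+\<omega>. indicator A \<omega> * ennreal (card (P l \<omega> \<inter> ?B)) \<partial>\<Omega>)"
        unfolding 2 by (intro nn_integral_cong sum_indicator_rect[OF 2(2) _ l D])
      also have "\<dots> = (\<integral>\<^sup>+\<omega>. indicator A \<omega> \<partial>\<Omega>) * (\<integral>\<^sup>+\<omega>. ennreal (card (P l \<omega> \<inter> ?B)) \<partial>\<Omega>)"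
        using 2(4) by (intro nn_integral_mult_indep[OF _ _ N, of "{..s}"]) auto
      also have "\<dots> = emeasure \<Omega> A * ennreal (p l * measure lborel ?B)"
        using F_events[OF 2(4)] by (simp add: nn_integral_card[OF l B])
      also have "\<dots> = ennreal (p l) * (emeasure lborel ?B * emeasure \<Omega> A)"
        using intensity_pos[OF l] emeasure_bounded_finite[OF B(2)]
        by (simp add: emeasure_eq_ennreal_measure ennreal_mult mult_ac)
      also have "emeasure lborel ?B * emeasure \<Omega> A = (\<integral>\<^sup>+x. indicator (?B \<times> A) x \<partial>(lborel \<Otimes>\<^sub>M \<Omega>))"
        using F_events[OF 2(4)] B by (subst nn_integral_indicator) (auto simp: emeasure_pair_measure_Times)
      also have "\<dots> = ?I Q"
        unfolding 2 using 2(2) by (intro nn_integral_cong) (auto simp: indicator_def)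
      finally show ?thesis .
    qed
  next
    case (compl Q)
    let ?W = "{0..} \<times> space \<Omega>"
    have Q: "Q \<in> sets Pred" using compl(1) by (simp add: sets_Pred)
    then have sub: "Q \<subseteq> ?W" using sets.sets_into_space[of Q Pred] by simp
    have W: "?W \<in> sets Pred" using sets.top[of Pred] by simp
    \<comment> \<open>The expected number of positive points in \<open>D\<close> is finite, which
      makes the difference of integrals legitimate in the extended nonnegative reals.\<close>
    have fin: "?S Q \<noteq> \<infinity>"
    proof -
      have "?S Q \<le> (\<integral>\<^sup>+\<omega>. ennreal (card (points l D \<omega>)) \<partial>\<Omega>)"
      proof (rule nn_integral_mono)
        fix \<omega>
        have "(\<Sum>r\<in>points l D \<omega>. indicator Q (r, \<omega>) :: ennreal) \<le> (\<Sum>r\<in>points l D \<omega>. 1)"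
          by (intro sum_mono) (auto simp: indicator_def)
        then show "(\<Sum>r\<in>points l D \<omega>. indicator Q (r, \<omega>) :: ennreal) \<le> ennreal (card (points l D \<omega>))"
          by (simp add: ennreal_of_nat_eq_real_of_nat)
      qed
      also have "\<dots> < \<infinity>" using initial_pos[OF D] initial_bounded[OF D] by (subst nn_integral_card[OF l]) auto
      finally show ?thesis by simp
    qed
    have "?S (?W - Q) = (\<integral>\<^sup>+\<omega>. ennreal (card (points l D \<omega>)) - (\<Sum>r\<in>points l D \<omega>. indicator Q (r, \<omega>)) \<partial>\<Omega>)"
      by (intro nn_integral_cong sum_indicator_compl[OF sub l _ D])
    also have "\<dots> = (\<integral>\<^sup>+\<omega>. ennreal (card (points l D \<omega>)) \<partial>\<Omega>) - ?S Q"
    proof (rule nn_integral_diff)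
      have "(\<lambda>\<omega>. card (points l D \<omega>)) \<in> measurable \<Omega> (count_space UNIV)"
        using initial_pos[OF D] initial_bounded[OF D] by (intro measurable_card_points[OF l]) auto
      then show "(\<lambda>\<omega>. ennreal (card (points l D \<omega>))) \<in> borel_measurable \<Omega>" by measurable
      show "AE \<omega> in \<Omega>. (\<Sum>r\<in>points l D \<omega>. indicator Q (r, \<omega>)) \<le> ennreal (card (points l D \<omega>))"
      proof (rule AE_I2)
        fix \<omega>
        have "(\<Sum>r\<in>points l D \<omega>. indicator Q (r, \<omega>) :: ennreal) \<le> (\<Sum>r\<in>points l D \<omega>. 1)"
          by (intro sum_mono) (auto simp: indicator_def)
        then show "(\<Sum>r\<in>points l D \<omega>. indicator Q (r, \<omega>) :: ennreal) \<le> ennreal (card (points l D \<omega>))"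
          by (simp add: ennreal_of_nat_eq_real_of_nat)
      qed
    qed (use fin measS[OF Q] in auto)
    also have "\<dots> = ennreal (p l) * ?I ?W - ennreal (p l) * ?I Q"
      unfolding total compl(2) ..
    also have "\<dots> = ennreal (p l) * (?I ?W - ?I Q)"
      by (simp add: ennreal_right_diff_distrib)
    also have "?I ?W - ?I Q = ?I (?W - Q)"
    proof -
      have "?I Q \<noteq> \<infinity>"
      proof
        assume "?I Q = \<infinity>"
        then have "ennreal (p l) * ?I Q = \<infinity>" using intensity_pos[OF l] by (simp add: ennreal_mult_top)
        then show False using fin compl(2) by simp
      qed
      then have "?I ?W - ?I Q = (\<integral>\<^sup>+x. (if fst x \<in> {0<..} \<inter> D then indicator ?W x else 0)
          - (if fst x \<in> {0<..} \<inter> D then indicator Q x else 0) \<partial>(lborel \<Otimes>\<^sub>M \<Omega>))"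
        using sub by (intro nn_integral_diff[symmetric] meas W Q) (auto simp: indicator_def intro!: AE_I2)
      also have "\<dots> = ?I (?W - Q)"
        using sub by (intro nn_integral_cong) (auto simp: indicator_def)
      finally show ?thesis .
    qed
    finally show ?case .
  next
    case (union A)
    have A: "A i \<in> sets Pred" for i using union(2) by (auto simp: sets_Pred)
    have "?S (\<Union>i. A i) = (\<integral>\<^sup>+\<omega>. (\<Sum>i. \<Sum>r\<in>points l D \<omega>. indicator (A i) (r, \<omega>)) \<partial>\<Omega>)"
      by (simp add: sum_indicator_UN[OF union(1)])
    also have "\<dots> = (\<Sum>i. ?S (A i))" by (intro nn_integral_suminf measS A)
    also have "\<dots> = (\<Sum>i. ennreal (p l) * ?I (A i))" using union(3) by simp
    also have "\<dots> = ennreal (p l) * (\<Sum>i. ?I (A i))" by simp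
    also have "(\<Sum>i. ?I (A i)) = (\<integral>\<^sup>+x. (\<Sum>i. if fst x \<in> {0<..} \<inter> D then indicator (A i) x else 0) \<partial>(lborel \<Otimes>\<^sub>M \<Omega>))"
      by (intro nn_integral_suminf[symmetric] meas A)
    also have "\<dots> = ?I (\<Union>i. A i)"
      by (intro nn_integral_cong) (auto simp: suminf_indicator[OF union(1)])
    finally show ?case .
  next
    case empty
    have "?I {} = (\<integral>\<^sup>+(x :: real \<times> 'w). 0 \<partial>(lborel \<Otimes>\<^sub>M \<Omega>))"
      by (intro nn_integral_cong) simp
    then show ?case by simp
  qed
next
  case (mult u c)
  have "(\<integral>\<^sup>+\<omega>. (\<Sum>r\<in>points l D \<omega>. c * u (r, \<omega>)) \<partial>\<Omega>) = c * (\<integral>\<^sup>+\<omega>. (\<Sum>r\<in>points l D \<omega>. u (r, \<omega>)) \<partial>\<Omega>)"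
    using mult(2) unfolding sum_distrib_left[symmetric]
    by (intro nn_integral_cmult sum_points_measurable[OF l D])
  moreover have "(\<integral>\<^sup>+x. (if fst x \<in> {0<..} \<inter> D then c * u x else 0) \<partial>(lborel \<Otimes>\<^sub>M \<Omega>)) =
      c * (\<integral>\<^sup>+x. (if fst x \<in> {0<..} \<inter> D then u x else 0) \<partial>(lborel \<Otimes>\<^sub>M \<Omega>))"
    by (subst nn_integral_cmult[symmetric, OF Pred_measurable_pair[OF mult(2) initial_pos[OF D]]]) (auto intro!: nn_integral_cong)
  ultimately show ?case using mult(4) by (simp add: mult_ac)
next
  case (add u v)
  have "(\<integral>\<^sup>+\<omega>. (\<Sum>r\<in>points l D \<omega>. v (r, \<omega>) + u (r, \<omega>)) \<partial>\<Omega>)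
      = (\<integral>\<^sup>+\<omega>. (\<Sum>r\<in>points l D \<omega>. v (r, \<omega>)) \<partial>\<Omega>) + (\<integral>\<^sup>+\<omega>. (\<Sum>r\<in>points l D \<omega>. u (r, \<omega>)) \<partial>\<Omega>)"
    using add(1,4) unfolding sum.distrib
    by (intro nn_integral_add sum_points_measurable[OF l D])
  moreover have "(\<integral>\<^sup>+x. (if fst x \<in> {0<..} \<inter> D then v x + u x else 0) \<partial>(lborel \<Otimes>\<^sub>M \<Omega>)) =
      (\<integral>\<^sup>+x. (if fst x \<in> {0<..} \<inter> D then v x else 0) \<partial>(lborel \<Otimes>\<^sub>M \<Omega>)) + (\<integral>\<^sup>+x. (if fst x \<in> {0<..} \<inter> D then u x else 0) \<partial>(lborel \<Otimes>\<^sub>M \<Omega>))"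
    by (subst nn_integral_add[symmetric, OF Pred_measurable_pair[OF add(4) initial_pos[OF D]] Pred_measurable_pair[OF add(1) initial_pos[OF D]]])
      (auto intro!: nn_integral_cong)
  ultimately show ?case using add(3,7) by (simp add: distrib_left)
next
  case (seq U)
  have inc: "incseq (\<lambda>i \<omega>. \<Sum>r\<in>points l D \<omega>. U i (r, \<omega>))"
    using seq(4) by (auto simp: incseq_def le_fun_def intro!: sum_mono)
  have "(\<integral>\<^sup>+\<omega>. (\<Sum>r\<in>points l D \<omega>. (SUP i. U i) (r, \<omega>)) \<partial>\<Omega>)
      = (\<integral>\<^sup>+\<omega>. (SUP i. \<Sum>r\<in>points l D \<omega>. U i (r, \<omega>)) \<partial>\<Omega>)" by (simp only: sum_SUP_apply[OF seq(4)])
  also have "\<dots> = (SUP i. \<integral>\<^sup>+\<omega>. (\<Sum>r\<in>points l D \<omega>. U i (r, \<omega>)) \<partial>\<Omega>)"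
    using seq(1) by (intro nn_integral_monotone_convergence_SUP inc
        sum_points_measurable[OF l D])
  also have "\<dots> = (SUP i. ennreal (p l) * (\<integral>\<^sup>+x. (if fst x \<in> {0<..} \<inter> D then U i x else 0) \<partial>(lborel \<Otimes>\<^sub>M \<Omega>)))"
    using seq(3) by simp
  also have "\<dots> = ennreal (p l) * (SUP i. \<integral>\<^sup>+x. (if fst x \<in> {0<..} \<inter> D then U i x else 0) \<partial>(lborel \<Otimes>\<^sub>M \<Omega>))"
    by (simp add: SUP_mult_left_ennreal)
  also have "(SUP i. \<integral>\<^sup>+x. (if fst x \<in> {0<..} \<inter> D then U i x else 0) \<partial>(lborel \<Otimes>\<^sub>M \<Omega>))
      = (\<integral>\<^sup>+x. (SUP i. if fst x \<in> {0<..} \<inter> D then U i x else 0) \<partial>(lborel \<Otimes>\<^sub>M \<Omega>))"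
    using seq(4)
    by (intro nn_integral_monotone_convergence_SUP[symmetric] Pred_measurable_pair[OF seq(1) initial_pos[OF D]])
      (auto simp: incseq_def le_fun_def)
  also have "\<dots> = (\<integral>\<^sup>+x. (if fst x \<in> {0<..} \<inter> D then (SUP i. U i) x else 0) \<partial>(lborel \<Otimes>\<^sub>M \<Omega>))"
    by (intro nn_integral_cong) (auto simp: image_comp)
  finally show ?case .
qed

text \<open>Positive and negative parts reduce to the extended nonnegative case; the sums are
  finite, so \<open>enn2real\<close> loses nothing.\<close>

lemma adapted_sum_real:
  fixes H :: "real \<times> 'w \<Rightarrow> real"
  assumes l: "l \<in> {1..m}" and D: "initial D" and H: "H \<in> borel_measurable Pred"
  shows "(\<lambda>\<omega>. \<Sum>r\<in>points l D \<omega>. H (r, \<omega>)) \<in> borel_measurable (F D)"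
proof -
  have pos: "(\<lambda>\<omega>. \<Sum>r\<in>points l D \<omega>. max 0 (f (r, \<omega>))) \<in> borel_measurable (F D)"
    if f: "f \<in> borel_measurable Pred" for f :: "real \<times> 'w \<Rightarrow> real"
  proof -
    have "(\<lambda>x. ennreal (f x)) \<in> borel_measurable Pred" using f by measurable
    from adapted_sum_ennreal[OF l D this]
    have "(\<lambda>\<omega>. enn2real (\<Sum>r\<in>points l D \<omega>. ennreal (f (r, \<omega>)))) \<in> borel_measurable (F D)"
      by measurable
    moreover have "(\<Sum>r\<in>S. ennreal (f (r, \<omega>))) = ennreal (\<Sum>r\<in>S. max 0 (f (r, \<omega>)))" for S \<omega>
      by (subst sum_ennreal[symmetric]) auto
    ultimately show ?thesis by (simp add: sum_nonneg)
  qed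
  have "(\<lambda>x. - H x) \<in> borel_measurable Pred" using H by measurable
  from borel_measurable_diff[OF pos[OF H] pos[OF this]]
  have "(\<lambda>\<omega>. \<Sum>r\<in>points l D \<omega>. max 0 (H (r, \<omega>)) - max 0 (- H (r, \<omega>))) \<in> borel_measurable (F D)"
    by (simp only: sum_subtractf)
  moreover have "max 0 a - max 0 (- a) = a" for a :: real by simp
  ultimately show ?thesis by (simp only:)
qed

lemma adapted_sum:
  fixes H :: "real \<times> 'w \<Rightarrow> 'b::euclidean_space"
  assumes l: "l \<in> {1..m}" and D: "initial D" and H: "H \<in> borel_measurable Pred"
  shows "(\<lambda>\<omega>. \<Sum>r\<in>points l D \<omega>. H (r, \<omega>)) \<in> borel_measurable (F D)"
proof (rule borel_measurable_euclidean_space[THEN iffD2], rule ballI)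
  fix b :: 'b assume "b \<in> Basis"
  have "(\<lambda>x. H x \<bullet> b) \<in> borel_measurable Pred" using H by measurable
  from adapted_sum_real[OF l D this]
  show "(\<lambda>\<omega>. (\<Sum>r\<in>points l D \<omega>. H (r, \<omega>)) \<bullet> b) \<in> borel_measurable (F D)"
    by (simp add: inner_sum_left)
qed

text \<open>The open right end is what matters: the sum over points strictly before
  \<open>t - c\<close> is left continuous in \<open>t\<close>, and for nonnegative \<open>c\<close>
  it is known at time \<open>t\<close>.\<close>

lemma predictable_sum_shift:
  fixes H :: "real \<times> 'w \<Rightarrow> 'b::euclidean_space"
  assumes l: "l \<in> {1..m}" and H: "H \<in> borel_measurable Pred" and c: "0 \<le> c"
  shows "(\<lambda>(t, \<omega>). \<Sum>r\<in>points l {..<t - c} \<omega>. H (r, \<omega>)) \<in> borel_measurable Pred"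
proof (rule left_continuous_predictable)
  show "(\<lambda>\<omega>. \<Sum>r\<in>points l {..<t - c} \<omega>. H (r, \<omega>)) \<in> borel_measurable (F {..t})" for t
    using c by (intro measurable_F_mono[OF _ adapted_sum[OF l _ H]]) auto
next
  fix t \<omega> assume \<omega>: "\<omega> \<in> space \<Omega>"
  let ?A = "points l {..<t - c} \<omega>"
  have fin: "finite ?A" by (rule finite_points_initial[OF l \<omega>]) simp
  \<comment> \<open>\<open>b\<close> is the last point before \<open>t - c\<close>, and the sum does
    not change between times \<open>b + c\<close> and \<open>t\<close>. The element
    \<open>t - c - 1\<close> is a default for the case without points.\<close>
  define b where "b = Max (insert (t - c - 1) ?A)"
  have b: "b < t - c" "\<And>r. r \<in> ?A \<Longrightarrow> r \<le> b" using fin by (auto simp: b_def)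
  have "points l {..<s - c} \<omega> = ?A" if "b + c < s" "s < t" for s
    using b(2) that by force
  then have "\<forall>\<^sub>F s in at_left t. (\<Sum>r\<in>?A. H (r, \<omega>)) = (\<Sum>r\<in>points l {..<s - c} \<omega>. H (r, \<omega>))"
    unfolding eventually_at_left_field using b(1) by (intro exI[of _ "b + c"]) auto
  then show "((\<lambda>s. \<Sum>r\<in>points l {..<s - c} \<omega>. H (r, \<omega>)) \<longlongrightarrow> (\<Sum>r\<in>?A. H (r, \<omega>))) (at_left t)"
    by (rule tendsto_eventually[OF eventually_mono]) simp
qed

text \<open>With a closed right end the sum is right continuous in \<open>t\<close>, so the previous
  argument breaks down. A positive delay leaves room: the closed sum is the pointwise limit of open
  ones with slightly smaller, still nonnegative, delays.\<close>

lemma predictable_sum_delay: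
  fixes H :: "real \<times> 'w \<Rightarrow> 'b::euclidean_space"
  assumes l: "l \<in> {1..m}" and H: "H \<in> borel_measurable Pred" and c: "0 < c"
  shows "(\<lambda>(t, \<omega>). \<Sum>r\<in>points l {..t - c} \<omega>. H (r, \<omega>)) \<in> borel_measurable Pred"
proof (rule borel_measurable_LIMSEQ_metric)
  let ?c = "\<lambda>n. c - c / real (Suc n)"
  have c': "0 \<le> ?c n" for n using c by (simp add: field_simps)
  show "(\<lambda>(t, \<omega>). \<Sum>r\<in>points l {..<t - ?c n} \<omega>. H (r, \<omega>)) \<in> borel_measurable Pred" for n
    by (rule predictable_sum_shift[OF l H c'])
  fix x assume "x \<in> space Pred"
  then obtain t \<omega> where x: "x = (t, \<omega>)" "\<omega> \<in> space \<Omega>" by auto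
  let ?B = "points l {..t} \<omega>"
  have fin: "finite ?B" by (rule finite_points_initial[OF l x(2)]) simp
  \<comment> \<open>\<open>b\<close> is the first point after \<open>t - c\<close> up to time
    \<open>t\<close>, or \<open>t\<close> if there is none. Once the shifted end lies below
    \<open>b\<close>, the open and the closed sum run over the same points.\<close>
  define b where "b = Min (insert t (?B \<inter> {t - c<..}))"
  have b: "t - c < b" "\<And>r. r \<in> ?B \<Longrightarrow> t - c < r \<Longrightarrow> b \<le> r" using fin c by (auto simp: b_def)
  have "(\<lambda>n. t - c + c / real (Suc n)) \<longlonglongrightarrow> t - c + 0"
    by (intro tendsto_add tendsto_const LIMSEQ_Suc[OF lim_const_over_n])
  then have "\<forall>\<^sub>F n in sequentially. t - c + c / real (Suc n) < b"
    using b(1) by (intro order_tendstoD(2)) auto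
  then have "\<forall>\<^sub>F n in sequentially. points l {..<t - ?c n} \<omega> = points l {..t - c} \<omega>"
  proof eventually_elim
    case (elim n)
    have p: "0 < c / real (Suc n)" using c by simp
    show ?case
    proof (intro set_eqI iffI)
      fix r assume r: "r \<in> points l {..<t - ?c n} \<omega>"
      have "r \<le> t - c"
      proof (rule ccontr)
        assume "\<not> r \<le> t - c"
        moreover have "r \<in> ?B" using r c' [of n] by auto
        ultimately have "b \<le> r" using b(2) by auto
        then show False using r elim by auto
      qed
      then show "r \<in> points l {..t - c} \<omega>" using r by auto
    qed (use p in auto)
  qed
  then show "(\<lambda>n. (\<lambda>(t, \<omega>). \<Sum>r\<in>points l {..<t - ?c n} \<omega>. H (r, \<omega>)) x)
      \<longlonglongrightarrow> (case x of (t, \<omega>) \<Rightarrow> \<Sum>r\<in>points l {..t - c} \<omega>. H (r, \<omega>))"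
    unfolding x prod.case by (intro tendsto_eventually) (auto elim: eventually_mono)
qed

end

section \<open>Moments and simultaneous points\<close>

text \<open>A geometric series along an ordered finite set: the exponent counts the elements before
  \<open>s\<close>, so each new element multiplies the accumulated total by
  \<open>1 + c\<close>.\<close>

lemma one_plus_sum_power_card:
  fixes c :: real and U :: "real set"
  assumes "finite U"
  shows "1 + (\<Sum>s\<in>U. c * (1 + c) ^ card {r\<in>U. r < s}) = (1 + c) ^ card U"
  using assms
proof (induct rule: finite_linorder_max_induct)
  case (insert b A)
  have 1: "{r\<in>insert b A. r < s} = {r\<in>A. r < s}" if "s \<in> A" for s
    using insert(2) that by (auto dest: less_asym)
  have 2: "{r\<in>insert b A. r < b} = A" using insert(2) by auto
  have b: "b \<notin> A" using insert(2) by auto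
  have "(\<Sum>s\<in>insert b A. c * (1 + c) ^ card {r\<in>insert b A. r < s})
      = c * (1 + c) ^ card A + (\<Sum>s\<in>A. c * (1 + c) ^ card {r\<in>insert b A. r < s})"
    unfolding sum.insert[OF insert(1) b] 2 ..
  also have "(\<Sum>s\<in>A. c * (1 + c) ^ card {r\<in>insert b A. r < s}) = (1 + c) ^ card A - 1"
    unfolding insert(3)[symmetric] using 1 by (simp only: add_diff_cancel_left' cong: sum.cong)
  finally show ?case using insert(1) b by (simp add: algebra_simps)
qed simp

text \<open>A discrete Gronwall inequality. The hypothesis on a jump refers to sums over arbitrary
  sets of earlier times, since different blocks look back by different delays.\<close>

lemma norm_partial_sums_le:
  fixes h :: "real \<Rightarrow> 'a::real_normed_vector"
  assumes U: "finite U" and c: "c \<ge> 0"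
    and h: "\<And>s B. s \<in> U \<Longrightarrow> (\<And>W. W \<subseteq> {..<s} \<Longrightarrow> norm (y + (\<Sum>r\<in>U \<inter> W. h r)) \<le> B) \<Longrightarrow> norm (h s) \<le> c * B"
  shows "norm (y + (\<Sum>r\<in>U \<inter> W. h r)) \<le> (1 + c) ^ card U * norm y"
proof -
  have part: "norm (y + (\<Sum>r\<in>U \<inter> W. h r)) \<le> (1 + c) ^ card V * norm y"
    if V: "V \<subseteq> U" "U \<inter> W \<subseteq> V" and b: "\<And>s. s \<in> V \<Longrightarrow> norm (h s) \<le> c * (1 + c) ^ card {r\<in>V. r < s} * norm y" for V W
  proof -
    have fV: "finite V" using V U finite_subset by blast
    have "norm (y + (\<Sum>r\<in>U \<inter> W. h r)) \<le> norm y + (\<Sum>r\<in>U \<inter> W. norm (h r))"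
      by (rule norm_triangle_le) (simp add: norm_sum)
    also have "\<dots> \<le> norm y + (\<Sum>r\<in>V. norm (h r))"
      using V fV by (intro add_left_mono sum_mono2) auto
    also have "\<dots> \<le> norm y + (\<Sum>r\<in>V. c * (1 + c) ^ card {q\<in>V. q < r} * norm y)"
      using b by (intro add_left_mono sum_mono) auto
    also have "\<dots> = (1 + (\<Sum>r\<in>V. c * (1 + c) ^ card {q\<in>V. q < r})) * norm y"
      by (simp add: sum_distrib_right distrib_right)
    finally show ?thesis using one_plus_sum_power_card[OF fV, of c] by simp
  qed
  have "norm (h s) \<le> c * (1 + c) ^ card {r\<in>U. r < s} * norm y" if "s \<in> U" for s
    using that
  \<comment> \<open>Induction on the number of earlier times: \<open>part\<close>, applied to those
    times alone, bounds every position that the jump at \<open>s\<close> may have seen.\<close>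
  proof (induction "card {r\<in>U. r < s}" arbitrary: s rule: less_induct)
    case less
    have "norm (h s) \<le> c * ((1 + c) ^ card {r\<in>U. r < s} * norm y)"
    proof (rule h[OF less.prems])
      fix W :: "real set" assume W: "W \<subseteq> {..<s}"
      show "norm (y + (\<Sum>r\<in>U \<inter> W. h r)) \<le> (1 + c) ^ card {r\<in>U. r < s} * norm y"
      proof (rule part)
        fix r assume r: "r \<in> {r\<in>U. r < s}"
        have "{q\<in>U. q < r} \<subset> {q\<in>U. q < s}" using r by auto
        then have "card {q\<in>U. q < r} < card {q\<in>U. q < s}" using U by (intro psubset_card_mono) auto
        then have "norm (h r) \<le> c * (1 + c) ^ card {q\<in>U. q < r} * norm y"
          using less.hyps[of r] r by simp
        moreover have "{q\<in>{r\<in>U. r < s}. q < r} = {q\<in>U. q < r}" using r by auto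
        ultimately show "norm (h r) \<le> c * (1 + c) ^ card {q\<in>{r\<in>U. r < s}. q < r} * norm y" by simp
      qed (use W in auto)
    qed
    then show ?case by (simp add: mult.assoc)
  qed
  then show ?thesis by (intro part) auto
qed

lemma telescope_finite_set:
  fixes h :: "real \<Rightarrow> 'a::ab_group_add" and g :: "'a \<Rightarrow> real"
  assumes "finite U"
  shows "g (y + (\<Sum>r\<in>U. h r)) = g y + (\<Sum>s\<in>U. g (y + (\<Sum>r\<in>U \<inter> {..<s}. h r) + h s) - g (y + (\<Sum>r\<in>U \<inter> {..<s}. h r)))"
  using assms
proof (induct rule: finite_linorder_max_induct)
  case (insert b A)
  have 1: "insert b A \<inter> {..<s} = A \<inter> {..<s}" if "s \<in> A" for s
    using insert(2) that by (auto dest: less_asym)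
  have 2: "insert b A \<inter> {..<b} = A" using insert(2) by auto
  have b: "b \<notin> A" using insert(2) by auto
  have "(\<Sum>s\<in>insert b A. g (y + (\<Sum>r\<in>insert b A \<inter> {..<s}. h r) + h s) - g (y + (\<Sum>r\<in>insert b A \<inter> {..<s}. h r)))
    = (g (y + (\<Sum>r\<in>A. h r) + h b) - g (y + (\<Sum>r\<in>A. h r)))
      + (\<Sum>s\<in>A. g (y + (\<Sum>r\<in>A \<inter> {..<s}. h r) + h s) - g (y + (\<Sum>r\<in>A \<inter> {..<s}. h r)))"
    using insert(1) b 1 by (simp add: 2)
  then show ?case using insert(1,3) b by (simp add: add_ac)
qed simp

context poisson_family begin

text \<open>Common points are counted once per process: the sum dominates the number of jump times
  on every path, and its exponential moments reduce to those of the single processes.\<close>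

definition count :: "real \<Rightarrow> 'w \<Rightarrow> nat" where
  "count T \<omega> = (\<Sum>l\<in>{1..m}. card (points l {..T} \<omega>))"

lemma measurable_card_initial:
  assumes "l \<in> {1..m}" "initial D"
  shows "(\<lambda>\<omega>. card (points l D \<omega>)) \<in> measurable \<Omega> (count_space UNIV)"
  using assms initial_bounded[OF assms(2)] initial_borel[OF assms(2)]
  by (intro measurable_card_points) auto

lemma measurable_count: "count T \<in> measurable \<Omega> (count_space UNIV)"
  unfolding count_def
  by (intro measurable_sum_nat measurable_card_initial) auto

text \<open>The total count is at most \<open>m\<close> times the largest single count, so the power
  is dominated by a sum over processes of powers with base \<open>a ^ m\<close>, each with a finite
  generating function.\<close>

lemma integrable_power_count:
  fixes a :: real
  assumes a: "a \<ge> 1"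
  shows "integrable \<Omega> (\<lambda>\<omega>. a ^ count T \<omega>)"
proof (rule Bochner_Integration.integrable_bound[where f="\<lambda>\<omega>. 1 + (\<Sum>l\<in>{1..m}. (a ^ m) ^ card (points l {..T} \<omega>))"])
  have "integrable \<Omega> (\<lambda>\<omega>. (a ^ m) ^ card (points l {..T} \<omega>))" if l: "l \<in> {1..m}" for l
  proof (rule integrableI_nonneg)
    show "(\<lambda>\<omega>. (a ^ m) ^ card (points l {..T} \<omega>)) \<in> borel_measurable \<Omega>"
      using measurable_compose[OF measurable_card_initial[OF l initial_atMost, of T], of "\<lambda>n. (a ^ m) ^ n" borel] by simp
    have "(\<integral>\<^sup>+\<omega>. ennreal ((a ^ m) ^ card (points l {..T} \<omega>)) \<partial>\<Omega>) =
        ennreal (exp (p l * measure lborel ({0<..} \<inter> {..T}) * (a ^ m - 1)))"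
      using a initial_bounded[OF initial_atMost, of T] by (intro nn_integral_power_card l) auto
    then show "(\<integral>\<^sup>+\<omega>. ennreal ((a ^ m) ^ card (points l {..T} \<omega>)) \<partial>\<Omega>) < \<infinity>" by simp
  qed (use a in auto)
  then show "integrable \<Omega> (\<lambda>\<omega>. 1 + (\<Sum>l\<in>{1..m}. (a ^ m) ^ card (points l {..T} \<omega>)))"
    by (intro Bochner_Integration.integrable_add integrable_const Bochner_Integration.integrable_sum)
  show "(\<lambda>\<omega>. a ^ count T \<omega>) \<in> borel_measurable \<Omega>"
    using measurable_compose[OF measurable_count, of "\<lambda>n. a ^ n" borel T] by simp
  show "AE \<omega> in \<Omega>. norm (a ^ count T \<omega>) \<le> norm (1 + (\<Sum>l\<in>{1..m}. (a ^ m) ^ card (points l {..T} \<omega>)))"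
  proof (rule AE_I2)
    fix \<omega>
    let ?n = "\<lambda>l. card (points l {..T} \<omega>)"
    have "a ^ count T \<omega> \<le> 1 + (\<Sum>l\<in>{1..m}. (a ^ m) ^ ?n l)"
    proof (cases "m = 0")
      case False
      define M where "M = Max (?n ` {1..m})"
      have "M \<in> ?n ` {1..m}" unfolding M_def using False by (intro Max_in) auto
      then obtain l0 where l0: "l0 \<in> {1..m}" "M = ?n l0" by auto
      have "count T \<omega> \<le> (\<Sum>l\<in>{1..m}. M)"
        unfolding count_def M_def by (intro sum_mono Max_ge) auto
      then have "a ^ count T \<omega> \<le> a ^ (m * ?n l0)"
        using a l0 by (intro power_increasing) auto
      also have "\<dots> = (a ^ m) ^ ?n l0" by (rule power_mult)
      also have "\<dots> \<le> (\<Sum>l\<in>{1..m}. (a ^ m) ^ ?n l)"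
        using l0(1) a by (intro member_le_sum) auto
      finally show ?thesis by simp
    next
      case True
      then have "count T \<omega> = 0" unfolding count_def by simp
      then show ?thesis using a by (simp add: sum_nonneg)
    qed
    moreover have "0 \<le> a ^ count T \<omega>" using a by simp
    ultimately show "norm (a ^ count T \<omega>) \<le> norm (1 + (\<Sum>l\<in>{1..m}. (a ^ m) ^ ?n l))" unfolding real_norm_def by linarith
  qed
qed

lemma AE_not_point:
  assumes l: "l \<in> {1..m}" and u: "0 \<le> u"
  shows "AE \<omega> in \<Omega>. u \<notin> P l \<omega>"
proof -
  have "prob {\<omega>\<in>space \<Omega>. card (P l \<omega> \<inter> {u}) = 0} = 1"
    using prob_card_points[OF l, of "{u}" 0] u by simp
  moreover have "{\<omega>\<in>space \<Omega>. card (P l \<omega> \<inter> {u}) = 0} \<in> events"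
    using measurable_sets[OF measurable_card_points[OF l, of "{u}"], of "{0}"]
    by (simp add: vimage_def Int_def conj_commute)
  ultimately have "AE \<omega> in \<Omega>. \<omega> \<in> {\<omega>\<in>space \<Omega>. card (P l \<omega> \<inter> {u}) = 0}"
    by (simp only: prob_eq_1)
  then show ?thesis
  proof eventually_elim
    case (elim \<omega>)
    moreover have "finite (P l \<omega> \<inter> {u})" by simp
    ultimately show ?case by auto
  qed
qed

lemma prob_point_le:
  assumes l: "l \<in> {1..m}" and B: "B \<in> sets borel" "bounded B" "B \<subseteq> {0..}"
  shows "prob {\<omega>\<in>space \<Omega>. card (P l \<omega> \<inter> B) \<noteq> 0} \<le> p l * measure lborel B"
proof -
  let ?Z = "{\<omega>\<in>space \<Omega>. card (P l \<omega> \<inter> B) = 0}"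
  have ev: "?Z \<in> events"
    using measurable_sets[OF measurable_card_points[OF l B(1,2)], of "{0}"]
    by (simp add: vimage_def Int_def conj_commute)
  have "{\<omega>\<in>space \<Omega>. card (P l \<omega> \<inter> B) \<noteq> 0} = space \<Omega> - ?Z" by auto
  then have "prob {\<omega>\<in>space \<Omega>. card (P l \<omega> \<inter> B) \<noteq> 0} = 1 - prob ?Z" using prob_compl[OF ev] by simp
  also have "\<dots> = 1 - exp (- (p l * measure lborel B))" using prob_card_points[OF l B, of 0] by simp
  also have "\<dots> \<le> p l * measure lborel B" using exp_ge_add_one_self[of "- (p l * measure lborel B)"] by linarith
  finally show ?thesis .
qed

text \<open>A common point forces both processes into the same cell of any partition of
  \<open>{0<..T}\<close>. By independence the probability that both hit a given cell is quadratic in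
  its length, so over all cells the total is proportional to the mesh and tends to 0.\<close>

lemma AE_no_common_point:
  assumes k: "k \<in> {1..m}" and l: "l \<in> {1..m}" and kl: "k \<noteq> l" and T: "T > 0"
  shows "AE \<omega> in \<Omega>. P k \<omega> \<inter> P l \<omega> \<inter> {0<..T} = {}"
proof -
  define I where "I = (\<lambda>n j::nat. {real j * T / real (Suc n)<..real (Suc j) * T / real (Suc n)})"
  define A where "A = (\<lambda>l n j. {\<omega>\<in>space \<Omega>. card (P l \<omega> \<inter> I n j) \<noteq> 0})"
  define B where "B = (\<lambda>n. \<Union>j\<in>{..n}. A k n j \<inter> A l n j)"
  have I: "I n j \<in> sets borel" "bounded (I n j)" "I n j \<subseteq> {0..}" for n j
  proof -
    have "0 \<le> real j * T / real (Suc n)" using T by simp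
    then have "I n j \<subseteq> {0..}" unfolding I_def by (intro subsetI) (simp del: of_nat_Suc)
    then show "I n j \<in> sets borel" "bounded (I n j)" "I n j \<subseteq> {0..}" by (simp_all add: I_def)
  qed
  have mI: "measure lborel (I n j) = T / real (Suc n)" for n j
    using T by (simp add: I_def measure_lborel_Ioc field_simps del: of_nat_Suc) (simp add: field_simps)
  have AF: "A l n j \<in> sets (points_sigma \<Omega> P {l} UNIV)" for l n j
  proof -
    have "(\<lambda>\<omega>. card (P l \<omega> \<inter> I n j)) -` (- {0}) \<inter> space (points_sigma \<Omega> P {l} UNIV) \<in> sets (points_sigma \<Omega> P {l} UNIV)"
      using I by (intro measurable_sets[OF card_points_sigma_sets]) auto
    then show ?thesis by (simp add: A_def vimage_def Int_def conj_commute)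
  qed
  have Aev: "A l n j \<in> events" if "l \<in> {1..m}" for l n j
    using AF sets_points_sigma_subset[of "{l}" UNIV] that by auto
  have Bev: "B n \<in> events" for n
    unfolding B_def using Aev[OF k] Aev[OF l] by auto
  have pA: "prob (A l n j) \<le> p l * (T / real (Suc n))" if "l \<in> {1..m}" for l n j
    using prob_point_le[OF that I, of n j] unfolding mI A_def .
  have Bn: "prob (B n) \<le> p k * p l * T\<^sup>2 / real (Suc n)" for n
  proof -
    have "prob (B n) \<le> (\<Sum>j\<in>{..n}. prob (A k n j \<inter> A l n j))"
      unfolding B_def using Aev[OF k] Aev[OF l] by (intro finite_measure_subadditive_finite) auto
    also have "\<dots> \<le> (\<Sum>j\<in>{..n}. (p k * (T / real (Suc n))) * (p l * (T / real (Suc n))))"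
    proof (rule sum_mono)
      fix j
      have "prob (\<Inter>i\<in>{k, l}. A i n j) = (\<Prod>i\<in>{k, l}. prob (A i n j))"
      proof (rule indep_setsD)
        show "indep_sets (\<lambda>k. sets (points_sigma \<Omega> P {k} UNIV)) {1..m}"
          using indep_poisson unfolding independent_poisson_processes_def by simp
      qed (use k l AF in auto)
      then have "prob (A k n j \<inter> A l n j) = prob (A k n j) * prob (A l n j)" using kl by simp
      also have "\<dots> \<le> (p k * (T / real (Suc n))) * (p l * (T / real (Suc n)))"
        using intensity_pos[OF k] T by (intro mult_mono pA k l) (auto intro!: mult_nonneg_nonneg)
      finally show "prob (A k n j \<inter> A l n j) \<le> (p k * (T / real (Suc n))) * (p l * (T / real (Suc n)))" .
    qed
    also have "\<dots> = real (Suc n) * ((p k * (T / real (Suc n))) * (p l * (T / real (Suc n))))" by simp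
    also have "\<dots> = p k * p l * T\<^sup>2 / real (Suc n)"
      by (simp add: power2_eq_square field_simps del: of_nat_Suc)
    finally show ?thesis .
  qed
  have "prob (\<Inter>n. B n) \<le> p k * p l * T\<^sup>2 / real (Suc n)" for n
    using finite_measure_mono[of "\<Inter>n. B n" "B n"] Bev Bn[of n] by (meson INT_lower UNIV_I order_trans)
  moreover have "(\<lambda>n. p k * p l * T\<^sup>2 / real (Suc n)) \<longlonglongrightarrow> 0"
    by (rule LIMSEQ_Suc[OF lim_const_over_n])
  ultimately have "prob (\<Inter>n. B n) \<le> 0"
    by (intro LIMSEQ_le_const[where X="\<lambda>n. p k * p l * T\<^sup>2 / real (Suc n)"]) auto
  then have 0: "prob (\<Inter>n. B n) = 0" using measure_nonneg[of \<Omega> "\<Inter>n. B n"] by linarith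
  have cover: "\<omega> \<in> B n" if \<omega>: "\<omega> \<in> space \<Omega>" and s: "s \<in> P k \<omega> \<inter> P l \<omega> \<inter> {0<..T}" for \<omega> s n
  proof -
    have s0: "0 < s" "s \<le> T" using s by auto
    define j where "j = nat (\<lceil>s * real (Suc n) / T\<rceil> - 1)"
    have pos: "s * real (Suc n) / T > 0" using s0 T by simp
    then have c: "\<lceil>s * real (Suc n) / T\<rceil> \<ge> 1" by linarith
    have j: "real j < s * real (Suc n) / T" "s * real (Suc n) / T \<le> real (Suc j)"
      using c unfolding j_def by (simp_all add: of_nat_nat) linarith+
    then have sI: "s \<in> I n j" using T by (auto simp: I_def field_simps simp del: of_nat_Suc)
    have "s * real (Suc n) / T \<le> real (Suc n)" using s0 T by (simp add: field_simps del: of_nat_Suc)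
    then have "real j < real (Suc n)" using j(1) by linarith
    then have "j \<in> {..n}" by simp
    moreover have "\<omega> \<in> A i n j" if "i \<in> {k, l}" for i
    proof -
      have "i \<in> {1..m}" using that k l by auto
      then have "finite (P i \<omega> \<inter> I n j)" using \<omega> I(2) finite_points by blast
      moreover have "s \<in> P i \<omega> \<inter> I n j" using that s sI by auto
      ultimately show ?thesis using \<omega> unfolding A_def by (auto simp: card_eq_0_iff)
    qed
    ultimately show ?thesis unfolding B_def by blast
  qed
  show ?thesis
  proof (rule AE_I[of _ _ "\<Inter>n. B n"])
    show "{\<omega> \<in> space \<Omega>. P k \<omega> \<inter> P l \<omega> \<inter> {0<..T} \<noteq> {}} \<subseteq> (\<Inter>n. B n)" using cover by blast
    show "emeasure \<Omega> (\<Inter>n. B n) = 0" using 0 by (simp add: emeasure_eq_measure)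
    show "(\<Inter>n. B n) \<in> events" using Bev by auto
  qed
qed

end

section \<open>Measurability and growth of the process\<close>

text \<open>\<open>C\<close> is a common Lipschitz constant of the block gradients in the full norm:
  too crude for the rate, but enough for measurability and moment bounds. The sharp constants
  \<open>L\<close> and \<open>M\<close> join in \<open>delayed_descent_rates\<close>.\<close>

locale delayed_descent = poisson_family \<Omega> m p P + orthogonal_blocks m E
  for \<Omega> :: "'w measure" and m :: nat and p :: "nat \<Rightarrow> real" and P :: "nat \<Rightarrow> 'w \<Rightarrow> real set"
    and E :: "nat \<Rightarrow> 'a::euclidean_space set" +
  fixes G :: "'a \<Rightarrow> real" and C \<sigma> :: real and \<tau> \<eta> :: "nat \<Rightarrow> real"
    and \<xi> :: "nat \<Rightarrow> real \<Rightarrow> 'w \<Rightarrow> real" and X :: "real \<Rightarrow> 'w \<Rightarrow> 'a" and x0 xstar :: 'a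
  assumes G_diff: "\<And>x. G differentiable (at x)"
    and sigma_pos: "\<sigma> > 0"
    and G_convex: "strongly_convex \<sigma> G"
    and G_min: "\<And>x. G xstar \<le> G x"
    and C_nonneg: "0 \<le> C"
    and block_grad_lipschitz: "\<And>k x y. k \<in> {1..m} \<Longrightarrow>
      norm (block_grad E G k x - block_grad E G k y) \<le> C * norm (x - y)"
    and delay_nonneg: "\<And>k. k \<in> {1..m} \<Longrightarrow> \<tau> k \<ge> 0"
    and step_pos: "\<And>k. k \<in> {1..m} \<Longrightarrow> \<eta> k > 0"
    and xi_01: "\<And>k t \<omega>. k \<in> {1..m} \<Longrightarrow> t \<ge> 0 \<Longrightarrow> \<omega> \<in> space \<Omega> \<Longrightarrow> \<xi> k t \<omega> \<in> {0, 1}"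
    and xi_predictable: "\<And>k. k \<in> {1..m} \<Longrightarrow> (\<lambda>(t, \<omega>). \<xi> k t \<omega>) \<in> borel_measurable Pred"
    and descent: "delayed_coordinate_descent \<Omega> m E G P \<tau> \<eta> \<xi> x0 X"
begin

text \<open>Defined at every time, not only at points of \<open>P k\<close>, so that it can serve as
  an integrand in the compensation formula.\<close>

definition J :: "nat \<Rightarrow> real \<Rightarrow> 'w \<Rightarrow> 'a" where
  "J k s \<omega> = - (\<xi> k s \<omega> * \<eta> k) *\<^sub>R block_grad E G k (delayed (\<tau> k) (\<lambda>r. X r \<omega>) s)"

text \<open>Indexing positions by the set of times whose jumps have been made treats the current
  position, its left limit and the delayed positions alike.\<close>

definition Y :: "real set \<Rightarrow> 'w \<Rightarrow> 'a" where
  "Y S \<omega> = x0 + (\<Sum>l\<in>{1..m}. \<Sum>r\<in>points l S \<omega>. J l r \<omega>)"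

text \<open>The jump times visible to block \<open>k\<close> at time \<open>s\<close>. Without delay
  the left limit is read, which excludes a jump at \<open>s\<close>; with a positive delay the
  position at \<open>s - \<tau> k\<close> includes a jump at that time.\<close>

definition W :: "nat \<Rightarrow> real \<Rightarrow> real set" where
  "W k s = (if \<tau> k = 0 then {..<s} else {..s - \<tau> k})"

definition D :: "nat \<Rightarrow> real \<Rightarrow> 'w \<Rightarrow> 'a" where
  "D k s \<omega> = block_grad E G k (Y (W k s) \<omega>)"

lemma W_subset: "k \<in> {1..m} \<Longrightarrow> W k s \<subseteq> {..<s}"
  using delay_nonneg[of k] unfolding W_def by auto

lemma block_grad_in: "k \<in> {1..m} \<Longrightarrow> block_grad E G k x \<in> E k"
  unfolding block_grad_def by (rule orth_proj_in[OF subspace_block])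

lemma J_in: "k \<in> {1..m} \<Longrightarrow> J k s \<omega> \<in> E k"
  unfolding J_def by (intro subspace_scale subspace_block block_grad_in)

lemma X_eq:
  assumes \<omega>: "\<omega> \<in> space \<Omega>"
  shows "X t \<omega> = Y {..t} \<omega>"
proof (cases "t \<le> 0")
  case True
  then have "{0<..} \<inter> {..t} = {}" by auto
  then have "Y {..t} \<omega> = x0" by (simp add: Y_def)
  then show ?thesis using descent True \<omega> unfolding delayed_coordinate_descent_def by simp
next
  case False
  then have t: "{0<..} \<inter> {..t} = {0<..t}" "t > 0" by auto
  show ?thesis
  proof (rule eq_if_orth_proj_eq)
    fix k assume k: "k \<in> {1..m}"
    interpret linear "orth_proj (E k)" by (rule linear_orth_proj[OF subspace_block[OF k]])
    have "orth_proj (E k) (Y {..t} \<omega>) = orth_proj (E k) x0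
        + (\<Sum>l\<in>{1..m}. \<Sum>r\<in>P l \<omega> \<inter> {0<..t}. orth_proj (E k) (J l r \<omega>))"
      unfolding Y_def t by (simp only: add sum)
    also have "(\<Sum>l\<in>{1..m}. \<Sum>r\<in>P l \<omega> \<inter> {0<..t}. orth_proj (E k) (J l r \<omega>))
        = (\<Sum>l\<in>{1..m}. if k = l then (\<Sum>r\<in>P l \<omega> \<inter> {0<..t}. J l r \<omega>) else 0)"
      using k J_in by (intro sum.cong refl) (simp add: orth_proj_block)
    also have "\<dots> = (\<Sum>r\<in>P k \<omega> \<inter> {0<..t}. J k r \<omega>)" using k by simp
    finally have "orth_proj (E k) (Y {..t} \<omega>) = orth_proj (E k) x0 + (\<Sum>r\<in>P k \<omega> \<inter> {0<..t}. J k r \<omega>)" .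
    moreover have "orth_proj (E k) (X t \<omega>) = orth_proj (E k) x0
             - (\<Sum>s\<in>P k \<omega> \<inter> {0<..t}.
                  (\<xi> k s \<omega> * \<eta> k) *\<^sub>R block_grad E G k (delayed (\<tau> k) (\<lambda>r. X r \<omega>) s))"
      using descent k t \<omega> unfolding delayed_coordinate_descent_def by blast
    ultimately show "orth_proj (E k) (X t \<omega>) = orth_proj (E k) (Y {..t} \<omega>)"
      by (simp add: J_def sum_negf)
  qed
qed

lemma delayed_eq:
  assumes k: "k \<in> {1..m}" and \<omega>: "\<omega> \<in> space \<Omega>"
  shows "delayed (\<tau> k) (\<lambda>r. X r \<omega>) s = Y (W k s) \<omega>"
proof (cases "\<tau> k = 0")
  case True
  define A where "A = (\<Union>l\<in>{1..m}. points l {..<s} \<omega>)"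
  have fin: "finite A" unfolding A_def by (intro finite_UN_I finite_points_initial[OF _ \<omega>]) simp_all
  \<comment> \<open>\<open>A\<close> collects the points of all processes before \<open>s\<close>.
    After the last of them the path is constant up to \<open>s\<close>, so the left limit exists and
    has missed no earlier jump; \<open>s - 1\<close> is a default for an empty
    \<open>A\<close>.\<close>
  define b where "b = Max (insert (s - 1) A)"
  have b: "b < s" "\<And>r. r \<in> A \<Longrightarrow> r \<le> b" using fin by (auto simp: b_def A_def)
  have "Y {..r} \<omega> = Y {..<s} \<omega>" if r: "b < r" "r < s" for r
  proof -
    have "points l {..r} \<omega> = points l {..<s} \<omega>" if l: "l \<in> {1..m}" for l
    proof (intro set_eqI iffI)
      fix q assume q: "q \<in> points l {..<s} \<omega>"
      then have "q \<in> A" using l unfolding A_def by blast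
      then have "q \<le> b" by (rule b(2))
      then show "q \<in> points l {..r} \<omega>" using q r by auto
    qed (use r in auto)
    then show ?thesis unfolding Y_def by (intro arg_cong2[where f=plus] refl sum.cong) auto
  qed
  then have "\<forall>\<^sub>F r in at_left s. X r \<omega> = Y {..<s} \<omega>"
    unfolding eventually_at_left_field X_eq[OF \<omega>] using b(1) by blast
  then have "((\<lambda>r. X r \<omega>) \<longlongrightarrow> Y {..<s} \<omega>) (at_left s)" by (rule tendsto_eventually)
  then have "Lim (at_left s) (\<lambda>r. X r \<omega>) = Y {..<s} \<omega>"
    by (intro tendsto_Lim) (simp_all add: trivial_limit_at_left_real)
  then show ?thesis using True by (simp add: delayed_def W_def)
next
  case False
  then show ?thesis by (simp add: delayed_def W_def X_eq[OF \<omega>])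
qed

lemma J_eq:
  assumes "k \<in> {1..m}" "\<omega> \<in> space \<Omega>"
  shows "J k s \<omega> = - (\<xi> k s \<omega> * \<eta> k) *\<^sub>R D k s \<omega>"
  unfolding J_def D_def delayed_eq[OF assms] ..

lemma block_grad_measurable: "k \<in> {1..m} \<Longrightarrow> block_grad E G k \<in> borel_measurable borel"
proof (intro borel_measurable_continuous_onI)
  assume k: "k \<in> {1..m}"
  have "C-lipschitz_on UNIV (block_grad E G k)"
    using block_grad_lipschitz[OF k] C_nonneg by (intro lipschitz_onI) (auto simp: dist_norm)
  then show "continuous_on UNIV (block_grad E G k)" by (rule lipschitz_on_continuous_on)
qed

lemma G_measurable: "G \<in> borel_measurable borel"
  using G_diff by (intro borel_measurable_continuous_onI continuous_at_imp_continuous_on ballI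
      differentiable_imp_continuous_within) auto

text \<open>The Picard iterates: \<open>picard n k s \<omega>\<close> is the jump \<open>J k s \<omega>\<close> as soon as fewer than \<open>n\<close> points
  (counted with multiplicity) precede \<open>s\<close>.\<close>

primrec picard :: "nat \<Rightarrow> nat \<Rightarrow> real \<Rightarrow> 'w \<Rightarrow> 'a" where
  "picard 0 k s \<omega> = 0"
| "picard (Suc n) k s \<omega> = - (\<xi> k s \<omega> * \<eta> k) *\<^sub>R
     block_grad E G k (x0 + (\<Sum>l\<in>{1..m}. \<Sum>r\<in>points l (W k s) \<omega>. picard n l r \<omega>))"

lemma predictable_sum_W:
  fixes H :: "real \<times> 'w \<Rightarrow> 'b::euclidean_space"
  assumes k: "k \<in> {1..m}" and l: "l \<in> {1..m}" and H: "H \<in> borel_measurable Pred"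
  shows "(\<lambda>(t, \<omega>). \<Sum>r\<in>points l (W k t) \<omega>. H (r, \<omega>)) \<in> borel_measurable Pred"
proof (cases "\<tau> k = 0")
  case True
  then show ?thesis using predictable_sum_shift[OF l H, of 0] by (simp add: W_def)
next
  case False
  then show ?thesis using predictable_sum_delay[OF l H, of "\<tau> k"] delay_nonneg[OF k] by (simp add: W_def)
qed

lemma predictable_sums_W:
  fixes H :: "nat \<Rightarrow> real \<Rightarrow> 'w \<Rightarrow> 'a"
  assumes k: "k \<in> {1..m}" and H: "\<And>l. l \<in> {1..m} \<Longrightarrow> (\<lambda>(s, \<omega>). H l s \<omega>) \<in> borel_measurable Pred"
  shows "(\<lambda>(t, \<omega>). x0 + (\<Sum>l\<in>{1..m}. \<Sum>r\<in>points l (W k t) \<omega>. H l r \<omega>)) \<in> borel_measurable Pred"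
proof -
  have "(\<lambda>x. x0 + (\<Sum>l\<in>{1..m}. (\<lambda>(t, \<omega>). \<Sum>r\<in>points l (W k t) \<omega>. (\<lambda>(s, \<omega>). H l s \<omega>) (r, \<omega>)) x)) \<in> borel_measurable Pred"
    by (intro borel_measurable_add borel_measurable_const borel_measurable_sum predictable_sum_W[OF k _ H])
  then show ?thesis by (simp add: case_prod_beta')
qed

lemma picard_predictable: "k \<in> {1..m} \<Longrightarrow> (\<lambda>(s, \<omega>). picard n k s \<omega>) \<in> borel_measurable Pred"
proof (induction n arbitrary: k)
  case 0
  have "(\<lambda>(s, \<omega>). picard 0 k s \<omega>) = (\<lambda>_. 0)" by (simp add: fun_eq_iff)
  then show ?case by simp
next
  case (Suc n)
  note [measurable] = xi_predictable[OF Suc.prems]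
    measurable_compose[OF predictable_sums_W[OF Suc.prems Suc.IH] block_grad_measurable[OF Suc.prems]]
  have "(\<lambda>x. - ((\<lambda>(t, \<omega>). \<xi> k t \<omega>) x * \<eta> k) *\<^sub>R block_grad E G k
      ((\<lambda>(t, \<omega>). x0 + (\<Sum>l\<in>{1..m}. \<Sum>r\<in>points l (W k t) \<omega>. picard n l r \<omega>)) x)) \<in> borel_measurable Pred"
    by measurable
  then show ?case by (simp add: case_prod_beta')
qed

text \<open>A point \<open>r\<close> visible at \<open>s\<close> has strictly fewer predecessors
  than \<open>s\<close>, because \<open>r\<close> itself precedes \<open>s\<close>; so each
  unfolding of the recursion uses up at least one point.\<close>

lemma picard_eq:
  assumes \<omega>: "\<omega> \<in> space \<Omega>"
  shows "k \<in> {1..m} \<Longrightarrow> (\<Sum>l\<in>{1..m}. card (points l {..<s} \<omega>)) < n \<Longrightarrow> picard n k s \<omega> = J k s \<omega>"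
proof (induction n arbitrary: k s)
  case (Suc n)
  have "picard n l r \<omega> = J l r \<omega>" if l: "l \<in> {1..m}" and r: "r \<in> points l (W k s) \<omega>" for l r
  proof (rule Suc.IH[OF l])
    have rs: "r < s" using r W_subset[OF Suc.prems(1), of s] by auto
    have "(\<Sum>l\<in>{1..m}. card (points l {..<r} \<omega>)) < (\<Sum>l\<in>{1..m}. card (points l {..<s} \<omega>))"
    proof (rule sum_strict_mono_ex1)
      show "\<forall>l\<in>{1..m}. card (points l {..<r} \<omega>) \<le> card (points l {..<s} \<omega>)"
        using rs by (intro ballI card_mono finite_points_initial[OF _ \<omega>]) auto
      have "points l {..<r} \<omega> \<subset> points l {..<s} \<omega>" using r rs by auto
      then show "\<exists>l\<in>{1..m}. card (points l {..<r} \<omega>) < card (points l {..<s} \<omega>)"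
        using l by (intro bexI[of _ l] psubset_card_mono finite_points_initial[OF _ \<omega>]) auto
    qed simp
    then show "(\<Sum>l\<in>{1..m}. card (points l {..<r} \<omega>)) < n" using Suc.prems by simp
  qed
  then have "(\<Sum>l\<in>{1..m}. \<Sum>r\<in>points l (W k s) \<omega>. picard n l r \<omega>) =
      (\<Sum>l\<in>{1..m}. \<Sum>r\<in>points l (W k s) \<omega>. J l r \<omega>)"
    by (intro sum.cong refl) auto
  then show ?case unfolding J_eq[OF Suc.prems(1) \<omega>] D_def Y_def by (simp only: picard.simps)
qed simp

text \<open>Only finitely many points precede a given time on a given path, so the iterates
  eventually equal \<open>J\<close> there and predictability passes to the pointwise limit.\<close>

lemma J_predictable:
  assumes k: "k \<in> {1..m}"
  shows "(\<lambda>(s, \<omega>). J k s \<omega>) \<in> borel_measurable Pred"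
proof (rule borel_measurable_LIMSEQ_metric[OF picard_predictable[OF k]])
  fix x assume "x \<in> space Pred"
  then obtain s \<omega> where x: "x = (s, \<omega>)" "\<omega> \<in> space \<Omega>" by auto
  have "\<forall>\<^sub>F n in sequentially. picard n k s \<omega> = J k s \<omega>"
    using picard_eq[OF x(2) k] by (intro eventually_mono[OF eventually_gt_at_top])
  then show "(\<lambda>n. (\<lambda>(s, \<omega>). picard n k s \<omega>) x) \<longlonglongrightarrow> (case x of (s, \<omega>) \<Rightarrow> J k s \<omega>)"
    unfolding x prod.case by (rule tendsto_eventually)
qed

lemma Y_W_predictable:
  assumes k: "k \<in> {1..m}"
  shows "(\<lambda>(s, \<omega>). Y (W k s) \<omega>) \<in> borel_measurable Pred"
  unfolding Y_def by (rule predictable_sums_W[OF k J_predictable])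

lemma D_predictable:
  assumes k: "k \<in> {1..m}"
  shows "(\<lambda>(s, \<omega>). D k s \<omega>) \<in> borel_measurable Pred"
  using measurable_compose[OF Y_W_predictable[OF k] block_grad_measurable[OF k]]
  by (simp add: D_def case_prod_beta')

lemma Y_lessThan_predictable: "(\<lambda>(s, \<omega>). Y {..<s} \<omega>) \<in> borel_measurable Pred"
proof -
  have "(\<lambda>x. x0 + (\<Sum>l\<in>{1..m}. (\<lambda>(t, \<omega>). \<Sum>r\<in>points l {..<t - 0} \<omega>. (\<lambda>(s, \<omega>). J l s \<omega>) (r, \<omega>)) x)) \<in> borel_measurable Pred"
    by (intro borel_measurable_add borel_measurable_const borel_measurable_sum predictable_sum_shift J_predictable order_refl)
  then show ?thesis by (simp add: case_prod_beta' Y_def)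
qed

lemma Y_adapted:
  assumes S: "initial S"
  shows "Y S \<in> borel_measurable (F S)"
proof -
  have "(\<lambda>\<omega>. x0 + (\<Sum>l\<in>{1..m}. \<Sum>r\<in>points l S \<omega>. (\<lambda>(s, \<omega>). J l s \<omega>) (r, \<omega>))) \<in> borel_measurable (F S)"
    by (intro borel_measurable_add borel_measurable_const borel_measurable_sum adapted_sum[OF _ S] J_predictable)
  moreover have "Y S = (\<lambda>\<omega>. x0 + (\<Sum>l\<in>{1..m}. \<Sum>r\<in>points l S \<omega>. (\<lambda>(s, \<omega>). J l s \<omega>) (r, \<omega>)))"
    by (auto simp: fun_eq_iff Y_def)
  ultimately show ?thesis by simp
qed

lemma Y_measurable: "initial S \<Longrightarrow> Y S \<in> borel_measurable \<Omega>"
  by (rule measurable_from_subalg[OF subalgebra_F Y_adapted])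

section \<open>Growth of the paths\<close>

definition pts :: "real \<Rightarrow> 'w \<Rightarrow> real set" where
  "pts T \<omega> = (\<Union>l\<in>{1..m}. points l {..T} \<omega>)"

definition jump :: "real \<Rightarrow> 'w \<Rightarrow> 'a" where
  "jump s \<omega> = (\<Sum>k\<in>{k\<in>{1..m}. s \<in> P k \<omega>}. J k s \<omega>)"

lemma finite_pts: "\<omega> \<in> space \<Omega> \<Longrightarrow> finite (pts T \<omega>)"
  unfolding pts_def by (intro finite_UN_I finite_points_initial) simp_all

lemma card_pts_le: "card (pts T \<omega>) \<le> count T \<omega>"
  unfolding pts_def count_def by (rule card_UN_le) simp

text \<open>Regroups by time instead of by process, since the Gronwall bound and the telescoping
  follow the order of the jump times.\<close>

lemma sum_points_eq:
  fixes f :: "nat \<Rightarrow> real \<Rightarrow> 'b::comm_monoid_add"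
  assumes \<omega>: "\<omega> \<in> space \<Omega>" and S: "S \<subseteq> {..T}"
  shows "(\<Sum>l\<in>{1..m}. \<Sum>r\<in>points l S \<omega>. f l r) = (\<Sum>r\<in>pts T \<omega> \<inter> S. \<Sum>k\<in>{k\<in>{1..m}. r \<in> P k \<omega>}. f k r)"
proof -
  have "points l S \<omega> = {r\<in>pts T \<omega> \<inter> S. r \<in> P l \<omega>}" if "l \<in> {1..m}" for l
    using that S unfolding pts_def by auto
  then have "(\<Sum>l\<in>{1..m}. \<Sum>r\<in>points l S \<omega>. f l r) = (\<Sum>l\<in>{1..m}. \<Sum>r\<in>{r\<in>pts T \<omega> \<inter> S. r \<in> P l \<omega>}. f l r)"
    by (intro sum.cong) auto
  also have "\<dots> = (\<Sum>r\<in>pts T \<omega> \<inter> S. \<Sum>k\<in>{k\<in>{1..m}. r \<in> P k \<omega>}. f k r)"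
    using finite_pts[OF \<omega>] by (intro sum.swap_restrict) auto
  finally show ?thesis .
qed

lemma Y_eq_jumps:
  assumes "\<omega> \<in> space \<Omega>" "S \<subseteq> {..T}"
  shows "Y S \<omega> = x0 + (\<Sum>r\<in>pts T \<omega> \<inter> S. jump r \<omega>)"
  unfolding Y_def jump_def sum_points_eq[OF assms] ..

lemma grad_xstar: "grad G xstar = 0"
proof -
  have "(\<lambda>h. grad G xstar \<bullet> h) = (\<lambda>v. 0)"
    using G_min by (intro differential_zero_maxmin[OF _ open_UNIV has_derivative_grad[OF G_diff]]) auto
  then have "grad G xstar \<bullet> grad G xstar = 0" by metis
  then show ?thesis by simp
qed

lemma norm_block_grad_le: "k \<in> {1..m} \<Longrightarrow> norm (block_grad E G k x) \<le> C * norm (x - xstar)"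
proof -
  assume k: "k \<in> {1..m}"
  have "block_grad E G k xstar = 0"
    unfolding block_grad_def grad_xstar using linear_0[OF linear_orth_proj[OF subspace_block[OF k]]] .
  then show ?thesis using block_grad_lipschitz[OF k, of x xstar] by simp
qed

text \<open>The factor by which one jump time can enlarge the distance to \<open>xstar\<close>: even
  if all blocks jump at once, the increments add up to at most the sum of the
  \<open>\<eta> k * C\<close> times the largest distance seen so far.\<close>

definition a :: real where "a = 1 + (\<Sum>k\<in>{1..m}. \<eta> k * C)"

definition R :: "real \<Rightarrow> 'w \<Rightarrow> real" where "R T \<omega> = a ^ count T \<omega> * norm (x0 - xstar)"

lemma a_ge_1: "a \<ge> 1"
proof -
  have "0 \<le> (\<Sum>k\<in>{1..m}. \<eta> k * C)"
    by (intro sum_nonneg mult_nonneg_nonneg C_nonneg less_imp_le[OF step_pos])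
  then show ?thesis by (simp add: a_def)
qed

lemma R_nonneg: "0 \<le> R T \<omega>"
  using a_ge_1 unfolding R_def by simp

lemma norm_jump_le:
  assumes \<omega>: "\<omega> \<in> space \<Omega>" and s: "0 < s"
    and B: "\<And>k. k \<in> {1..m} \<Longrightarrow> norm (Y (W k s) \<omega> - xstar) \<le> B"
  shows "norm (jump s \<omega>) \<le> (\<Sum>k\<in>{1..m}. \<eta> k * C) * B"
proof -
  have "norm (jump s \<omega>) \<le> (\<Sum>k\<in>{k\<in>{1..m}. s \<in> P k \<omega>}. norm (J k s \<omega>))"
    unfolding jump_def by (rule norm_sum)
  also have "\<dots> \<le> (\<Sum>k\<in>{1..m}. norm (J k s \<omega>))"
    by (intro sum_mono2) auto
  also have "\<dots> \<le> (\<Sum>k\<in>{1..m}. (\<eta> k * C) * B)"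
  proof (rule sum_mono)
    fix k assume k: "k \<in> {1..m}"
    have "norm (D k s \<omega>) \<le> C * B"
      unfolding D_def using norm_block_grad_le[OF k, of "Y (W k s) \<omega>"] mult_left_mono[OF B[OF k] C_nonneg]
      by linarith
    then have "\<eta> k * norm (D k s \<omega>) \<le> \<eta> k * (C * B)"
      using step_pos[OF k] by (intro mult_left_mono) auto
    moreover have "\<bar>\<xi> k s \<omega>\<bar> \<le> 1" using xi_01[OF k _ \<omega>, of s] s by auto
    then have "\<bar>\<xi> k s \<omega>\<bar> * (\<eta> k * norm (D k s \<omega>)) \<le> 1 * (\<eta> k * norm (D k s \<omega>))"
      using step_pos[OF k] by (intro mult_right_mono) auto
    ultimately show "norm (J k s \<omega>) \<le> (\<eta> k * C) * B"
      unfolding J_eq[OF k \<omega>] using step_pos[OF k] by (simp add: abs_mult mult.assoc)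
  qed
  finally show ?thesis by (simp add: sum_distrib_right)
qed

text \<open>The discrete Gronwall inequality for distances to \<open>xstar\<close>, at which all
  block gradients vanish. The bound is uniform in the set of jump times, so it covers delayed
  positions and left limits at once.\<close>

lemma norm_Y_le:
  assumes \<omega>: "\<omega> \<in> space \<Omega>" and S: "S \<subseteq> {..T}"
  shows "norm (Y S \<omega> - xstar) \<le> R T \<omega>"
proof -
  have Y: "Y S' \<omega> - xstar = (x0 - xstar) + (\<Sum>r\<in>pts T \<omega> \<inter> S'. jump r \<omega>)" if "S' \<subseteq> {..T}" for S'
    using Y_eq_jumps[OF \<omega> that] by simp
  have "norm ((x0 - xstar) + (\<Sum>r\<in>pts T \<omega> \<inter> S. jump r \<omega>)) \<le> (1 + (\<Sum>k\<in>{1..m}. \<eta> k * C)) ^ card (pts T \<omega>) * norm (x0 - xstar)"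
  proof (rule norm_partial_sums_le[OF finite_pts[OF \<omega>]])
    show "0 \<le> (\<Sum>k\<in>{1..m}. \<eta> k * C)" using a_ge_1 by (simp add: a_def)
    fix s B assume s: "s \<in> pts T \<omega>"
      and B: "\<And>S'. S' \<subseteq> {..<s} \<Longrightarrow> norm ((x0 - xstar) + (\<Sum>r\<in>pts T \<omega> \<inter> S'. jump r \<omega>)) \<le> B"
    have s': "0 < s" "s \<le> T" using s by (auto simp: pts_def)
    show "norm (jump s \<omega>) \<le> (\<Sum>k\<in>{1..m}. \<eta> k * C) * B"
    proof (rule norm_jump_le[OF \<omega> s'(1)])
      fix k assume k: "k \<in> {1..m}"
      have "{..<s} \<subseteq> {..T}" using s' by auto
      then show "norm (Y (W k s) \<omega> - xstar) \<le> B"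
        using B[OF W_subset[OF k]] Y[OF order_trans[OF W_subset[OF k]], of s] by (simp add: diff_add_eq)
    qed
  qed
  also have "\<dots> \<le> R T \<omega>"
    unfolding R_def a_def[symmetric] using a_ge_1 card_pts_le
    by (intro mult_right_mono power_increasing) auto
  finally show ?thesis using Y[OF S] by (simp add: diff_add_eq)
qed

lemma integrable_R_sq: "integrable \<Omega> (\<lambda>\<omega>. (R T \<omega>)\<^sup>2)"
proof -
  have "(R T \<omega>)\<^sup>2 = (a\<^sup>2) ^ count T \<omega> * (norm (x0 - xstar))\<^sup>2" for \<omega>
    unfolding R_def by (simp add: power_mult_distrib power_mult[symmetric] mult.commute)
  moreover have "integrable \<Omega> (\<lambda>\<omega>. (a\<^sup>2) ^ count T \<omega> * (norm (x0 - xstar))\<^sup>2)"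
    using a_ge_1 by (intro integrable_mult_left integrable_power_count) (auto simp: one_le_power)
  ultimately show ?thesis by simp
qed

lemma norm_grad_le: "norm (grad G x) \<le> real m * C * norm (x - xstar)"
proof -
  have "norm (grad G x) = norm (\<Sum>k\<in>{1..m}. block_grad E G k x)"
    unfolding block_grad_def sum_orth_proj ..
  also have "\<dots> \<le> (\<Sum>k\<in>{1..m}. C * norm (x - xstar))"
    by (rule sum_norm_le) (rule norm_block_grad_le)
  finally show ?thesis by simp
qed

text \<open>Convexity bounds the gap by the gradient, and the gradient grows at most linearly; hence
  square integrability of \<open>R\<close> is enough to integrate \<open>G\<close> along the
  process.\<close>

lemma G_growth: "G x - G xstar \<le> real m * C * (norm (x - xstar))\<^sup>2"
proof -
  have "G x - G xstar \<le> grad G x \<bullet> (x - xstar) - \<sigma> / 2 * (norm (x - xstar))\<^sup>2"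
    using strongly_convex_grad_le[OF G_diff G_convex, of x xstar] by (simp add: inner_diff_right)
  also have "\<dots> \<le> grad G x \<bullet> (x - xstar)" using sigma_pos by simp
  also have "\<dots> \<le> norm (grad G x) * norm (x - xstar)" by (rule norm_cauchy_schwarz)
  also have "\<dots> \<le> (real m * C * norm (x - xstar)) * norm (x - xstar)"
    by (intro mult_right_mono norm_grad_le) auto
  finally show ?thesis by (simp add: power2_eq_square mult.assoc)
qed

end

section \<open>Expected increments\<close>

context poisson_family begin

lemma fst_predictable: "fst \<in> borel_measurable Pred"
proof -
  have "(\<lambda>(t, \<omega>). t) \<in> borel_measurable Pred"
    by (rule left_continuous_predictable) (auto intro!: tendsto_eq_intros)
  moreover have "fst = (\<lambda>(t::real, \<omega>::'w). t)" by auto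
  ultimately show ?thesis by simp
qed

lemma expectation_mult_indep:
  fixes f g :: "'w \<Rightarrow> real"
  assumes disj: "S \<inter> S' = {}" and f: "f \<in> borel_measurable (F S)" and g: "g \<in> borel_measurable (F S')"
    and nonneg: "\<And>\<omega>. \<omega> \<in> space \<Omega> \<Longrightarrow> 0 \<le> f \<omega>" "\<And>\<omega>. \<omega> \<in> space \<Omega> \<Longrightarrow> 0 \<le> g \<omega>"
    and int: "integrable \<Omega> f" "integrable \<Omega> g"
  shows "integrable \<Omega> (\<lambda>\<omega>. f \<omega> * g \<omega>)" "expectation (\<lambda>\<omega>. f \<omega> * g \<omega>) = expectation f * expectation g"
proof -
  have "(\<integral>\<^sup>+\<omega>. ennreal (f \<omega> * g \<omega>) \<partial>\<Omega>) = (\<integral>\<^sup>+\<omega>. ennreal (f \<omega>) * ennreal (g \<omega>) \<partial>\<Omega>)"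
    by (intro nn_integral_cong) (simp add: ennreal_mult nonneg)
  also have "\<dots> = (\<integral>\<^sup>+\<omega>. ennreal (f \<omega>) \<partial>\<Omega>) * (\<integral>\<^sup>+\<omega>. ennreal (g \<omega>) \<partial>\<Omega>)"
    by (intro nn_integral_mult_indep[OF disj] measurable_compose[OF f measurable_ennreal]
        measurable_compose[OF g measurable_ennreal])
  also have "\<dots> = ennreal (expectation f) * ennreal (expectation g)"
    using nonneg by (simp add: nn_integral_eq_integral[OF int(1)] nn_integral_eq_integral[OF int(2)])
  also have "\<dots> = ennreal (expectation f * expectation g)"
    using nonneg by (intro ennreal_mult[symmetric] integral_nonneg_AE) auto
  finally have eq: "(\<integral>\<^sup>+\<omega>. ennreal (f \<omega> * g \<omega>) \<partial>\<Omega>) = ennreal (expectation f * expectation g)" .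
  have meas: "(\<lambda>\<omega>. f \<omega> * g \<omega>) \<in> borel_measurable \<Omega>" using int by measurable
  show "integrable \<Omega> (\<lambda>\<omega>. f \<omega> * g \<omega>)"
    using eq nonneg by (intro integrableI_nonneg meas AE_I2 mult_nonneg_nonneg) auto
  have "0 \<le> expectation f * expectation g"
    using nonneg by (intro mult_nonneg_nonneg integral_nonneg_AE) auto
  then show "expectation (\<lambda>\<omega>. f \<omega> * g \<omega>) = expectation f * expectation g"
    using nonneg by (subst integral_eq_nn_integral[OF meas]) (auto simp: eq)
qed

lemma integrable_pair_predictable:
  fixes H :: "real \<times> 'w \<Rightarrow> real"
  assumes H: "H \<in> borel_measurable Pred"
    and bound: "\<And>s \<omega>. 0 < s \<Longrightarrow> s \<le> T \<Longrightarrow> \<omega> \<in> space \<Omega> \<Longrightarrow> \<bar>H (s, \<omega>)\<bar> \<le> g \<omega>"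
    and g: "integrable \<Omega> g"
  shows "integrable (lborel \<Otimes>\<^sub>M \<Omega>) (\<lambda>x. if fst x \<in> {0<..} \<inter> {..T} then H x else 0)"
proof (rule Bochner_Integration.integrable_bound)
  interpret pair_sigma_finite "lborel :: real measure" \<Omega> ..
  have gm: "g \<in> borel_measurable \<Omega>" using g by simp
  have "integrable (lborel \<Otimes>\<^sub>M \<Omega>) (\<lambda>(s::real, \<omega>). indicator {0<..T} s * \<bar>g \<omega>\<bar>)"
  proof (rule Fubini_integrable)
    show "(\<lambda>(s::real, \<omega>). indicator {0<..T} s * \<bar>g \<omega>\<bar>) \<in> borel_measurable (lborel \<Otimes>\<^sub>M \<Omega>)"
      using gm by measurable
    have "expectation (\<lambda>\<omega>. norm (case (s, \<omega>) of (s, \<omega>) \<Rightarrow> indicator {0<..T} s * \<bar>g \<omega>\<bar>))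
        = indicator {0<..T} s * expectation (\<lambda>\<omega>. \<bar>g \<omega>\<bar>)" for s
      by (simp add: abs_mult)
    moreover have fin: "emeasure lborel {0<..T} < \<infinity>" by (rule emeasure_bounded_finite) simp
    have "integrable lborel (\<lambda>s::real. indicator {0<..T} s * expectation (\<lambda>\<omega>. \<bar>g \<omega>\<bar>))"
      by (intro integrable_mult_left integrable_real_indicator) (use fin in auto)
    ultimately show "integrable lborel (\<lambda>s. expectation (\<lambda>\<omega>. norm (case (s, \<omega>) of (s, \<omega>) \<Rightarrow> indicator {0<..T} s * \<bar>g \<omega>\<bar>)))"
      by simp
    show "AE s in lborel. integrable \<Omega> (\<lambda>\<omega>. case (s, \<omega>) of (s, \<omega>) \<Rightarrow> indicator {0<..T} s * \<bar>g \<omega>\<bar>)"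
      using g by (intro AE_I2) (simp add: integrable_mult_right)
  qed
  then show "integrable (lborel \<Otimes>\<^sub>M \<Omega>) (\<lambda>(s::real, \<omega>). indicator {0<..T} s * \<bar>g \<omega>\<bar>)" .
  show "(\<lambda>x. if fst x \<in> {0<..} \<inter> {..T} then H x else 0) \<in> borel_measurable (lborel \<Otimes>\<^sub>M \<Omega>)"
    by (rule Pred_measurable_pair[OF H]) auto
  show "AE x in lborel \<Otimes>\<^sub>M \<Omega>. norm (if fst x \<in> {0<..} \<inter> {..T} then H x else 0) \<le> norm (case x of (s, \<omega>) \<Rightarrow> indicator {0<..T} s * \<bar>g \<omega>\<bar>)"
  proof (rule AE_I2)
    fix x :: "real \<times> 'w" assume "x \<in> space (lborel \<Otimes>\<^sub>M \<Omega>)"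
    then obtain s \<omega> where x: "x = (s, \<omega>)" "\<omega> \<in> space \<Omega>" by (auto simp: space_pair_measure)
    show "norm (if fst x \<in> {0<..} \<inter> {..T} then H x else 0) \<le> norm (case x of (s, \<omega>) \<Rightarrow> indicator {0<..T} s * \<bar>g \<omega>\<bar>)"
      using bound[of s \<omega>] x by (auto simp: indicator_def)
  qed
qed

lemma expectation_predictable:
  fixes H :: "real \<times> 'w \<Rightarrow> real"
  assumes H: "H \<in> borel_measurable Pred"
    and bound: "\<And>s \<omega>. 0 < s \<Longrightarrow> s \<le> T \<Longrightarrow> \<omega> \<in> space \<Omega> \<Longrightarrow> \<bar>H (s, \<omega>)\<bar> \<le> g \<omega>"
    and g: "integrable \<Omega> g"
  shows "set_integrable lborel {0<..T} (\<lambda>s. expectation (\<lambda>\<omega>. H (s, \<omega>)))"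
    and "integral\<^sup>L (lborel \<Otimes>\<^sub>M \<Omega>) (\<lambda>x. if fst x \<in> {0<..} \<inter> {..T} then H x else 0)
      = (LBINT s:{0<..T}. expectation (\<lambda>\<omega>. H (s, \<omega>)))"
proof -
  interpret pair_sigma_finite "lborel :: real measure" \<Omega> ..
  let ?f = "\<lambda>x. if fst x \<in> {0<..} \<inter> {..T} then H x else 0"
  note int = integrable_pair_predictable[OF H bound g]
  have eq: "expectation (\<lambda>\<omega>. ?f (s, \<omega>)) = indicator {0<..T} s *\<^sub>R expectation (\<lambda>\<omega>. H (s, \<omega>))" for s
    by (cases "0 < s"; cases "s \<le> T") simp_all
  show "set_integrable lborel {0<..T} (\<lambda>s. expectation (\<lambda>\<omega>. H (s, \<omega>)))"
    unfolding set_integrable_def eq[symmetric] by (rule integrable_fst'[OF int])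
  show "integral\<^sup>L (lborel \<Otimes>\<^sub>M \<Omega>) ?f = (LBINT s:{0<..T}. expectation (\<lambda>\<omega>. H (s, \<omega>)))"
    unfolding set_lebesgue_integral_def eq[symmetric] by (rule integral_fst'[OF int, symmetric])
qed

lemma measurable_at_time:
  fixes H :: "real \<times> 'w \<Rightarrow> 'b::topological_space"
  assumes "H \<in> borel_measurable Pred" "0 \<le> s"
  shows "(\<lambda>\<omega>. H (s, \<omega>)) \<in> borel_measurable \<Omega>"
proof (rule measurableI)
  fix B :: "'b set" assume "B \<in> sets borel"
  then have "H -` B \<inter> space Pred \<in> sets (lborel \<Otimes>\<^sub>M \<Omega>)"
    using assms(1) by (intro Pred_subset_pair measurable_sets)
  then have "Pair s -` (H -` B \<inter> space Pred) \<in> events" by (rule sets_Pair1)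
  moreover have "Pair s -` (H -` B \<inter> space Pred) = (\<lambda>\<omega>. H (s, \<omega>)) -` B \<inter> space \<Omega>" using assms(2) by auto
  ultimately show "(\<lambda>\<omega>. H (s, \<omega>)) -` B \<inter> space \<Omega> \<in> events" by simp
qed simp

text \<open>The signed version of the compensation formula. The dominating variable \<open>g\<close>
  does not depend on time, which makes both parts integrable over the bounded time interval and
  their difference meaningful.\<close>

lemma expectation_sum_points:
  fixes H :: "real \<times> 'w \<Rightarrow> real"
  assumes l: "l \<in> {1..m}" and H: "H \<in> borel_measurable Pred"
    and bound: "\<And>s \<omega>. 0 < s \<Longrightarrow> s \<le> T \<Longrightarrow> \<omega> \<in> space \<Omega> \<Longrightarrow> \<bar>H (s, \<omega>)\<bar> \<le> g \<omega>"
    and g: "integrable \<Omega> g"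
  shows "integrable \<Omega> (\<lambda>\<omega>. \<Sum>r\<in>points l {..T} \<omega>. H (r, \<omega>))"
    and "expectation (\<lambda>\<omega>. \<Sum>r\<in>points l {..T} \<omega>. H (r, \<omega>))
      = p l * (LBINT s:{0<..T}. expectation (\<lambda>\<omega>. H (s, \<omega>)))"
proof -
  let ?f = "\<lambda>H x. if fst x \<in> {0<..} \<inter> {..T} then H x else (0::real)"
  let ?S = "\<lambda>H \<omega>. \<Sum>r\<in>points l {..T} \<omega>. (H (r, \<omega>) :: real)"
  have pos: "integrable \<Omega> (?S h) \<and> expectation (?S h) = p l * integral\<^sup>L (lborel \<Otimes>\<^sub>M \<Omega>) (?f h)"
    if h: "h \<in> borel_measurable Pred" and nn: "\<And>x. 0 \<le> h x"
      and b: "\<And>s \<omega>. 0 < s \<Longrightarrow> s \<le> T \<Longrightarrow> \<omega> \<in> space \<Omega> \<Longrightarrow> \<bar>h (s, \<omega>)\<bar> \<le> g \<omega>" for h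
  proof -
    have int: "integrable (lborel \<Otimes>\<^sub>M \<Omega>) (?f h)" by (rule integrable_pair_predictable[OF h b g])
    have fn: "0 \<le> integral\<^sup>L (lborel \<Otimes>\<^sub>M \<Omega>) (?f h)" by (rule integral_nonneg_AE) (simp add: nn)
    have "(\<integral>\<^sup>+\<omega>. ennreal (?S h \<omega>) \<partial>\<Omega>) = (\<integral>\<^sup>+\<omega>. (\<Sum>r\<in>points l {..T} \<omega>. ennreal (h (r, \<omega>))) \<partial>\<Omega>)"
      using nn by (intro nn_integral_cong) (simp add: sum_ennreal)
    also have "\<dots> = ennreal (p l) * (\<integral>\<^sup>+x. (if fst x \<in> {0<..} \<inter> {..T} then ennreal (h x) else 0) \<partial>(lborel \<Otimes>\<^sub>M \<Omega>))"
      using h by (intro nn_integral_sum_points l initial_atMost) measurable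
    also have "(\<integral>\<^sup>+x. (if fst x \<in> {0<..} \<inter> {..T} then ennreal (h x) else 0) \<partial>(lborel \<Otimes>\<^sub>M \<Omega>))
        = (\<integral>\<^sup>+x. ennreal (?f h x) \<partial>(lborel \<Otimes>\<^sub>M \<Omega>))"
      by (intro nn_integral_cong) simp
    also have "\<dots> = ennreal (integral\<^sup>L (lborel \<Otimes>\<^sub>M \<Omega>) (?f h))"
      by (rule nn_integral_eq_integral[OF int]) (simp add: nn)
    also have "ennreal (p l) * \<dots> = ennreal (p l * integral\<^sup>L (lborel \<Otimes>\<^sub>M \<Omega>) (?f h))"
      using intensity_pos[OF l] fn by (simp add: ennreal_mult)
    finally have eq: "(\<integral>\<^sup>+\<omega>. ennreal (?S h \<omega>) \<partial>\<Omega>) = ennreal (p l * integral\<^sup>L (lborel \<Otimes>\<^sub>M \<Omega>) (?f h))" .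
    have meas: "?S h \<in> borel_measurable \<Omega>"
      by (rule measurable_from_subalg[OF subalgebra_F adapted_sum_real[OF l initial_atMost h]])
    have "integrable \<Omega> (?S h)"
      by (rule integrableI_nonneg[OF meas]) (auto simp: eq nn sum_nonneg)
    moreover have "expectation (?S h) = p l * integral\<^sup>L (lborel \<Otimes>\<^sub>M \<Omega>) (?f h)"
      using intensity_pos[OF l] fn nn by (subst integral_eq_nn_integral[OF meas]) (auto simp: eq sum_nonneg)
    ultimately show ?thesis ..
  qed
  let ?p = "\<lambda>x. max 0 (H x)" and ?n = "\<lambda>x. max 0 (- H x)"
  have b: "\<bar>max 0 (H (s, \<omega>))\<bar> \<le> g \<omega>" "\<bar>max 0 (- H (s, \<omega>))\<bar> \<le> g \<omega>" if "0 < s" "s \<le> T" "\<omega> \<in> space \<Omega>" for s \<omega>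
    using bound[OF that] by auto
  have pm: "?p \<in> borel_measurable Pred" "?n \<in> borel_measurable Pred" using H by measurable
  have d: "max 0 x - max 0 (- x) = x" for x :: real by simp
  note p = pos[OF pm(1) _ b(1)] and n = pos[OF pm(2) _ b(2)]
  have S: "?S H = (\<lambda>\<omega>. ?S ?p \<omega> - ?S ?n \<omega>)" by (simp only: sum_subtractf[symmetric] d)
  have f: "?f H = (\<lambda>x. ?f ?p x - ?f ?n x)" by (auto simp: fun_eq_iff d)
  show "integrable \<Omega> (?S H)"
    unfolding S using p n by (intro Bochner_Integration.integrable_diff) auto
  have "expectation (?S H) = expectation (?S ?p) - expectation (?S ?n)"
    unfolding S using p n by (intro Bochner_Integration.integral_diff) auto
  also have "\<dots> = p l * (integral\<^sup>L (lborel \<Otimes>\<^sub>M \<Omega>) (?f ?p) - integral\<^sup>L (lborel \<Otimes>\<^sub>M \<Omega>) (?f ?n))"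
    using p n by (simp add: right_diff_distrib)
  also have "integral\<^sup>L (lborel \<Otimes>\<^sub>M \<Omega>) (?f ?p) - integral\<^sup>L (lborel \<Otimes>\<^sub>M \<Omega>) (?f ?n) = integral\<^sup>L (lborel \<Otimes>\<^sub>M \<Omega>) (?f H)"
    unfolding f
    by (intro Bochner_Integration.integral_diff[symmetric] integrable_pair_predictable[OF pm(1) b(1) g]
        integrable_pair_predictable[OF pm(2) b(2) g])
  also have "\<dots> = (LBINT s:{0<..T}. expectation (\<lambda>\<omega>. H (s, \<omega>)))"
    by (rule expectation_predictable(2)[OF H bound g])
  finally show "expectation (?S H) = p l * (LBINT s:{0<..T}. expectation (\<lambda>\<omega>. H (s, \<omega>)))" .
qed

end

context delayed_descent begin

text \<open>Taken from the left limit and for a single block, whether or not \<open>s\<close> is a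
  point: this makes it a predictable integrand, and it is the true increment of \<open>G\<close> at
  points of \<open>P k\<close> that no other process shares.\<close>

definition \<Delta> :: "nat \<Rightarrow> real \<Rightarrow> 'w \<Rightarrow> real" where
  "\<Delta> k s \<omega> = G (Y {..<s} \<omega> + J k s \<omega>) - G (Y {..<s} \<omega>)"

lemma Delta_predictable:
  assumes k: "k \<in> {1..m}"
  shows "(\<lambda>(s, \<omega>). \<Delta> k s \<omega>) \<in> borel_measurable Pred"
proof -
  have "(\<lambda>x. G ((\<lambda>(s, \<omega>). Y {..<s} \<omega>) x + (\<lambda>(s, \<omega>). J k s \<omega>) x) - G ((\<lambda>(s, \<omega>). Y {..<s} \<omega>) x)) \<in> borel_measurable Pred"
    by (intro borel_measurable_diff measurable_compose[OF _ G_measurable] borel_measurable_add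
        Y_lessThan_predictable J_predictable k)
  then show ?thesis by (simp add: \<Delta>_def case_prod_beta')
qed

lemma norm_D_le:
  assumes "k \<in> {1..m}" "\<omega> \<in> space \<Omega>" "s \<le> T"
  shows "norm (D k s \<omega>) \<le> C * R T \<omega>"
proof -
  have "W k s \<subseteq> {..T}" using W_subset[OF assms(1), of s] assms(3) by auto
  from norm_Y_le[OF assms(2) this] have "C * norm (Y (W k s) \<omega> - xstar) \<le> C * R T \<omega>"
    using C_nonneg by (intro mult_left_mono)
  then show ?thesis unfolding D_def using norm_block_grad_le[OF assms(1)] order_trans by blast
qed

lemma Delta_bound:
  assumes k: "k \<in> {1..m}" and \<omega>: "\<omega> \<in> space \<Omega>" and s: "0 < s" "s \<le> T"
  shows "\<bar>\<Delta> k s \<omega>\<bar> \<le> real m * C * (1 + \<eta> k * C)\<^sup>2 * (R T \<omega>)\<^sup>2"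
proof -
  let ?B = "real m * C * ((1 + \<eta> k * C) * R T \<omega>)\<^sup>2"
  have \<eta>: "0 \<le> \<eta> k * C" using step_pos[OF k] C_nonneg by simp
  have bound: "0 \<le> G y - G xstar \<and> G y - G xstar \<le> ?B" if "norm (y - xstar) \<le> (1 + \<eta> k * C) * R T \<omega>" for y
  proof -
    have "(norm (y - xstar))\<^sup>2 \<le> ((1 + \<eta> k * C) * R T \<omega>)\<^sup>2" using that by (intro power_mono) auto
    then have "real m * C * (norm (y - xstar))\<^sup>2 \<le> ?B" using C_nonneg by (intro mult_left_mono) auto
    then show ?thesis using G_growth[of y] G_min[of y] by linarith
  qed
  have "{..<s} \<subseteq> {..T}" using s by auto
  from norm_Y_le[OF \<omega> this] have Y: "norm (Y {..<s} \<omega> - xstar) \<le> R T \<omega>" .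
  have "norm (J k s \<omega>) \<le> \<eta> k * C * R T \<omega>"
  proof -
    have "\<bar>\<xi> k s \<omega>\<bar> \<le> 1" using xi_01[OF k _ \<omega>, of s] s by auto
    then have "\<bar>\<xi> k s \<omega>\<bar> * (\<eta> k * norm (D k s \<omega>)) \<le> 1 * (\<eta> k * norm (D k s \<omega>))"
      using step_pos[OF k] by (intro mult_right_mono) auto
    also have "\<dots> \<le> \<eta> k * (C * R T \<omega>)"
      using step_pos[OF k] norm_D_le[OF k \<omega> s(2)] by simp
    finally show ?thesis unfolding J_eq[OF k \<omega>] using step_pos[OF k] by (simp add: abs_mult mult.assoc)
  qed
  then have "norm (Y {..<s} \<omega> + J k s \<omega> - xstar) \<le> (1 + \<eta> k * C) * R T \<omega>"
    using Y norm_triangle_ineq[of "Y {..<s} \<omega> - xstar" "J k s \<omega>"] by (simp add: algebra_simps)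
  from bound[OF this] have b1: "0 \<le> G (Y {..<s} \<omega> + J k s \<omega>) - G xstar" "G (Y {..<s} \<omega> + J k s \<omega>) - G xstar \<le> ?B" by auto
  have "R T \<omega> \<le> (1 + \<eta> k * C) * R T \<omega>" using mult_right_mono[of 1 "1 + \<eta> k * C" "R T \<omega>"] \<eta> R_nonneg by simp
  then have "norm (Y {..<s} \<omega> - xstar) \<le> (1 + \<eta> k * C) * R T \<omega>" using Y by linarith
  from bound[OF this] have b2: "0 \<le> G (Y {..<s} \<omega>) - G xstar" "G (Y {..<s} \<omega>) - G xstar \<le> ?B" by auto
  have "\<bar>\<Delta> k s \<omega>\<bar> \<le> ?B" unfolding \<Delta>_def using b1 b2 by linarith
  then show ?thesis by (simp add: power_mult_distrib mult.assoc)
qed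

text \<open>\<open>G\<close> telescopes over the ordered jump times. The total jump at such a time
  belongs to one block only because almost surely no point is shared, and this exceptional set is
  why the identity is not pathwise.\<close>

lemma AE_telescope:
  assumes T: "T > 0"
  shows "AE \<omega> in \<Omega>. G (X T \<omega>) = G x0 + (\<Sum>k\<in>{1..m}. \<Sum>s\<in>points k {..T} \<omega>. \<Delta> k s \<omega>)"
proof -
  have "AE \<omega> in \<Omega>. \<forall>k\<in>{1..m}. \<forall>l\<in>{1..m}. k \<noteq> l \<longrightarrow> P k \<omega> \<inter> P l \<omega> \<inter> {0<..T} = {}"
    using AE_no_common_point[OF _ _ _ T] by (intro AE_finite_allI) auto
  with AE_space show ?thesis
  proof eventually_elim
    case (elim \<omega>)
    note \<omega> = elim(1)
    have single: "\<exists>k0. {k\<in>{1..m}. s \<in> P k \<omega>} = {k0}" if s: "s \<in> pts T \<omega>" for s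
    proof -
      obtain k0 where k0: "k0 \<in> {1..m}" "s \<in> P k0 \<omega>" "s \<in> {0<..T}" using s unfolding pts_def by auto
      have "k = k0" if "k \<in> {1..m}" "s \<in> P k \<omega>" for k
        using elim(2) k0 that by blast
      then show ?thesis using k0 by auto
    qed
    have Ys: "x0 + (\<Sum>r\<in>pts T \<omega> \<inter> {..<s}. jump r \<omega>) = Y {..<s} \<omega>" if "s \<in> pts T \<omega>" for s
      using that by (intro Y_eq_jumps[OF \<omega>, symmetric]) (auto simp: pts_def)
    have "pts T \<omega> \<inter> {..T} = pts T \<omega>" unfolding pts_def by auto
    then have "X T \<omega> = x0 + (\<Sum>r\<in>pts T \<omega>. jump r \<omega>)"
      unfolding X_eq[OF \<omega>] using Y_eq_jumps[OF \<omega> order_refl, of T] by simp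
    then have "G (X T \<omega>) = G x0 + (\<Sum>s\<in>pts T \<omega>. G (x0 + (\<Sum>r\<in>pts T \<omega> \<inter> {..<s}. jump r \<omega>) + jump s \<omega>)
        - G (x0 + (\<Sum>r\<in>pts T \<omega> \<inter> {..<s}. jump r \<omega>)))"
      using telescope_finite_set[OF finite_pts[OF \<omega>], of G x0 "\<lambda>r. jump r \<omega>" T] by simp
    also have "(\<Sum>s\<in>pts T \<omega>. G (x0 + (\<Sum>r\<in>pts T \<omega> \<inter> {..<s}. jump r \<omega>) + jump s \<omega>)
        - G (x0 + (\<Sum>r\<in>pts T \<omega> \<inter> {..<s}. jump r \<omega>))) = (\<Sum>s\<in>pts T \<omega>. \<Sum>k\<in>{k\<in>{1..m}. s \<in> P k \<omega>}. \<Delta> k s \<omega>)"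
    proof (rule sum.cong[OF refl])
      fix s assume s: "s \<in> pts T \<omega>"
      obtain k0 where k0: "{k\<in>{1..m}. s \<in> P k \<omega>} = {k0}" using single[OF s] by blast
      have js: "jump s \<omega> = J k0 s \<omega>" unfolding jump_def k0 by simp
      show "G (x0 + (\<Sum>r\<in>pts T \<omega> \<inter> {..<s}. jump r \<omega>) + jump s \<omega>) - G (x0 + (\<Sum>r\<in>pts T \<omega> \<inter> {..<s}. jump r \<omega>))
          = (\<Sum>k\<in>{k\<in>{1..m}. s \<in> P k \<omega>}. \<Delta> k s \<omega>)"
        unfolding Ys[OF s] js k0 \<Delta>_def by simp
    qed
    also have "\<dots> = (\<Sum>k\<in>{1..m}. \<Sum>s\<in>points k {..T} \<omega>. \<Delta> k s \<omega>)"
      unfolding sum_points_eq[OF \<omega> order_refl] \<open>pts T \<omega> \<inter> {..T} = pts T \<omega>\<close> ..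
    finally show ?case .
  qed
qed

text \<open>A Dynkin formula: compensating the sums over points turns the telescoped increments into
  time integrals.\<close>

lemma
  assumes T: "T > 0"
  shows integrable_G_X: "integrable \<Omega> (\<lambda>\<omega>. G (X T \<omega>))"
    and expectation_G_X: "expectation (\<lambda>\<omega>. G (X T \<omega>)) = G x0 + (\<Sum>k\<in>{1..m}. p k * (LBINT s:{0<..T}. expectation (\<Delta> k s)))"
proof -
  let ?S = "\<lambda>k \<omega>. \<Sum>s\<in>points k {..T} \<omega>. \<Delta> k s \<omega>"
  have 1: "integrable \<Omega> (?S k)" "expectation (?S k) = p k * (LBINT s:{0<..T}. expectation (\<Delta> k s))"
    if k: "k \<in> {1..m}" for k
  proof -
    have g: "integrable \<Omega> (\<lambda>\<omega>. real m * C * (1 + \<eta> k * C)\<^sup>2 * (R T \<omega>)\<^sup>2)"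
      by (intro integrable_mult_right integrable_R_sq)
    have b: "\<bar>(\<lambda>(s, \<omega>). \<Delta> k s \<omega>) (s, \<omega>)\<bar> \<le> real m * C * (1 + \<eta> k * C)\<^sup>2 * (R T \<omega>)\<^sup>2"
      if "0 < s" "s \<le> T" "\<omega> \<in> space \<Omega>" for s \<omega>
      using Delta_bound[OF k that(3,1,2)] by simp
    show "integrable \<Omega> (?S k)" "expectation (?S k) = p k * (LBINT s:{0<..T}. expectation (\<Delta> k s))"
      using expectation_sum_points[OF k Delta_predictable[OF k] b g] by simp_all
  qed
  have XY: "integrable \<Omega> (\<lambda>\<omega>. G (X T \<omega>)) = integrable \<Omega> (\<lambda>\<omega>. G x0 + (\<Sum>k\<in>{1..m}. ?S k \<omega>))"
    "expectation (\<lambda>\<omega>. G (X T \<omega>)) = expectation (\<lambda>\<omega>. G x0 + (\<Sum>k\<in>{1..m}. ?S k \<omega>))"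
  proof -
    have "(\<lambda>\<omega>. G (Y {..T} \<omega>)) \<in> borel_measurable \<Omega>"
      by (rule measurable_compose[OF Y_measurable G_measurable]) simp
    then have m1: "(\<lambda>\<omega>. G (X T \<omega>)) \<in> borel_measurable \<Omega>"
      by (subst measurable_cong[where g="\<lambda>\<omega>. G (Y {..T} \<omega>)"]) (simp_all add: X_eq)
    have m2: "(\<lambda>\<omega>. G x0 + (\<Sum>k\<in>{1..m}. ?S k \<omega>)) \<in> borel_measurable \<Omega>"
      using 1(1) by (intro borel_measurable_add borel_measurable_const borel_measurable_sum borel_measurable_integrable)
    show "integrable \<Omega> (\<lambda>\<omega>. G (X T \<omega>)) = integrable \<Omega> (\<lambda>\<omega>. G x0 + (\<Sum>k\<in>{1..m}. ?S k \<omega>))"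
      by (rule integrable_cong_AE[OF m1 m2 AE_telescope[OF T]])
    show "expectation (\<lambda>\<omega>. G (X T \<omega>)) = expectation (\<lambda>\<omega>. G x0 + (\<Sum>k\<in>{1..m}. ?S k \<omega>))"
      by (rule integral_cong_AE[OF m1 m2 AE_telescope[OF T]])
  qed
  have int: "integrable \<Omega> (\<lambda>\<omega>. \<Sum>k\<in>{1..m}. ?S k \<omega>)"
    by (intro Bochner_Integration.integrable_sum 1(1))
  show "integrable \<Omega> (\<lambda>\<omega>. G (X T \<omega>))"
    unfolding XY by (intro Bochner_Integration.integrable_add integrable_const int)
  have "expectation (\<lambda>\<omega>. G (X T \<omega>)) = G x0 + (\<Sum>k\<in>{1..m}. expectation (?S k))"
    unfolding XY using int 1(1) by (simp add: Bochner_Integration.integral_add Bochner_Integration.integral_sum prob_space)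
  then show "expectation (\<lambda>\<omega>. G (X T \<omega>)) = G x0 + (\<Sum>k\<in>{1..m}. p k * (LBINT s:{0<..T}. expectation (\<Delta> k s)))"
    using 1(2) by simp
qed

end

section \<open>The descent estimate\<close>

locale delayed_descent_rates = delayed_descent \<Omega> m p P E G C \<sigma> \<tau> \<eta> \<xi> X x0 xstar
  for \<Omega> :: "'w measure" and m p and P :: "nat \<Rightarrow> 'w \<Rightarrow> real set"
    and E :: "nat \<Rightarrow> 'a::euclidean_space set" and G C \<sigma> \<tau> \<eta> \<xi> X x0 xstar +
  fixes L :: "nat \<Rightarrow> real" and M :: "nat \<Rightarrow> nat \<Rightarrow> real"
  assumes L_pos: "\<And>k. k \<in> {1..m} \<Longrightarrow> L k > 0"
    and G_smooth: "\<And>k. k \<in> {1..m} \<Longrightarrow> block_smooth E G k (L k)"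
    and M_nonneg: "\<And>k l. k \<in> {1..m} \<Longrightarrow> l \<in> {1..m} \<Longrightarrow> adj E G k l \<Longrightarrow> 0 \<le> M k l"
    and G_lipschitz: "\<And>k x y. k \<in> {1..m} \<Longrightarrow> norm (block_grad E G k x - block_grad E G k y)
        \<le> (\<Sum>l\<in>{l\<in>{1..m}. adj E G k l}. M k l * norm (orth_proj (E l) x - orth_proj (E l) y))"
    and xi_window: "\<And>k t. k \<in> {1..m} \<Longrightarrow> 0 \<le> t \<Longrightarrow> \<xi> k t \<in> borel_measurable (F {t - \<tau> k..<t})"
    and xi_corr: "\<And>k l t. k \<in> {1..m} \<Longrightarrow> l \<in> {1..m} \<Longrightarrow> 0 \<le> t \<Longrightarrow>
          expectation (\<lambda>\<omega>. \<xi> k t \<omega> * real (card (P l \<omega> \<inter> {t - \<tau> k..t})))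
            \<le> expectation (\<xi> k t) * expectation (\<lambda>\<omega>. real (card (P l \<omega> \<inter> {t - \<tau> k..t})))"
begin

definition sq :: "nat \<Rightarrow> real \<Rightarrow> 'w \<Rightarrow> real" where
  "sq k s \<omega> = \<xi> k s \<omega> * (norm (D k s \<omega>))\<^sup>2"

definition w :: "nat \<Rightarrow> real \<Rightarrow> real" where
  "w k s = expectation (sq k s)"

text \<open>Open at both ends: it holds the points before \<open>s\<close> that block
  \<open>k\<close> does not see. Without delay it is empty.\<close>

definition window :: "nat \<Rightarrow> nat \<Rightarrow> real \<Rightarrow> 'w \<Rightarrow> real set" where
  "window k l s \<omega> = points l {s - \<tau> k<..<s} \<omega>"

lemma sq_nonneg: "k \<in> {1..m} \<Longrightarrow> \<omega> \<in> space \<Omega> \<Longrightarrow> 0 \<le> s \<Longrightarrow> 0 \<le> sq k s \<omega>"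
  using xi_01[of k s \<omega>] unfolding sq_def by auto

lemma sq_predictable:
  assumes k: "k \<in> {1..m}"
  shows "(\<lambda>(s, \<omega>). sq k s \<omega>) \<in> borel_measurable Pred"
proof -
  note [measurable] = xi_predictable[OF k] D_predictable[OF k]
  have "(\<lambda>x. (\<lambda>(s, \<omega>). \<xi> k s \<omega>) x * (norm ((\<lambda>(s, \<omega>). D k s \<omega>) x))\<^sup>2) \<in> borel_measurable Pred"
    by measurable
  then show ?thesis by (simp add: sq_def case_prod_beta')
qed

lemma D_sq_le:
  assumes "k \<in> {1..m}" "\<omega> \<in> space \<Omega>" "s \<le> T"
  shows "(norm (D k s \<omega>))\<^sup>2 \<le> C\<^sup>2 * (R T \<omega>)\<^sup>2"
  using power_mono[OF norm_D_le[OF assms] norm_ge_zero, of 2] by (simp add: power_mult_distrib)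

lemma sq_le:
  assumes "k \<in> {1..m}" "\<omega> \<in> space \<Omega>" "0 \<le> s" "s \<le> T"
  shows "\<bar>sq k s \<omega>\<bar> \<le> C\<^sup>2 * (R T \<omega>)\<^sup>2"
  using D_sq_le[OF assms(1,2,4)] xi_01[OF assms(1,3,2)] C_nonneg unfolding sq_def by auto

lemma integrable_bound_R: "integrable \<Omega> (\<lambda>\<omega>. c * (R T \<omega>)\<^sup>2)"
  by (intro integrable_mult_right integrable_R_sq)

lemma integrable_if_le_R:
  fixes f :: "'w \<Rightarrow> real"
  assumes "f \<in> borel_measurable \<Omega>" "\<And>\<omega>. \<omega> \<in> space \<Omega> \<Longrightarrow> \<bar>f \<omega>\<bar> \<le> c * (R T \<omega>)\<^sup>2"
  shows "integrable \<Omega> f"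
proof (rule Bochner_Integration.integrable_bound[OF integrable_bound_R[of c T] assms(1)])
  show "AE \<omega> in \<Omega>. norm (f \<omega>) \<le> norm (c * (R T \<omega>)\<^sup>2)"
    using assms(2) by (intro AE_I2) (smt (verit) real_norm_def)
qed

lemma integrable_sq:
  assumes k: "k \<in> {1..m}" and s: "0 \<le> s"
  shows "integrable \<Omega> (sq k s)"
proof (rule integrable_if_le_R)
  show "sq k s \<in> borel_measurable \<Omega>" using measurable_at_time[OF sq_predictable[OF k] s] by simp
  show "\<bar>sq k s \<omega>\<bar> \<le> C\<^sup>2 * (R s \<omega>)\<^sup>2" if "\<omega> \<in> space \<Omega>" for \<omega>
    by (rule sq_le[OF k that s order_refl])
qed

lemma integrable_D_sq:
  assumes k: "k \<in> {1..m}" and s: "0 \<le> s"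
  shows "integrable \<Omega> (\<lambda>\<omega>. (norm (D k s \<omega>))\<^sup>2)"
proof (rule integrable_if_le_R)
  have "(\<lambda>\<omega>. D k s \<omega>) \<in> borel_measurable \<Omega>" using measurable_at_time[OF D_predictable[OF k] s] by simp
  then show "(\<lambda>\<omega>. (norm (D k s \<omega>))\<^sup>2) \<in> borel_measurable \<Omega>" by measurable
  show "\<bar>(norm (D k s \<omega>))\<^sup>2\<bar> \<le> C\<^sup>2 * (R s \<omega>)\<^sup>2" if "\<omega> \<in> space \<Omega>" for \<omega>
    using D_sq_le[OF k that order_refl] by simp
qed

lemma w_nonneg: "k \<in> {1..m} \<Longrightarrow> 0 \<le> s \<Longrightarrow> 0 \<le> w k s"
  unfolding w_def using sq_nonneg by (intro integral_nonneg_AE AE_I2) auto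

lemma set_integrable_w: "k \<in> {1..m} \<Longrightarrow> set_integrable lborel {0<..T} (w k)"
  using expectation_predictable(1)[OF sq_predictable _ integrable_bound_R[of "C\<^sup>2" T], of k T] sq_le[of k]
  unfolding w_def by (simp add: less_imp_le)

text \<open>At a fixed time the delayed gradient only depends on the points before the window of \<open>\<xi>\<close>.\<close>

lemma expectation_window_mult:
  assumes k: "k \<in> {1..m}" and s: "0 \<le> s"
    and g: "g \<in> borel_measurable (F {s - \<tau> k..s})" "\<And>\<omega>. \<omega> \<in> space \<Omega> \<Longrightarrow> 0 \<le> g \<omega>" "integrable \<Omega> g"
  shows "integrable \<Omega> (\<lambda>\<omega>. (norm (D k s \<omega>))\<^sup>2 * g \<omega>)"
    and "expectation (\<lambda>\<omega>. (norm (D k s \<omega>))\<^sup>2 * g \<omega>) = expectation (\<lambda>\<omega>. (norm (D k s \<omega>))\<^sup>2) * expectation g"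
proof -
  \<comment> \<open>With a positive delay, both the delayed position and \<open>g\<close> may depend
    on a point at time \<open>u\<close>, so their sigma-algebras would overlap there. Dropping that
    single time from the position separates them and almost surely changes nothing.\<close>
  define u where "u = s - \<tau> k"
  define D' where "D' = (\<lambda>\<omega>. (norm (block_grad E G k (Y {..<u} \<omega>)))\<^sup>2)"
  have D': "D' \<in> borel_measurable (F {..<u})"
  proof -
    have [measurable]: "(\<lambda>\<omega>. block_grad E G k (Y {..<u} \<omega>)) \<in> borel_measurable (F {..<u})"
      by (rule measurable_compose[OF Y_adapted[OF initial_lessThan] block_grad_measurable[OF k]])
    show ?thesis unfolding D'_def by measurable
  qed
  have AE: "AE \<omega> in \<Omega>. (norm (D k s \<omega>))\<^sup>2 = D' \<omega>"
  proof (cases "\<tau> k = 0")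
    case True
    then show ?thesis by (simp add: D_def D'_def W_def u_def)
  next
    case False
    \<comment> \<open>The guard \<open>0 < u\<close> suffices since \<open>points\<close> only
      contains positive times.\<close>
    have "AE \<omega> in \<Omega>. \<forall>l\<in>{1..m}. 0 < u \<longrightarrow> u \<notin> P l \<omega>"
      using AE_not_point[of _ u] by (intro AE_finite_allI) (cases "0 < u", auto)
    then show ?thesis
    proof eventually_elim
      case (elim \<omega>)
      have "points l {..u} \<omega> = points l {..<u} \<omega>" if "l \<in> {1..m}" for l
        using elim that by (auto simp: less_le)
      then have "Y {..u} \<omega> = Y {..<u} \<omega>" unfolding Y_def by (intro arg_cong2[where f=plus] refl sum.cong) auto
      then show ?case using False by (simp add: D_def D'_def W_def u_def)
    qed
  qed
  have mD: "(\<lambda>\<omega>. (norm (D k s \<omega>))\<^sup>2) \<in> borel_measurable \<Omega>" using integrable_D_sq[OF k s] by simp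
  have mD': "D' \<in> borel_measurable \<Omega>" by (rule measurable_from_subalg[OF subalgebra_F D'])
  have mg: "g \<in> borel_measurable \<Omega>" using g(3) by simp
  have intD': "integrable \<Omega> D'"
    using integrable_cong_AE[OF mD mD' AE] integrable_D_sq[OF k s] by simp
  have disj: "{..<u} \<inter> {s - \<tau> k..s} = {}" by (auto simp: u_def)
  have D'0: "0 \<le> D' \<omega>" for \<omega> by (simp add: D'_def)
  note ind = expectation_mult_indep[OF disj D' g(1) D'0 g(2) intD' g(3)]
  have AE2: "AE \<omega> in \<Omega>. (norm (D k s \<omega>))\<^sup>2 * g \<omega> = D' \<omega> * g \<omega>" using AE by eventually_elim simp
  have m1: "(\<lambda>\<omega>. (norm (D k s \<omega>))\<^sup>2 * g \<omega>) \<in> borel_measurable \<Omega>" using mD mg by measurable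
  have m2: "(\<lambda>\<omega>. D' \<omega> * g \<omega>) \<in> borel_measurable \<Omega>" using mD' mg by measurable
  show "integrable \<Omega> (\<lambda>\<omega>. (norm (D k s \<omega>))\<^sup>2 * g \<omega>)"
    using integrable_cong_AE[OF m1 m2 AE2] ind(1) by simp
  show "expectation (\<lambda>\<omega>. (norm (D k s \<omega>))\<^sup>2 * g \<omega>) = expectation (\<lambda>\<omega>. (norm (D k s \<omega>))\<^sup>2) * expectation g"
    using integral_cong_AE[OF m1 m2 AE2] integral_cong_AE[OF mD mD' AE] ind(2) by simp
qed

lemma xi_window_closed:
  assumes "k \<in> {1..m}" "0 \<le> s"
  shows "\<xi> k s \<in> borel_measurable (F {s - \<tau> k..s})"
  by (rule measurable_F_mono[OF _ xi_window[OF assms]]) auto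

lemma xi_abs_le: "k \<in> {1..m} \<Longrightarrow> 0 \<le> s \<Longrightarrow> \<omega> \<in> space \<Omega> \<Longrightarrow> \<bar>\<xi> k s \<omega>\<bar> \<le> 1"
  using xi_01[of k s \<omega>] by auto

lemma xi_nonneg: "k \<in> {1..m} \<Longrightarrow> 0 \<le> s \<Longrightarrow> \<omega> \<in> space \<Omega> \<Longrightarrow> 0 \<le> \<xi> k s \<omega>"
  using xi_01[of k s \<omega>] by auto

lemma integrable_xi: "k \<in> {1..m} \<Longrightarrow> 0 \<le> s \<Longrightarrow> integrable \<Omega> (\<xi> k s)"
  by (intro integrable_const_bound[where B=1] AE_I2 measurable_from_subalg[OF subalgebra_F xi_window_closed])
    (auto simp: xi_abs_le)

lemma w_eq:
  assumes k: "k \<in> {1..m}" and s: "0 \<le> s"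
  shows "w k s = expectation (\<xi> k s) * expectation (\<lambda>\<omega>. (norm (D k s \<omega>))\<^sup>2)"
  using expectation_window_mult(2)[OF k s xi_window_closed[OF k s] xi_nonneg[OF k s] integrable_xi[OF k s]]
  unfolding w_def sq_def by (simp add: mult.commute)

text \<open>The squared delayed gradient factors out by independence of the window. What is left is
  the joint mean of \<open>\<xi>\<close> and the point count, which the correlation hypothesis
  splits; putting the factors back together gives \<open>w k s\<close> times the mean count.\<close>

lemma
  assumes k: "k \<in> {1..m}" and l: "l \<in> {1..m}" and s: "0 \<le> s"
  shows integrable_sq_card: "integrable \<Omega> (\<lambda>\<omega>. sq k s \<omega> * real (card (window k l s \<omega>)))"
    and expectation_sq_card_le: "expectation (\<lambda>\<omega>. sq k s \<omega> * real (card (window k l s \<omega>))) \<le> p l * \<tau> k * w k s"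
proof -
  let ?I = "{s - \<tau> k..s}"
  let ?N = "\<lambda>\<omega>. real (card (P l \<omega> \<inter> ?I))"
  \<comment> \<open>Points are nonnegative and the law of the counts is given on nonnegative times,
    so the window is cut at 0; its length stays at most \<open>\<tau> k\<close>.\<close>
  let ?J = "{max 0 (s - \<tau> k)..s}"
  have \<tau>: "0 \<le> \<tau> k" by (rule delay_nonneg[OF k])
  have NJ: "P l \<omega> \<inter> ?I = P l \<omega> \<inter> ?J" if "\<omega> \<in> space \<Omega>" for \<omega>
    using points_nonneg[OF l that] by auto
  have cN: "(\<lambda>\<omega>. card (P l \<omega> \<inter> ?I)) \<in> measurable (F ?I) (count_space UNIV)"
    by (intro card_points_sigma_sets l) auto
  then have mN: "?N \<in> borel_measurable (F ?I)" by measurable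
  have mN': "?N \<in> borel_measurable \<Omega>" by (rule measurable_from_subalg[OF subalgebra_F mN])
  have nnN: "(\<integral>\<^sup>+\<omega>. ennreal (?N \<omega>) \<partial>\<Omega>) = ennreal (p l * measure lborel ?J)"
  proof -
    have "(\<integral>\<^sup>+\<omega>. ennreal (?N \<omega>) \<partial>\<Omega>) = (\<integral>\<^sup>+\<omega>. ennreal (card (P l \<omega> \<inter> ?J)) \<partial>\<Omega>)"
      by (intro nn_integral_cong) (simp only: NJ)
    also have "\<dots> = ennreal (p l * measure lborel ?J)" by (intro nn_integral_card l) auto
    finally show ?thesis .
  qed
  have intN: "integrable \<Omega> ?N"
    using nnN by (intro integrableI_nonneg mN') auto
  have "expectation ?N = p l * measure lborel ?J"
    using nnN intensity_pos[OF l] by (subst integral_eq_nn_integral[OF mN']) auto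
  also have "\<dots> \<le> p l * \<tau> k"
    using intensity_pos[OF l] \<tau> s by (intro mult_left_mono) auto
  finally have EN: "expectation ?N \<le> p l * \<tau> k" .
  have mxN: "(\<lambda>\<omega>. \<xi> k s \<omega> * ?N \<omega>) \<in> borel_measurable (F ?I)"
    using xi_window_closed[OF k s] mN by measurable
  have xN0: "0 \<le> \<xi> k s \<omega> * ?N \<omega>" if "\<omega> \<in> space \<Omega>" for \<omega>
    using xi_nonneg[OF k s that] by simp
  have intxN: "integrable \<Omega> (\<lambda>\<omega>. \<xi> k s \<omega> * ?N \<omega>)"
  proof (rule Bochner_Integration.integrable_bound[OF intN measurable_from_subalg[OF subalgebra_F mxN]])
    show "AE \<omega> in \<Omega>. norm (\<xi> k s \<omega> * ?N \<omega>) \<le> norm (?N \<omega>)"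
      using xi_abs_le[OF k s] by (intro AE_I2) (simp add: abs_mult mult_left_le_one_le)
  qed
  note wm = expectation_window_mult[OF k s mxN xN0 intxN]
  have bound: "0 \<le> sq k s \<omega> * real (card (window k l s \<omega>)) \<and>
      sq k s \<omega> * real (card (window k l s \<omega>)) \<le> (norm (D k s \<omega>))\<^sup>2 * (\<xi> k s \<omega> * ?N \<omega>)" if \<omega>: "\<omega> \<in> space \<Omega>" for \<omega>
  proof -
    have "card (window k l s \<omega>) \<le> card (P l \<omega> \<inter> ?I)"
      using finite_points[OF l \<omega>, of ?I] by (intro card_mono) (auto simp: window_def)
    then have "sq k s \<omega> * real (card (window k l s \<omega>)) \<le> sq k s \<omega> * ?N \<omega>"
      using sq_nonneg[OF k \<omega> s] by (intro mult_left_mono) auto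
    moreover have "0 \<le> sq k s \<omega> * real (card (window k l s \<omega>))" using sq_nonneg[OF k \<omega> s] by simp
    moreover have "sq k s \<omega> * ?N \<omega> = (norm (D k s \<omega>))\<^sup>2 * (\<xi> k s \<omega> * ?N \<omega>)" by (simp add: sq_def)
    ultimately show ?thesis by simp
  qed
  have mw: "(\<lambda>\<omega>. sq k s \<omega> * real (card (window k l s \<omega>))) \<in> borel_measurable \<Omega>"
  proof -
    have "(\<lambda>\<omega>. card (points l {s - \<tau> k<..<s} \<omega>)) \<in> measurable \<Omega> (count_space UNIV)"
      by (intro measurable_card_points l) (auto intro: bounded_subset[of "{s - \<tau> k<..<s}"])
    moreover have "sq k s \<in> borel_measurable \<Omega>" using integrable_sq[OF k s] by simp
    ultimately show ?thesis unfolding window_def by measurable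
  qed
  show int: "integrable \<Omega> (\<lambda>\<omega>. sq k s \<omega> * real (card (window k l s \<omega>)))"
  proof (rule Bochner_Integration.integrable_bound[OF wm(1) mw])
    show "AE \<omega> in \<Omega>. norm (sq k s \<omega> * real (card (window k l s \<omega>))) \<le> norm ((norm (D k s \<omega>))\<^sup>2 * (\<xi> k s \<omega> * ?N \<omega>))"
      using bound by (intro AE_I2) (smt (verit) real_norm_def)
  qed
  have "expectation (\<lambda>\<omega>. sq k s \<omega> * real (card (window k l s \<omega>))) \<le> expectation (\<lambda>\<omega>. (norm (D k s \<omega>))\<^sup>2 * (\<xi> k s \<omega> * ?N \<omega>))"
    using bound by (intro integral_mono int wm(1)) auto
  also have "\<dots> = expectation (\<lambda>\<omega>. (norm (D k s \<omega>))\<^sup>2) * expectation (\<lambda>\<omega>. \<xi> k s \<omega> * ?N \<omega>)" by (rule wm(2))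
  also have "\<dots> \<le> expectation (\<lambda>\<omega>. (norm (D k s \<omega>))\<^sup>2) * (expectation (\<xi> k s) * expectation ?N)"
    by (intro mult_left_mono xi_corr k l s integral_nonneg_AE) auto
  also have "\<dots> = w k s * expectation ?N" unfolding w_eq[OF k s] by simp
  also have "\<dots> \<le> w k s * (p l * \<tau> k)" by (intro mult_left_mono EN w_nonneg k s)
  finally show "expectation (\<lambda>\<omega>. sq k s \<omega> * real (card (window k l s \<omega>))) \<le> p l * \<tau> k * w k s" by (simp add: mult_ac)
qed

text \<open>The cut-off at \<open>s - \<tau> k\<close> is deterministic, so it can be put into the
  predictable integrand and the expected sum becomes a time integral of \<open>w l\<close>.
  Admitting a point at \<open>s\<close> itself only enlarges the sum.\<close>

lemma
  assumes k: "k \<in> {1..m}" and l: "l \<in> {1..m}" and s: "0 \<le> s"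
  shows integrable_sum_window: "integrable \<Omega> (\<lambda>\<omega>. \<Sum>r\<in>window k l s \<omega>. sq l r \<omega>)"
    and expectation_sum_window_le: "expectation (\<lambda>\<omega>. \<Sum>r\<in>window k l s \<omega>. sq l r \<omega>)
      \<le> p l * (LBINT r:{0<..s}. indicator {s - \<tau> k<..} r * w l r)"
proof -
  let ?H = "\<lambda>x. indicator {s - \<tau> k<..} (fst x) * (\<lambda>(r, \<omega>). sq l r \<omega>) x :: real"
  have H: "?H \<in> borel_measurable Pred"
    by (intro borel_measurable_times sq_predictable l measurable_compose[OF fst_predictable] borel_measurable_indicator) auto
  have b: "\<bar>?H (r, \<omega>)\<bar> \<le> C\<^sup>2 * (R s \<omega>)\<^sup>2" if "0 < r" "r \<le> s" "\<omega> \<in> space \<Omega>" for r \<omega>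
    using sq_le[OF l that(3) less_imp_le[OF that(1)] that(2)] by (auto simp: indicator_def)
  note sum = expectation_sum_points[OF l H b integrable_bound_R]
  have bound: "0 \<le> (\<Sum>r\<in>window k l s \<omega>. sq l r \<omega>) \<and>
      (\<Sum>r\<in>window k l s \<omega>. sq l r \<omega>) \<le> (\<Sum>r\<in>points l {..s} \<omega>. ?H (r, \<omega>))" if \<omega>: "\<omega> \<in> space \<Omega>" for \<omega>
  proof
    show "0 \<le> (\<Sum>r\<in>window k l s \<omega>. sq l r \<omega>)"
      using sq_nonneg[OF l \<omega>] by (intro sum_nonneg) (auto simp: window_def)
    have "(\<Sum>r\<in>window k l s \<omega>. sq l r \<omega>) = (\<Sum>r\<in>window k l s \<omega>. ?H (r, \<omega>))"
      by (intro sum.cong) (auto simp: window_def)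
    also have "\<dots> \<le> (\<Sum>r\<in>points l {..s} \<omega>. ?H (r, \<omega>))"
    proof (rule sum_mono2[OF finite_points_initial[OF l \<omega> initial_atMost]])
      show "window k l s \<omega> \<subseteq> points l {..s} \<omega>" by (auto simp: window_def)
      fix r assume "r \<in> points l {..s} \<omega> - window k l s \<omega>"
      then have "0 \<le> r" by simp
      then show "0 \<le> ?H (r, \<omega>)" using sq_nonneg[OF l \<omega>, of r] by simp
    qed
    finally show "(\<Sum>r\<in>window k l s \<omega>. sq l r \<omega>) \<le> (\<Sum>r\<in>points l {..s} \<omega>. ?H (r, \<omega>))" .
  qed
  have mw: "(\<lambda>\<omega>. \<Sum>r\<in>window k l s \<omega>. sq l r \<omega>) \<in> borel_measurable \<Omega>"
  proof -
    have "(\<lambda>\<omega>. \<Sum>r\<in>points l {..<s} \<omega>. ?H (r, \<omega>)) \<in> borel_measurable \<Omega>"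
      by (rule measurable_from_subalg[OF subalgebra_F adapted_sum_real[OF l initial_lessThan H]])
    moreover have "(\<Sum>r\<in>points l {..<s} \<omega>. ?H (r, \<omega>)) = (\<Sum>r\<in>window k l s \<omega>. sq l r \<omega>)"
      if \<omega>: "\<omega> \<in> space \<Omega>" for \<omega>
      by (rule sum.mono_neutral_cong_right[OF finite_points_initial[OF l \<omega> initial_lessThan]])
        (auto simp: window_def indicator_def split: if_splits)
    ultimately show ?thesis by (rule measurable_cong[THEN iffD1, rotated])
  qed
  show int: "integrable \<Omega> (\<lambda>\<omega>. \<Sum>r\<in>window k l s \<omega>. sq l r \<omega>)"
  proof (rule Bochner_Integration.integrable_bound[OF sum(1) mw])
    show "AE \<omega> in \<Omega>. norm (\<Sum>r\<in>window k l s \<omega>. sq l r \<omega>) \<le> norm (\<Sum>r\<in>points l {..s} \<omega>. ?H (r, \<omega>))"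
      using bound by (intro AE_I2) (smt (verit) real_norm_def)
  qed
  have "expectation (\<lambda>\<omega>. \<Sum>r\<in>window k l s \<omega>. sq l r \<omega>) \<le> expectation (\<lambda>\<omega>. \<Sum>r\<in>points l {..s} \<omega>. ?H (r, \<omega>))"
    using bound by (intro integral_mono int sum(1)) auto
  also have "\<dots> = p l * (LBINT r:{0<..s}. indicator {s - \<tau> k<..} r * w l r)"
    using sum(2) by (simp add: w_def)
  finally show "expectation (\<lambda>\<omega>. \<Sum>r\<in>window k l s \<omega>. sq l r \<omega>)
      \<le> p l * (LBINT r:{0<..s}. indicator {s - \<tau> k<..} r * w l r)" .
qed

text \<open>Jumps of the other blocks are orthogonal to \<open>E l\<close>, so only points of
  \<open>P l\<close> in the window move this projection.\<close>

lemma block_drift_le: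
  assumes k: "k \<in> {1..m}" and l: "l \<in> {1..m}" and \<omega>: "\<omega> \<in> space \<Omega>"
  shows "norm (orth_proj (E l) (Y {..<s} \<omega>) - orth_proj (E l) (Y (W k s) \<omega>)) \<le> (\<Sum>r\<in>window k l s \<omega>. \<eta> l * (\<xi> l r \<omega> * norm (D l r \<omega>)))"
proof -
  interpret linear "orth_proj (E l)" by (rule linear_orth_proj[OF subspace_block[OF l]])
  have proj: "orth_proj (E l) (Y S \<omega>) = orth_proj (E l) x0 + (\<Sum>r\<in>points l S \<omega>. J l r \<omega>)" for S
  proof -
    have "orth_proj (E l) (Y S \<omega>) = orth_proj (E l) x0 + (\<Sum>i\<in>{1..m}. \<Sum>r\<in>points i S \<omega>. orth_proj (E l) (J i r \<omega>))"
      unfolding Y_def by (simp only: add sum)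
    also have "(\<Sum>i\<in>{1..m}. \<Sum>r\<in>points i S \<omega>. orth_proj (E l) (J i r \<omega>))
        = (\<Sum>i\<in>{1..m}. if l = i then (\<Sum>r\<in>points i S \<omega>. J i r \<omega>) else 0)"
      using l J_in by (intro sum.cong refl) (simp add: orth_proj_block)
    finally show ?thesis using l by simp
  qed
  have sub: "W k s \<subseteq> {..<s}" by (rule W_subset[OF k])
  have "(\<Sum>r\<in>points l {..<s} \<omega>. J l r \<omega>) - (\<Sum>r\<in>points l (W k s) \<omega>. J l r \<omega>)
      = (\<Sum>r\<in>points l {..<s} \<omega> - points l (W k s) \<omega>. J l r \<omega>)"
    using sub by (intro sum_diff[symmetric] finite_points_initial[OF l \<omega>]) auto
  also have "points l {..<s} \<omega> - points l (W k s) \<omega> = window k l s \<omega>"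
    unfolding window_def W_def by auto
  finally have "orth_proj (E l) (Y {..<s} \<omega>) - orth_proj (E l) (Y (W k s) \<omega>) = (\<Sum>r\<in>window k l s \<omega>. J l r \<omega>)"
    unfolding proj by simp
  also have "norm \<dots> \<le> (\<Sum>r\<in>window k l s \<omega>. \<eta> l * (\<xi> l r \<omega> * norm (D l r \<omega>)))"
  proof (rule sum_norm_le)
    fix r assume "r \<in> window k l s \<omega>"
    then have "0 \<le> r" by (auto simp: window_def)
    then have "0 \<le> \<xi> l r \<omega>" by (rule xi_nonneg[OF l _ \<omega>])
    then show "norm (J l r \<omega>) \<le> \<eta> l * (\<xi> l r \<omega> * norm (D l r \<omega>))"
      unfolding J_eq[OF l \<omega>] using step_pos[OF l] by (simp add: abs_mult mult_ac)
  qed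
  finally show ?thesis .
qed

text \<open>Young's inequality with weight \<open>c l\<close>, using \<open>\<xi>\<^sup>2 = \<xi>\<close>.\<close>

lemma Delta_le:
  assumes k: "k \<in> {1..m}" and \<omega>: "\<omega> \<in> space \<Omega>" and s: "0 \<le> s" and c: "\<And>l. l \<in> {1..m} \<Longrightarrow> c l > 0"
  shows "\<Delta> k s \<omega> \<le> \<eta> k * (- (1 - L k * \<eta> k / 2) * sq k s \<omega> +
    (\<Sum>l\<in>{l\<in>{1..m}. adj E G k l}. M k l * \<eta> l / 2 *
      (c l * (sq k s \<omega> * real (card (window k l s \<omega>))) + (\<Sum>r\<in>window k l s \<omega>. sq l r \<omega>) / c l)))"
proof (cases "\<xi> k s \<omega> = 0")
  \<comment> \<open>Block \<open>k\<close> stays put, but the window sums do not carry the factor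
    \<open>\<xi> k s\<close>; their nonnegativity is what keeps the right side from falling below
    zero.\<close>
  case True
  then have "\<Delta> k s \<omega> = 0" unfolding \<Delta>_def J_eq[OF k \<omega>] by simp
  moreover have "0 \<le> (\<Sum>l\<in>{l\<in>{1..m}. adj E G k l}. M k l * \<eta> l / 2 * ((\<Sum>r\<in>window k l s \<omega>. sq l r \<omega>) / c l))"
  proof (rule sum_nonneg)
    fix l assume l: "l \<in> {l\<in>{1..m}. adj E G k l}"
    then have "0 \<le> (\<Sum>r\<in>window k l s \<omega>. sq l r \<omega>)"
      using sq_nonneg[OF _ \<omega>, of l] by (intro sum_nonneg) (auto simp: window_def)
    then show "0 \<le> M k l * \<eta> l / 2 * ((\<Sum>r\<in>window k l s \<omega>. sq l r \<omega>) / c l)"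
      using l M_nonneg[OF k, of l] step_pos[of l] c[of l] by (intro mult_nonneg_nonneg divide_nonneg_nonneg) auto
  qed
  ultimately show ?thesis using True step_pos[OF k] by (simp add: sq_def)
next
  case False
  then have xi: "\<xi> k s \<omega> = 1" using xi_01[OF k s \<omega>] by auto
  let ?y = "Y {..<s} \<omega>" and ?D = "D k s \<omega>"
  let ?g = "block_grad E G k ?y"
  let ?n = "norm ?D"
  have J: "J k s \<omega> = - \<eta> k *\<^sub>R ?D" unfolding J_eq[OF k \<omega>] xi by simp
  have "G (?y + J k s \<omega>) \<le> G ?y + ?g \<bullet> J k s \<omega> + L k / 2 * (norm (J k s \<omega>))\<^sup>2"
    using G_smooth[OF k] J_in[OF k] unfolding block_smooth_def by blast
  then have "\<Delta> k s \<omega> \<le> - \<eta> k * (?g \<bullet> ?D) + L k / 2 * (\<eta> k)\<^sup>2 * ?n\<^sup>2"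
    unfolding \<Delta>_def J by (simp add: power_mult_distrib)
  \<comment> \<open>The current gradient is split against the delayed one that the step uses:
    \<open>?D\<close> itself provides the descent, and the discrepancy is charged to the drift
    during the delay.\<close>
  also have "?g \<bullet> ?D = ?n\<^sup>2 - (?D - ?g) \<bullet> ?D"
    by (simp add: inner_diff_left power2_norm_eq_inner)
  also have "- \<eta> k * (?n\<^sup>2 - (?D - ?g) \<bullet> ?D) + L k / 2 * (\<eta> k)\<^sup>2 * ?n\<^sup>2
      = \<eta> k * (- (1 - L k * \<eta> k / 2) * ?n\<^sup>2 + (?D - ?g) \<bullet> ?D)"
    by (simp add: algebra_simps power2_eq_square)
  also have "\<dots> \<le> \<eta> k * (- (1 - L k * \<eta> k / 2) * ?n\<^sup>2 + (\<Sum>l\<in>{l\<in>{1..m}. adj E G k l}. M k l * \<eta> l / 2 *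
      (c l * (?n\<^sup>2 * real (card (window k l s \<omega>))) + (\<Sum>r\<in>window k l s \<omega>. sq l r \<omega>) / c l)))"
  proof (intro mult_left_mono add_left_mono)
    have "(?D - ?g) \<bullet> ?D \<le> norm (?D - ?g) * ?n" by (rule norm_cauchy_schwarz)
    also have "norm (?D - ?g) = norm (?g - ?D)" by (rule norm_minus_commute)
    also have "norm (?g - ?D) * ?n \<le> (\<Sum>l\<in>{l\<in>{1..m}. adj E G k l}. M k l * norm (orth_proj (E l) ?y - orth_proj (E l) (Y (W k s) \<omega>))) * ?n"
      unfolding D_def by (intro mult_right_mono G_lipschitz k) auto
    also have "\<dots> = (\<Sum>l\<in>{l\<in>{1..m}. adj E G k l}. M k l * norm (orth_proj (E l) ?y - orth_proj (E l) (Y (W k s) \<omega>)) * ?n)"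
      by (rule sum_distrib_right)
    also have "\<dots> \<le> (\<Sum>l\<in>{l\<in>{1..m}. adj E G k l}. M k l * \<eta> l / 2 *
      (c l * (?n\<^sup>2 * real (card (window k l s \<omega>))) + (\<Sum>r\<in>window k l s \<omega>. sq l r \<omega>) / c l))"
    proof (rule sum_mono)
      fix l assume "l \<in> {l\<in>{1..m}. adj E G k l}"
      then have l: "l \<in> {1..m}" and Mkl: "0 \<le> M k l" using M_nonneg[OF k] by auto
      have cl: "c l > 0" by (rule c[OF l])
      have "norm (orth_proj (E l) ?y - orth_proj (E l) (Y (W k s) \<omega>)) * ?n \<le> (\<Sum>r\<in>window k l s \<omega>. \<eta> l * (\<xi> l r \<omega> * norm (D l r \<omega>))) * ?n"
        by (intro mult_right_mono block_drift_le k l \<omega>) auto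
      also have "\<dots> = (\<Sum>r\<in>window k l s \<omega>. \<eta> l * (\<xi> l r \<omega> * norm (D l r \<omega>)) * ?n)"
        by (rule sum_distrib_right)
      also have "\<dots> \<le> (\<Sum>r\<in>window k l s \<omega>. \<eta> l / 2 * (c l * ?n\<^sup>2 + sq l r \<omega> / c l))"
      proof (rule sum_mono)
        fix r assume "r \<in> window k l s \<omega>"
        then have "0 \<le> r" by (auto simp: window_def)
        then have x: "\<xi> l r \<omega> \<in> {0, 1}" by (rule xi_01[OF l _ \<omega>])
        have "2 * (\<xi> l r \<omega> * norm (D l r \<omega>) * ?n) \<le> c l * ?n\<^sup>2 + sq l r \<omega> / c l"
        proof (cases "\<xi> l r \<omega> = 0")
          case False
          then have "\<xi> l r \<omega> = 1" using x by simp
          moreover have "0 \<le> (c l * ?n - norm (D l r \<omega>))\<^sup>2 / c l" using cl by simp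
          moreover have "(c l * ?n - norm (D l r \<omega>))\<^sup>2 / c l = c l * ?n\<^sup>2 + (norm (D l r \<omega>))\<^sup>2 / c l - 2 * (norm (D l r \<omega>) * ?n)"
            using cl by (simp add: power2_eq_square field_simps)
          ultimately show ?thesis by (simp add: sq_def)
        qed (use cl in \<open>simp add: sq_def\<close>)
        then have "\<eta> l / 2 * (2 * (\<xi> l r \<omega> * norm (D l r \<omega>) * ?n)) \<le> \<eta> l / 2 * (c l * ?n\<^sup>2 + sq l r \<omega> / c l)"
          using step_pos[OF l] by (intro mult_left_mono) auto
        then show "\<eta> l * (\<xi> l r \<omega> * norm (D l r \<omega>)) * ?n \<le> \<eta> l / 2 * (c l * ?n\<^sup>2 + sq l r \<omega> / c l)"
          by (simp add: mult_ac)
      qed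
      also have "\<dots> = \<eta> l / 2 * (c l * (?n\<^sup>2 * real (card (window k l s \<omega>))) + (\<Sum>r\<in>window k l s \<omega>. sq l r \<omega>) / c l)"
        unfolding sum_distrib_left[symmetric] sum.distrib sum_divide_distrib[symmetric] by simp
      finally have "M k l * (norm (orth_proj (E l) ?y - orth_proj (E l) (Y (W k s) \<omega>)) * ?n)
          \<le> M k l * (\<eta> l / 2 * (c l * (?n\<^sup>2 * real (card (window k l s \<omega>))) + (\<Sum>r\<in>window k l s \<omega>. sq l r \<omega>) / c l))"
        using Mkl by (rule mult_left_mono)
      then show "M k l * norm (orth_proj (E l) ?y - orth_proj (E l) (Y (W k s) \<omega>)) * ?n
          \<le> M k l * \<eta> l / 2 * (c l * (?n\<^sup>2 * real (card (window k l s \<omega>))) + (\<Sum>r\<in>window k l s \<omega>. sq l r \<omega>) / c l)"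
        by (simp add: mult.assoc)
    qed
    finally show "(?D - ?g) \<bullet> ?D \<le> (\<Sum>l\<in>{l\<in>{1..m}. adj E G k l}. M k l * \<eta> l / 2 *
      (c l * (?n\<^sup>2 * real (card (window k l s \<omega>))) + (\<Sum>r\<in>window k l s \<omega>. sq l r \<omega>) / c l))" .
  qed (use step_pos[OF k] in simp)
  finally show ?thesis by (simp add: sq_def xi)
qed

lemma expectation_Delta_le:
  assumes k: "k \<in> {1..m}" and s: "0 < s" and c: "\<And>l. l \<in> {1..m} \<Longrightarrow> c l > 0"
  shows "expectation (\<Delta> k s) \<le> \<eta> k * (- (1 - L k * \<eta> k / 2) * w k s +
    (\<Sum>l\<in>{l\<in>{1..m}. adj E G k l}. M k l * \<eta> l / 2 *
      (c l * (p l * \<tau> k * w k s) + p l * (LBINT r:{0<..s}. indicator {s - \<tau> k<..} r * w l r) / c l)))"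
proof -
  let ?A = "{l\<in>{1..m}. adj E G k l}"
  have s0: "0 \<le> s" using s by simp
  let ?T = "\<lambda>l \<omega>. M k l * \<eta> l / 2 *
      (c l * (sq k s \<omega> * real (card (window k l s \<omega>))) + (\<Sum>r\<in>window k l s \<omega>. sq l r \<omega>) / c l)"
  have intT: "integrable \<Omega> (?T l)" if "l \<in> ?A" for l
    using that integrable_sq_card[OF k _ s0, of l] integrable_sum_window[OF k _ s0, of l]
    by (intro integrable_mult_right Bochner_Integration.integrable_add integrable_divide) auto
  have intS: "integrable \<Omega> (\<lambda>\<omega>. \<Sum>l\<in>?A. ?T l \<omega>)"
    by (intro Bochner_Integration.integrable_sum intT)
  have int: "integrable \<Omega> (\<lambda>\<omega>. \<eta> k * (- (1 - L k * \<eta> k / 2) * sq k s \<omega> + (\<Sum>l\<in>?A. ?T l \<omega>)))"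
    by (intro integrable_mult_right Bochner_Integration.integrable_add integrable_sq k s0 intS)
  have mD: "\<Delta> k s \<in> borel_measurable \<Omega>" using measurable_at_time[OF Delta_predictable[OF k] s0] by simp
  have intD: "integrable \<Omega> (\<Delta> k s)"
    by (rule integrable_if_le_R[OF mD Delta_bound[OF k _ s order_refl]])
  have "expectation (\<Delta> k s) \<le> expectation (\<lambda>\<omega>. \<eta> k * (- (1 - L k * \<eta> k / 2) * sq k s \<omega> + (\<Sum>l\<in>?A. ?T l \<omega>)))"
    by (intro integral_mono intD int Delta_le k s0 c)
  also have "\<dots> = \<eta> k * (- (1 - L k * \<eta> k / 2) * w k s + (\<Sum>l\<in>?A. expectation (?T l)))"
    using integrable_sq[OF k s0] intS intT
    by (simp add: Bochner_Integration.integral_add Bochner_Integration.integral_sum w_def)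
  also have "\<dots> \<le> \<eta> k * (- (1 - L k * \<eta> k / 2) * w k s +
    (\<Sum>l\<in>?A. M k l * \<eta> l / 2 *
      (c l * (p l * \<tau> k * w k s) + p l * (LBINT r:{0<..s}. indicator {s - \<tau> k<..} r * w l r) / c l)))"
  proof (intro mult_left_mono add_left_mono sum_mono)
    fix l assume l: "l \<in> ?A"
    then have l1: "l \<in> {1..m}" by simp
    have "expectation (?T l) = M k l * \<eta> l / 2 * (c l * expectation (\<lambda>\<omega>. sq k s \<omega> * real (card (window k l s \<omega>)))
        + expectation (\<lambda>\<omega>. \<Sum>r\<in>window k l s \<omega>. sq l r \<omega>) / c l)"
      using integrable_sq_card[OF k l1 s0] integrable_sum_window[OF k l1 s0]
      by (simp add: Bochner_Integration.integral_add)
    also have "\<dots> \<le> M k l * \<eta> l / 2 *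
      (c l * (p l * \<tau> k * w k s) + p l * (LBINT r:{0<..s}. indicator {s - \<tau> k<..} r * w l r) / c l)"
      using expectation_sq_card_le[OF k l1 s0] expectation_sum_window_le[OF k l1 s0] c[OF l1]
        M_nonneg[OF k l1] step_pos[OF l1] l
      by (intro mult_left_mono add_mono divide_right_mono) (auto intro!: mult_nonneg_nonneg)
    finally show "expectation (?T l) \<le> M k l * \<eta> l / 2 *
      (c l * (p l * \<tau> k * w k s) + p l * (LBINT r:{0<..s}. indicator {s - \<tau> k<..} r * w l r) / c l)" .
  qed (use step_pos[OF k] in simp)
  finally show ?thesis .
qed

end

section \<open>Weighted time integrals\<close>

text \<open>Both sides integrate over the pairs with \<open>r \<le> s\<close> and
  \<open>s < r + c\<close>. The bounded weight \<open>g\<close> stays general because it is used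
  both with an exponential and with its derivative.\<close>

lemma window_fubini:
  fixes g h :: "real \<Rightarrow> real"
  assumes h: "set_integrable lborel {0<..T} h" and g: "g \<in> borel_measurable borel"
    and B: "\<And>s. 0 < s \<Longrightarrow> s \<le> T \<Longrightarrow> \<bar>g s\<bar> \<le> B"
  shows "set_integrable lborel {0<..T} (\<lambda>s. g s * (LBINT r:{0<..s}. indicator {s - c<..} r * h r))"
    and "(LBINT s:{0<..T}. g s * (LBINT r:{0<..s}. indicator {s - c<..} r * h r))
      = (LBINT r:{0<..T}. h r * (LBINT s:{r..T}. indicator {..<r + c} s * g s))"
proof -
  \<comment> \<open>\<open>h\<close> is only known to be integrable on \<open>{0<..T}\<close>; the
    cut-off makes the integrand measurable on the whole plane.\<close>
  define h' where "h' = (\<lambda>r. indicator {0<..T} r *\<^sub>R h r)"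
  have h': "integrable lborel h'" using h unfolding set_integrable_def h'_def .
  have mh': "h' \<in> borel_measurable borel" using borel_measurable_integrable[OF h'] by simp
  define f where "f = (\<lambda>s r. if 0 < r \<and> r \<le> s \<and> s \<le> T \<and> s - c < r then g s * h' r else 0)"
  have mf: "case_prod f \<in> borel_measurable (lborel \<Otimes>\<^sub>M lborel)"
    unfolding f_def using g mh' by measurable
  have int: "integrable (lborel \<Otimes>\<^sub>M lborel) (case_prod f)"
  proof (rule Bochner_Integration.integrable_bound[OF _ mf])
    show "integrable (lborel \<Otimes>\<^sub>M lborel) (\<lambda>(s::real, r). indicator {0<..T} s * \<bar>B\<bar> * h' r)"
    proof (rule lborel_pair.Fubini_integrable)
      show "(\<lambda>(s::real, r). indicator {0<..T} s * \<bar>B\<bar> * h' r) \<in> borel_measurable (lborel \<Otimes>\<^sub>M lborel)"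
        using mh' by measurable
      have "(LBINT r. norm (case (s, r) of (s, r) \<Rightarrow> indicator {0<..T} s * \<bar>B\<bar> * h' r))
          = indicator {0<..T} s * (\<bar>B\<bar> * (LBINT r. \<bar>h' r\<bar>))" for s
        by (simp add: abs_mult)
      moreover have fin: "emeasure lborel {0<..T} < \<infinity>" by (rule emeasure_bounded_finite) simp
      have "integrable lborel (\<lambda>s::real. indicator {0<..T} s * (\<bar>B\<bar> * (LBINT r. \<bar>h' r\<bar>)))"
        by (intro integrable_mult_left integrable_real_indicator) (use fin in auto)
      ultimately show "integrable lborel (\<lambda>s. LBINT r. norm (case (s, r) of (s, r) \<Rightarrow> indicator {0<..T} s * \<bar>B\<bar> * h' r))"
        by simp
      show "AE s in lborel. integrable lborel (\<lambda>r. case (s, r) of (s, r) \<Rightarrow> indicator {0<..T} s * \<bar>B\<bar> * h' r)"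
        using h' by (intro AE_I2) simp
    qed
    show "AE x in lborel \<Otimes>\<^sub>M lborel. norm (case_prod f x) \<le> norm (case x of (s, r) \<Rightarrow> indicator {0<..T} s * \<bar>B\<bar> * h' r)"
    proof (rule AE_I2)
      fix x :: "real \<times> real"
      obtain s r where x: "x = (s, r)" by (cases x)
      have "\<bar>g s\<bar> * \<bar>h' r\<bar> \<le> \<bar>B\<bar> * \<bar>h' r\<bar>" if "0 < s" "s \<le> T"
        using B[OF that] by (intro mult_right_mono) auto
      then show "norm (case_prod f x) \<le> norm (case x of (s, r) \<Rightarrow> indicator {0<..T} s * \<bar>B\<bar> * h' r)"
        unfolding x f_def by (auto simp: abs_mult indicator_def)
    qed
  qed
  have inner: "(LBINT r. f s r) = indicator {0<..T} s *\<^sub>R (g s * (LBINT r:{0<..s}. indicator {s - c<..} r * h r))" for s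
  proof (cases "0 < s \<and> s \<le> T")
    case True
    then have "f s = (\<lambda>r. g s * (indicator {0<..s} r *\<^sub>R (indicator {s - c<..} r * h r)))"
      by (auto simp: fun_eq_iff f_def h'_def indicator_def)
    then show ?thesis using True by (simp add: set_lebesgue_integral_def)
  next
    case False
    then have "f s = (\<lambda>r. 0)" by (auto simp: fun_eq_iff f_def)
    then show ?thesis using False by (auto simp: indicator_def)
  qed
  have outer: "(LBINT s. f s r) = indicator {0<..T} r *\<^sub>R (h r * (LBINT s:{r..T}. indicator {..<r + c} s * g s))" for r
  proof (cases "0 < r \<and> r \<le> T")
    case True
    then have "(\<lambda>s. f s r) = (\<lambda>s. h r * (indicator {r..T} s *\<^sub>R (indicator {..<r + c} s * g s)))"
      by (auto simp: fun_eq_iff f_def h'_def indicator_def)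
    then show ?thesis using True by (simp add: set_lebesgue_integral_def)
  next
    case False
    then have "(\<lambda>s. f s r) = (\<lambda>s. 0)" by (auto simp: fun_eq_iff f_def h'_def)
    then show ?thesis using False by (auto simp: indicator_def)
  qed
  show "set_integrable lborel {0<..T} (\<lambda>s. g s * (LBINT r:{0<..s}. indicator {s - c<..} r * h r))"
    unfolding set_integrable_def inner[symmetric] using lborel_pair.integrable_fst[OF int] by simp
  show "(LBINT s:{0<..T}. g s * (LBINT r:{0<..s}. indicator {s - c<..} r * h r))
      = (LBINT r:{0<..T}. h r * (LBINT s:{r..T}. indicator {..<r + c} s * g s))"
    using lborel_pair.Fubini_integral[OF int]
    unfolding set_lebesgue_integral_def[of lborel "{0<..T}"] inner[symmetric] outer[symmetric] by simp
qed

lemma exp_weight_le: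
  fixes r T c \<gamma> :: real
  assumes "0 \<le> c" "0 \<le> \<gamma>"
  shows "(LBINT s:{r..T}. indicator {..<r + c} s * exp (\<gamma> * s)) \<le> c * exp (\<gamma> * (r + c))"
proof -
  have I: "integrable lborel (\<lambda>s::real. indicator {r..r + c} s * exp (\<gamma> * (r + c)))"
  proof -
    have "emeasure lborel {r..r + c} < \<infinity>" by (rule emeasure_bounded_finite) simp
    then show ?thesis by (intro integrable_mult_left integrable_real_indicator) auto
  qed
  have le: "0 \<le> indicator {r..T} s *\<^sub>R (indicator {..<r + c} s * exp (\<gamma> * s)) \<and>
      indicator {r..T} s *\<^sub>R (indicator {..<r + c} s * exp (\<gamma> * s)) \<le> indicator {r..r + c} s * exp (\<gamma> * (r + c))" for s
    using assms by (auto simp: indicator_def mult_left_mono)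
  have "(LBINT s:{r..T}. indicator {..<r + c} s * exp (\<gamma> * s)) \<le> (LBINT s. indicator {r..r + c} s * exp (\<gamma> * (r + c)))"
    unfolding set_lebesgue_integral_def
  proof (rule integral_mono[OF _ I])
    show "integrable lborel (\<lambda>s. indicator {r..T} s *\<^sub>R (indicator {..<r + c} s * exp (\<gamma> * s)))"
    proof (rule Bochner_Integration.integrable_bound[OF I])
      show "AE s in lborel. norm (indicator {r..T} s *\<^sub>R (indicator {..<r + c} s * exp (\<gamma> * s))) \<le> norm (indicator {r..r + c} s * exp (\<gamma> * (r + c)))"
        using le by (intro AE_I2) (smt (verit) real_norm_def)
    qed measurable
  qed (use le in blast)
  also have "\<dots> = c * exp (\<gamma> * (r + c))" using assms by simp
  finally show ?thesis .
qed

text \<open>With window length \<open>T\<close> the cut-off at \<open>r + T\<close> is void on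
  \<open>{r..T}\<close>, which lets \<open>window_fubini\<close> double as the unrestricted exchange
  of integrals.\<close>

lemma exp_weight_full:
  fixes r T \<gamma> :: real
  assumes "0 < r" "r \<le> T"
  shows "(LBINT s:{r..T}. indicator {..<r + T} s * (\<gamma> * exp (\<gamma> * s))) = exp (\<gamma> * T) - exp (\<gamma> * r)"
proof -
  have "(LBINT s:{r..T}. indicator {..<r + T} s * (\<gamma> * exp (\<gamma> * s))) = (LBINT s. \<gamma> * exp (\<gamma> * s) * indicator {r..T} s)"
    unfolding set_lebesgue_integral_def using assms
    by (intro Bochner_Integration.integral_cong) (auto simp: indicator_def)
  also have "\<dots> = exp (\<gamma> * T) - exp (\<gamma> * r)"
    using assms by (intro integral_FTC_Icc_real) (auto intro!: derivative_eq_intros continuous_intros)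
  finally show ?thesis .
qed

lemma set_integrable_const_Ioc: "set_integrable lborel {0<..T::real} (\<lambda>_. c :: real)"
proof -
  have "emeasure lborel {0<..T} < \<infinity>" by (rule emeasure_bounded_finite) simp
  then show ?thesis unfolding set_integrable_def
    by (intro integrable_scaleR_left integrable_real_indicator) auto
qed

lemma set_integrable_mult_bounded:
  fixes f h :: "real \<Rightarrow> real"
  assumes h: "set_integrable lborel {0<..T} h" and f: "f \<in> borel_measurable borel"
    and B: "\<And>s. 0 < s \<Longrightarrow> s \<le> T \<Longrightarrow> \<bar>f s\<bar> \<le> B"
  shows "set_integrable lborel {0<..T} (\<lambda>s. f s * h s)"
proof -
  have mh: "(\<lambda>s. indicator {0<..T} s *\<^sub>R h s) \<in> borel_measurable lborel"
    using h unfolding set_integrable_def by (rule borel_measurable_integrable)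
  have "(\<lambda>s. f s * (indicator {0<..T} s *\<^sub>R h s)) \<in> borel_measurable lborel"
    using f mh by measurable
  then have m: "(\<lambda>s. indicator {0<..T} s *\<^sub>R (f s * h s)) \<in> borel_measurable lborel"
    by (simp add: mult_ac)
  show ?thesis
    unfolding set_integrable_def
  proof (rule Bochner_Integration.integrable_bound[OF _ m])
    show "integrable lborel (\<lambda>s. B * (indicator {0<..T} s *\<^sub>R h s))"
      using h unfolding set_integrable_def by (rule integrable_mult_right)
    show "AE s in lborel. norm (indicator {0<..T} s *\<^sub>R (f s * h s)) \<le> norm (B * (indicator {0<..T} s *\<^sub>R h s))"
    proof (rule AE_I2)
      fix s
      have "\<bar>f s\<bar> * \<bar>h s\<bar> \<le> \<bar>B\<bar> * \<bar>h s\<bar>" if "0 < s" "s \<le> T"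
        using B[OF that] by (intro mult_right_mono) auto
      then show "norm (indicator {0<..T} s *\<^sub>R (f s * h s)) \<le> norm (B * (indicator {0<..T} s *\<^sub>R h s))"
        by (auto simp: indicator_def abs_mult)
    qed
  qed
qed

lemma set_integrable_exp_mult:
  assumes "set_integrable lborel {0<..T} h" "0 \<le> \<gamma>"
  shows "set_integrable lborel {0<..T} (\<lambda>s. exp (\<gamma> * s) * h s :: real)"
  by (rule set_integrable_mult_bounded[OF assms(1), where B="exp (\<gamma> * T)"])
    (use assms(2) in \<open>auto intro: mult_left_mono\<close>)

text \<open>The product rule for \<open>exp (\<gamma> * t) * \<phi> t\<close> in integrated form.
  The density \<open>b\<close> is merely integrable, so \<open>\<phi>\<close> need not be
  differentiable everywhere, and the rule is obtained by exchanging the order of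
  integration.\<close>

lemma exp_drift:
  fixes b \<phi> :: "real \<Rightarrow> real"
  assumes b: "\<And>T. set_integrable lborel {0<..T} b"
    and \<phi>: "\<And>t. 0 < t \<Longrightarrow> \<phi> t = \<phi>0 + (LBINT s:{0<..t}. b s)"
    and \<gamma>: "0 \<le> \<gamma>" and T: "0 < T"
  shows "set_integrable lborel {0<..T} (\<lambda>t. exp (\<gamma> * t) * \<phi> t)"
    and "exp (\<gamma> * T) * \<phi> T = \<phi>0 + \<gamma> * (LBINT t:{0<..T}. exp (\<gamma> * t) * \<phi> t) + (LBINT s:{0<..T}. exp (\<gamma> * s) * b s)"
proof -
  have eqb: "(LBINT r:{0<..s}. indicator {s - T<..} r * b r) = (LBINT r:{0<..s}. b r)" if "s \<le> T" for s
    unfolding set_lebesgue_integral_def using that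
    by (intro Bochner_Integration.integral_cong) (auto simp: indicator_def)
  have be: "\<bar>exp (\<gamma> * s)\<bar> \<le> exp (\<gamma> * T)" if "0 < s" "s \<le> T" for s
    using that \<gamma> by (auto intro: mult_left_mono)
  have bg: "\<bar>\<gamma> * exp (\<gamma> * s)\<bar> \<le> \<gamma> * exp (\<gamma> * T)" if "0 < s" "s \<le> T" for s
    using that \<gamma> by (auto simp: abs_mult intro!: mult_left_mono)
  have "set_integrable lborel {0<..T} (\<lambda>s. exp (\<gamma> * s) * (LBINT r:{0<..s}. indicator {s - T<..} r * b r))"
    by (rule window_fubini(1)[OF b _ be]) auto
  then have i1: "set_integrable lborel {0<..T} (\<lambda>s. exp (\<gamma> * s) * (LBINT r:{0<..s}. b r))"
    by (rule set_integrable_cong[THEN iffD1, rotated -1]) (auto simp: eqb)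
  have i0: "set_integrable lborel {0<..T} (\<lambda>s. exp (\<gamma> * s) * \<phi>0)"
    by (rule set_integrable_exp_mult[OF set_integrable_const_Ioc \<gamma>])
  have "set_integrable lborel {0<..T} (\<lambda>s. exp (\<gamma> * s) * \<phi>0 + exp (\<gamma> * s) * (LBINT r:{0<..s}. b r))"
    by (rule set_integral_add(1)[OF i0 i1])
  then show int: "set_integrable lborel {0<..T} (\<lambda>t. exp (\<gamma> * t) * \<phi> t)"
    by (rule set_integrable_cong[THEN iffD1, rotated -1]) (auto simp: \<phi> distrib_left)
  have "(LBINT s:{0<..T}. (\<gamma> * exp (\<gamma> * s)) * (LBINT r:{0<..s}. indicator {s - T<..} r * b r))
      = (LBINT r:{0<..T}. b r * (LBINT s:{r..T}. indicator {..<r + T} s * (\<gamma> * exp (\<gamma> * s))))"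
    by (rule window_fubini(2)[OF b _ bg]) auto
  also have "(LBINT s:{0<..T}. (\<gamma> * exp (\<gamma> * s)) * (LBINT r:{0<..s}. indicator {s - T<..} r * b r))
      = (LBINT s:{0<..T}. \<gamma> * (exp (\<gamma> * s) * (LBINT r:{0<..s}. b r)))"
    by (intro set_lebesgue_integral_cong) (auto simp: eqb)
  also have "\<dots> = \<gamma> * (LBINT s:{0<..T}. exp (\<gamma> * s) * (LBINT r:{0<..s}. b r))" by simp
  also have "(LBINT r:{0<..T}. b r * (LBINT s:{r..T}. indicator {..<r + T} s * (\<gamma> * exp (\<gamma> * s))))
      = (LBINT r:{0<..T}. exp (\<gamma> * T) * b r - exp (\<gamma> * r) * b r)"
  proof (intro set_lebesgue_integral_cong allI impI)
    fix r assume r: "r \<in> {0<..T}"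
    then have "(LBINT s:{r..T}. indicator {..<r + T} s * (\<gamma> * exp (\<gamma> * s))) = exp (\<gamma> * T) - exp (\<gamma> * r)"
      by (intro exp_weight_full) auto
    then show "b r * (LBINT s:{r..T}. indicator {..<r + T} s * (\<gamma> * exp (\<gamma> * s))) = exp (\<gamma> * T) * b r - exp (\<gamma> * r) * b r"
      by (simp only:) (simp add: algebra_simps)
  qed simp
  also have "\<dots> = exp (\<gamma> * T) * (LBINT r:{0<..T}. b r) - (LBINT r:{0<..T}. exp (\<gamma> * r) * b r)"
    using b by (subst set_integral_diff(2)) (auto intro!: set_integrable_exp_mult \<gamma>)
  finally have 1: "\<gamma> * (LBINT s:{0<..T}. exp (\<gamma> * s) * (LBINT r:{0<..s}. b r))
      = exp (\<gamma> * T) * (LBINT r:{0<..T}. b r) - (LBINT r:{0<..T}. exp (\<gamma> * r) * b r)" .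
  have "(LBINT s:{0<..T}. exp (\<gamma> * s) * (\<gamma> * \<phi>0)) = \<phi>0 * (LBINT s. \<gamma> * exp (\<gamma> * s) * indicator {0..T} s)"
  proof -
    have "(LBINT s:{0<..T}. exp (\<gamma> * s) * (\<gamma> * \<phi>0)) = (LBINT s:{0..T}. exp (\<gamma> * s) * (\<gamma> * \<phi>0))"
      by (rule set_integral_discrete_difference[where X="{0}"]) auto
    also have "\<dots> = (LBINT s. \<phi>0 * (\<gamma> * exp (\<gamma> * s) * indicator {0..T} s))"
      unfolding set_lebesgue_integral_def by (intro Bochner_Integration.integral_cong) auto
    finally show ?thesis by simp
  qed
  also have "(LBINT s. \<gamma> * exp (\<gamma> * s) * indicator {0..T} s) = exp (\<gamma> * T) - exp (\<gamma> * 0)"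
    using T by (intro integral_FTC_Icc_real) (auto intro!: derivative_eq_intros continuous_intros)
  finally have 2: "\<gamma> * (LBINT s:{0<..T}. exp (\<gamma> * s) * \<phi>0) = \<phi>0 * (exp (\<gamma> * T) - 1)"
    by (simp add: mult_ac)
  have "(LBINT t:{0<..T}. exp (\<gamma> * t) * \<phi> t) = (LBINT s:{0<..T}. exp (\<gamma> * s) * \<phi>0 + exp (\<gamma> * s) * (LBINT r:{0<..s}. b r))"
    by (intro set_lebesgue_integral_cong) (auto simp: \<phi> distrib_left)
  also have "\<dots> = (LBINT s:{0<..T}. exp (\<gamma> * s) * \<phi>0) + (LBINT s:{0<..T}. exp (\<gamma> * s) * (LBINT r:{0<..s}. b r))"
    by (rule set_integral_add(2)[OF i0 i1])
  finally have "\<gamma> * (LBINT t:{0<..T}. exp (\<gamma> * t) * \<phi> t) = \<gamma> * (LBINT s:{0<..T}. exp (\<gamma> * s) * \<phi>0) + \<gamma> * (LBINT s:{0<..T}. exp (\<gamma> * s) * (LBINT r:{0<..s}. b r))"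
    by (simp only: distrib_left)
  also have "\<dots> = \<phi>0 * (exp (\<gamma> * T) - 1) + exp (\<gamma> * T) * (LBINT r:{0<..T}. b r) - (LBINT r:{0<..T}. exp (\<gamma> * r) * b r)"
    unfolding 1 2 by simp
  finally show "exp (\<gamma> * T) * \<phi> T = \<phi>0 + \<gamma> * (LBINT t:{0<..T}. exp (\<gamma> * t) * \<phi> t) + (LBINT s:{0<..T}. exp (\<gamma> * s) * b s)"
    using \<phi>[OF T] by (simp add: algebra_simps)
qed

text \<open>After the exchange, the value at \<open>r\<close> is charged at times up to
  \<open>r + c\<close>: for a duration of at most \<open>c\<close>, and with a weight at most
  \<open>exp (\<gamma> * c)\<close> times the weight at \<open>r\<close>.\<close>

lemma window_exp_le:
  fixes h :: "real \<Rightarrow> real"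
  assumes h: "set_integrable lborel {0<..T} h" and nn: "\<And>r. 0 < r \<Longrightarrow> r \<le> T \<Longrightarrow> 0 \<le> h r" and c: "0 \<le> c" and \<gamma>: "0 \<le> \<gamma>"
  shows "set_integrable lborel {0<..T} (\<lambda>s. exp (\<gamma> * s) * (LBINT r:{0<..s}. indicator {s - c<..} r * h r))"
    and "(LBINT s:{0<..T}. exp (\<gamma> * s) * (LBINT r:{0<..s}. indicator {s - c<..} r * h r))
      \<le> c * exp (\<gamma> * c) * (LBINT r:{0<..T}. exp (\<gamma> * r) * h r)"
proof -
  have be: "\<bar>exp (\<gamma> * s)\<bar> \<le> exp (\<gamma> * T)" if "0 < s" "s \<le> T" for s
    using that \<gamma> by (auto intro: mult_left_mono)
  show "set_integrable lborel {0<..T} (\<lambda>s. exp (\<gamma> * s) * (LBINT r:{0<..s}. indicator {s - c<..} r * h r))"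
    by (rule window_fubini(1)[OF h _ be]) auto
  have "(LBINT s:{0<..T}. exp (\<gamma> * s) * (LBINT r:{0<..s}. indicator {s - c<..} r * h r))
      = (LBINT r:{0<..T}. h r * (LBINT s:{r..T}. indicator {..<r + c} s * exp (\<gamma> * s)))"
    by (rule window_fubini(2)[OF h _ be]) auto
  also have "\<dots> \<le> (LBINT r:{0<..T}. c * exp (\<gamma> * c) * (exp (\<gamma> * r) * h r))"
    unfolding set_lebesgue_integral_def
  proof (rule integral_mono')
    show "integrable lborel (\<lambda>r. indicator {0<..T} r *\<^sub>R (c * exp (\<gamma> * c) * (exp (\<gamma> * r) * h r)))"
      using set_integrable_exp_mult[OF h \<gamma>] by (fold set_integrable_def) (rule set_integrable_mult_right)
    fix r
    show "indicator {0<..T} r *\<^sub>R (h r * (LBINT s. indicator {r..T} s *\<^sub>R (indicator {..<r + c} s * exp (\<gamma> * s))))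
        \<le> indicator {0<..T} r *\<^sub>R (c * exp (\<gamma> * c) * (exp (\<gamma> * r) * h r))"
    proof (cases "0 < r \<and> r \<le> T")
      case True
      have "h r * (LBINT s. indicator {r..T} s *\<^sub>R (indicator {..<r + c} s * exp (\<gamma> * s))) \<le> h r * (c * exp (\<gamma> * (r + c)))"
        using exp_weight_le[OF c \<gamma>, of r T] nn[of r] True unfolding set_lebesgue_integral_def by (intro mult_left_mono) auto
      then show ?thesis using True by (simp add: distrib_left exp_add mult_ac)
    qed (auto simp: indicator_def)
    show "0 \<le> indicator {0<..T} r *\<^sub>R (c * exp (\<gamma> * c) * (exp (\<gamma> * r) * h r))"
      using nn[of r] c by (auto simp: indicator_def intro!: mult_nonneg_nonneg)
  qed
  finally show "(LBINT s:{0<..T}. exp (\<gamma> * s) * (LBINT r:{0<..s}. indicator {s - c<..} r * h r))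
      \<le> c * exp (\<gamma> * c) * (LBINT r:{0<..T}. exp (\<gamma> * r) * h r)"
    by simp
qed

text \<open>Jensen's inequality, in the form of the tangent to the exponential at the midpoint
  \<open>T / 2\<close>, whose linear part integrates to zero.\<close>

lemma exp_integral_ge:
  fixes \<gamma> T :: real
  assumes "0 \<le> \<gamma>" "0 < T"
  shows "T * exp (\<gamma> * T / 2) \<le> (LBINT t:{0..T}. exp (\<gamma> * t))"
proof -
  let ?f = "\<lambda>t. exp (\<gamma> * T / 2) * (1 + \<gamma> * (t - T / 2))"
  let ?F = "\<lambda>t. exp (\<gamma> * T / 2) * (t + \<gamma> * (t\<^sup>2 / 2 - t * T / 2))"
  have "set_integrable lborel {0..T} (\<lambda>t. exp (\<gamma> * t))" "set_integrable lborel {0..T} ?f"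
    by (intro borel_integrable_atLeastAtMost' continuous_intros)+
  moreover have "?f t \<le> exp (\<gamma> * t)" for t
  proof -
    have "?f t \<le> exp (\<gamma> * T / 2) * exp (\<gamma> * (t - T / 2))"
      by (intro mult_left_mono exp_ge_add_one_self) auto
    also have "\<dots> = exp (\<gamma> * t)" by (simp add: exp_add[symmetric] algebra_simps)
    finally show ?thesis .
  qed
  ultimately have "(LBINT t:{0..T}. ?f t) \<le> (LBINT t:{0..T}. exp (\<gamma> * t))"
    by (intro set_integral_mono)
  moreover have "(LBINT t:{0..T}. ?f t) = (LBINT t. ?f t * indicator {0..T} t)"
    unfolding set_lebesgue_integral_def by (simp add: mult.commute)
  moreover have "\<dots> = ?F T - ?F 0"
    using assms by (intro integral_FTC_Icc_real) (auto intro!: derivative_eq_intros continuous_intros simp: field_simps)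
  ultimately show ?thesis by (simp add: power2_eq_square algebra_simps)
qed

lemma set_integral_finite_sum:
  fixes f :: "'i \<Rightarrow> 'a \<Rightarrow> real"
  assumes "\<And>i. i \<in> A \<Longrightarrow> set_integrable N S (f i)"
  shows "set_integrable N S (\<lambda>x. \<Sum>i\<in>A. f i x)"
    and "(LINT x:S|N. (\<Sum>i\<in>A. f i x)) = (\<Sum>i\<in>A. LINT x:S|N. f i x)"
  using assms unfolding set_integrable_def set_lebesgue_integral_def
  by (simp_all add: scaleR_sum_right sum_distrib_left Bochner_Integration.integral_sum)

text \<open>\<open>c k l = \<eta> k * L k / (\<eta> l * sqrt (L k * L l))\<close> are the weights in Young's inequality; they make
  both terms comparable with the two halves of the step size condition.\<close>

lemma coupling_sum_le:
  fixes p \<eta> L I \<tau> :: "nat \<Rightarrow> real" and M :: "nat \<Rightarrow> nat \<Rightarrow> real" and e :: real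
  assumes A: "finite A" and sym: "\<And>k l. k \<in> A \<Longrightarrow> l \<in> A \<Longrightarrow> N k l \<longleftrightarrow> N l k"
    and p: "\<And>k. k \<in> A \<Longrightarrow> 0 < p k" and \<eta>: "\<And>k. k \<in> A \<Longrightarrow> 0 < \<eta> k" and L: "\<And>k. k \<in> A \<Longrightarrow> 0 < L k"
    and I: "\<And>k. k \<in> A \<Longrightarrow> 0 \<le> I k"
    and step: "\<And>k. k \<in> A \<Longrightarrow> \<eta> k * L k * (1 + (\<Sum>l\<in>{l\<in>A. N k l}.
        p l * ((\<tau> k * M k l + e * \<tau> l * M l k) / sqrt (L k * L l)))) \<le> 1"
    and c: "\<And>k l. c k l = \<eta> k * L k / (\<eta> l * sqrt (L k * L l))"
  shows "(\<Sum>k\<in>A. p k * (\<eta> k * (- (1 - L k * \<eta> k / 2) * I k + (\<Sum>l\<in>{l\<in>A. N k l}. M k l * \<eta> l / 2 *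
      (c k l * (p l * \<tau> k * I k) + p l * (\<tau> k * e * I l) / c k l)))))
    \<le> - (\<Sum>k\<in>A. p k * \<eta> k * I k) / 2"
proof -
  \<comment> \<open>\<open>H k l\<close> is the share of a pair charged to block \<open>k\<close>,
    which takes the step; \<open>S k l\<close> is the share charged to block \<open>l\<close>, which
    moved inside the window of \<open>k\<close>. Each is arranged to display the product of
    intensity, step size and \<open>I\<close> for the block that it is charged to.\<close>
  define q where "q = (\<lambda>k l. \<tau> k * M k l / sqrt (L k * L l))"
  define S where "S = (\<lambda>k l. p l * \<eta> l * I l * (\<eta> l * L l) * (p k * (e * q k l)) / 2)"
  define H where "H = (\<lambda>k l. p k * \<eta> k * I k * (\<eta> k * L k) * (p l * q k l) / 2)"
  have pair_eq: "p k * (\<eta> k * (M k l * \<eta> l / 2 * (c k l * (p l * \<tau> k * I k) + p l * (\<tau> k * e * I l) / c k l))) = H k l + S k l"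
    if k: "k \<in> A" and l: "l \<in> A" for k l
  proof -
    define r where "r = sqrt (L k * L l)"
    have r: "r > 0" "r * r = L k * L l" using L[OF k] L[OF l] by (simp_all add: r_def)
    have 1: "p k * (\<eta> k * (M k l * \<eta> l / 2 * (c k l * (p l * \<tau> k * I k)))) = H k l"
      unfolding c H_def q_def r_def[symmetric] using \<eta>[OF k] \<eta>[OF l] r(1) by (simp add: field_simps)
    \<comment> \<open>The reason for the square root in the weight: dividing by \<open>c k l\<close>
      trades the smoothness constant of block \<open>k\<close> for that of block
      \<open>l\<close>.\<close>
    have rL: "r / L k = L l / r" using r L[OF k] by (simp add: field_simps)
    have "p k * (\<eta> k * (M k l * \<eta> l / 2 * (p l * (\<tau> k * e * I l) / c k l)))
        = p k * M k l * \<eta> l * \<eta> l * p l * \<tau> k * e * I l / 2 * (r / L k)"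
      unfolding c r_def[symmetric] using \<eta>[OF k] \<eta>[OF l] r(1) L[OF k] by (simp add: field_simps)
    also have "\<dots> = S k l"
      unfolding rL S_def q_def r_def[symmetric] using r(1) by (simp add: field_simps)
    finally show ?thesis using 1 by (simp add: distrib_left)
  qed
  have "(\<Sum>k\<in>A. p k * (\<eta> k * (- (1 - L k * \<eta> k / 2) * I k + (\<Sum>l\<in>{l\<in>A. N k l}. M k l * \<eta> l / 2 *
      (c k l * (p l * \<tau> k * I k) + p l * (\<tau> k * e * I l) / c k l)))))
    = (\<Sum>k\<in>A. p k * \<eta> k * I k * (- (1 - L k * \<eta> k / 2)) + (\<Sum>l\<in>{l\<in>A. N k l}. H k l) + (\<Sum>l\<in>{l\<in>A. N k l}. S k l))"
  proof (rule sum.cong[OF refl])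
    fix k assume k: "k \<in> A"
    have "p k * (\<eta> k * (\<Sum>l\<in>{l\<in>A. N k l}. M k l * \<eta> l / 2 * (c k l * (p l * \<tau> k * I k) + p l * (\<tau> k * e * I l) / c k l)))
        = (\<Sum>l\<in>{l\<in>A. N k l}. H k l + S k l)"
      unfolding sum_distrib_left using pair_eq[OF k] by (intro sum.cong) auto
    then show "p k * (\<eta> k * (- (1 - L k * \<eta> k / 2) * I k + (\<Sum>l\<in>{l\<in>A. N k l}. M k l * \<eta> l / 2 *
      (c k l * (p l * \<tau> k * I k) + p l * (\<tau> k * e * I l) / c k l))))
      = p k * \<eta> k * I k * (- (1 - L k * \<eta> k / 2)) + (\<Sum>l\<in>{l\<in>A. N k l}. H k l) + (\<Sum>l\<in>{l\<in>A. N k l}. S k l)"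
      unfolding distrib_left sum.distrib by (simp add: mult_ac)
  qed
  also have "\<dots> = (\<Sum>k\<in>A. p k * \<eta> k * I k * (- (1 - L k * \<eta> k / 2)) + (\<Sum>l\<in>{l\<in>A. N k l}. H k l)) + (\<Sum>k\<in>A. \<Sum>l\<in>{l\<in>A. N k l}. S k l)"
    by (simp add: sum.distrib)
  \<comment> \<open>Regrouping by the block that moved. After renaming, symmetry of \<open>N\<close>
    lets both shares be summed over the same neighbours, and \<open>q l k\<close> appears with the
    factor \<open>e\<close>, as in the step size condition.\<close>
  also have "(\<Sum>k\<in>A. \<Sum>l\<in>{l\<in>A. N k l}. S k l) = (\<Sum>l\<in>A. \<Sum>k\<in>{k\<in>A. N k l}. S k l)"
    by (rule sum.swap_restrict[OF A A])
  also have "\<dots> = (\<Sum>k\<in>A. \<Sum>l\<in>{l\<in>A. N k l}. S l k)"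
    using sym by (intro sum.cong) auto
  also have "(\<Sum>k\<in>A. p k * \<eta> k * I k * (- (1 - L k * \<eta> k / 2)) + (\<Sum>l\<in>{l\<in>A. N k l}. H k l)) + (\<Sum>k\<in>A. \<Sum>l\<in>{l\<in>A. N k l}. S l k)
      = (\<Sum>k\<in>A. p k * \<eta> k * I k * (- 1 + (\<eta> k * L k * (1 + (\<Sum>l\<in>{l\<in>A. N k l}. p l * (q k l + e * q l k)))) / 2))"
    unfolding sum.distrib[symmetric]
  proof (rule sum.cong[OF refl])
    fix k
    have "(\<Sum>l\<in>{l\<in>A. N k l}. H k l) + (\<Sum>l\<in>{l\<in>A. N k l}. S l k)
      = p k * \<eta> k * I k * (\<eta> k * L k) / 2 * (\<Sum>l\<in>{l\<in>A. N k l}. p l * (q k l + e * q l k))"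
      unfolding sum.distrib[symmetric] sum_distrib_left by (intro sum.cong) (auto simp: H_def S_def algebra_simps)
    then show "p k * \<eta> k * I k * (- (1 - L k * \<eta> k / 2)) + (\<Sum>l\<in>{l\<in>A. N k l}. H k l) + (\<Sum>l\<in>{l\<in>A. N k l}. S l k)
      = p k * \<eta> k * I k * (- 1 + (\<eta> k * L k * (1 + (\<Sum>l\<in>{l\<in>A. N k l}. p l * (q k l + e * q l k)))) / 2)"
      unfolding add.assoc by (simp add: algebra_simps)
  qed
  \<comment> \<open>The smoothness term and both coupling shares together amount to half of the left
    side of \<open>step\<close>, which leaves the coefficient - 1 + 1 / 2.\<close>
  also have "\<dots> \<le> (\<Sum>k\<in>A. p k * \<eta> k * I k * (- 1 + 1 / 2))"
  proof (intro sum_mono mult_left_mono add_left_mono divide_right_mono)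
    fix k assume k: "k \<in> A"
    have "(\<Sum>l\<in>{l\<in>A. N k l}. p l * (q k l + e * q l k)) = (\<Sum>l\<in>{l\<in>A. N k l}. p l * ((\<tau> k * M k l + e * \<tau> l * M l k) / sqrt (L k * L l)))"
      unfolding q_def by (intro sum.cong refl) (simp add: add_divide_distrib mult_ac)
    then show "\<eta> k * L k * (1 + (\<Sum>l\<in>{l\<in>A. N k l}. p l * (q k l + e * q l k))) \<le> 1" using step[OF k] by simp
    show "0 \<le> p k * \<eta> k * I k" using p[OF k] \<eta>[OF k] I[OF k] by simp
  qed simp
  also have "\<dots> = - (\<Sum>k\<in>A. p k * \<eta> k * I k) / 2"
    by (simp add: sum_negf[symmetric] sum_divide_distrib)
  finally show ?thesis .
qed

context delayed_descent_rates begin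

lemma set_integrable_Delta: "k \<in> {1..m} \<Longrightarrow> set_integrable lborel {0<..T} (\<lambda>s. expectation (\<Delta> k s))"
  using expectation_predictable(1)[OF Delta_predictable _ integrable_bound_R[of "real m * C * (1 + \<eta> k * C)\<^sup>2" T], of k T]
    Delta_bound[of k] by simp

lemma set_integrable_D_sq: "k \<in> {1..m} \<Longrightarrow> set_integrable lborel {0<..T} (\<lambda>s. expectation (\<lambda>\<omega>. (norm (D k s \<omega>))\<^sup>2))"
proof -
  assume k: "k \<in> {1..m}"
  note [measurable] = D_predictable[OF k]
  have "(\<lambda>x. (norm ((\<lambda>(s, \<omega>). D k s \<omega>) x))\<^sup>2) \<in> borel_measurable Pred" by measurable
  from expectation_predictable(1)[OF this _ integrable_bound_R[of "C\<^sup>2" T], of T] show ?thesis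
    using D_sq_le[OF k] by simp
qed

definition wint :: "real \<Rightarrow> real \<Rightarrow> nat \<Rightarrow> real" where
  "wint \<gamma> T k = (LBINT s:{0<..T}. exp (\<gamma> * s) * w k s)"

lemma wint_nonneg: "k \<in> {1..m} \<Longrightarrow> 0 \<le> wint \<gamma> T k"
  unfolding wint_def set_lebesgue_integral_def
  by (intro integral_nonneg_AE AE_I2) (auto simp: indicator_def intro!: mult_nonneg_nonneg w_nonneg)

lemma weighted_Delta_le:
  assumes k: "k \<in> {1..m}" and \<gamma>: "0 \<le> \<gamma>" and \<gamma>\<tau>: "\<gamma> * \<tau> k \<le> 1" and c: "\<And>l. l \<in> {1..m} \<Longrightarrow> c l > 0"
  shows "(LBINT s:{0<..T}. exp (\<gamma> * s) * expectation (\<Delta> k s)) \<le> \<eta> k * (- (1 - L k * \<eta> k / 2) * wint \<gamma> T k +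
    (\<Sum>l\<in>{l\<in>{1..m}. adj E G k l}. M k l * \<eta> l / 2 *
      (c l * (p l * \<tau> k * wint \<gamma> T k) + p l * (\<tau> k * exp 1 * wint \<gamma> T l) / c l)))"
proof -
  let ?A = "{l\<in>{1..m}. adj E G k l}"
  let ?V = "\<lambda>l s. exp (\<gamma> * s) * (LBINT r:{0<..s}. indicator {s - \<tau> k<..} r * w l r)"
  let ?w = "\<lambda>s. exp (\<gamma> * s) * w k s"
  have wn: "0 \<le> w l r" if "l \<in> {1..m}" "0 < r" for l r using w_nonneg that by simp
  have iw: "set_integrable lborel {0<..T} ?w" by (intro set_integrable_exp_mult set_integrable_w k \<gamma>)
  have iV: "set_integrable lborel {0<..T} (?V l)" if "l \<in> ?A" for l
    using that delay_nonneg[OF k] \<gamma> by (intro window_exp_le(1) set_integrable_w wn) auto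
  have iT: "set_integrable lborel {0<..T} (\<lambda>s. M k l * \<eta> l / 2 * (c l * (p l * \<tau> k * ?w s) + p l * ?V l s / c l))"
    if "l \<in> ?A" for l
    using iw iV[OF that] by (intro set_integrable_mult_right set_integral_add(1) set_integrable_divide)
  have iS: "set_integrable lborel {0<..T} (\<lambda>s. \<Sum>l\<in>?A. M k l * \<eta> l / 2 * (c l * (p l * \<tau> k * ?w s) + p l * ?V l s / c l))"
    by (rule set_integral_finite_sum(1)[OF iT])
  have "(LBINT s:{0<..T}. exp (\<gamma> * s) * expectation (\<Delta> k s)) \<le>
    (LBINT s:{0<..T}. \<eta> k * (- (1 - L k * \<eta> k / 2) * ?w s +
      (\<Sum>l\<in>?A. M k l * \<eta> l / 2 * (c l * (p l * \<tau> k * ?w s) + p l * ?V l s / c l))))"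
  proof (rule set_integral_mono)
    show "set_integrable lborel {0<..T} (\<lambda>s. exp (\<gamma> * s) * expectation (\<Delta> k s))"
      by (intro set_integrable_exp_mult set_integrable_Delta k \<gamma>)
    show "set_integrable lborel {0<..T} (\<lambda>s. \<eta> k * (- (1 - L k * \<eta> k / 2) * ?w s +
      (\<Sum>l\<in>?A. M k l * \<eta> l / 2 * (c l * (p l * \<tau> k * ?w s) + p l * ?V l s / c l))))"
      by (intro set_integrable_mult_right set_integral_add(1) iw iS)
    fix s assume "s \<in> {0<..T}"
    then have s: "0 < s" by simp
    have "exp (\<gamma> * s) * expectation (\<Delta> k s) \<le> exp (\<gamma> * s) * (\<eta> k * (- (1 - L k * \<eta> k / 2) * w k s +
      (\<Sum>l\<in>?A. M k l * \<eta> l / 2 * (c l * (p l * \<tau> k * w k s) + p l * (LBINT r:{0<..s}. indicator {s - \<tau> k<..} r * w l r) / c l))))"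
      by (intro mult_left_mono expectation_Delta_le k s c) auto
    also have "\<dots> = \<eta> k * (- (1 - L k * \<eta> k / 2) * ?w s +
      (\<Sum>l\<in>?A. M k l * \<eta> l / 2 * (c l * (p l * \<tau> k * ?w s) + p l * ?V l s / c l)))"
      by (simp add: distrib_left sum_distrib_left mult_ac)
    finally show "exp (\<gamma> * s) * expectation (\<Delta> k s) \<le> \<eta> k * (- (1 - L k * \<eta> k / 2) * ?w s +
      (\<Sum>l\<in>?A. M k l * \<eta> l / 2 * (c l * (p l * \<tau> k * ?w s) + p l * ?V l s / c l)))" .
  qed
  also have "\<dots> = \<eta> k * (- (1 - L k * \<eta> k / 2) * wint \<gamma> T k +
      (\<Sum>l\<in>?A. LBINT s:{0<..T}. M k l * \<eta> l / 2 * (c l * (p l * \<tau> k * ?w s) + p l * ?V l s / c l)))"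
    by (simp only: set_integral_mult_right[where a="\<eta> k"] set_integral_mult_right[where a="- (1 - L k * \<eta> k / 2)"]
        set_integral_add(2)[OF set_integrable_mult_right[OF iw] iS] set_integral_finite_sum(2)[OF iT] wint_def)
  also have "\<dots> \<le> \<eta> k * (- (1 - L k * \<eta> k / 2) * wint \<gamma> T k +
    (\<Sum>l\<in>?A. M k l * \<eta> l / 2 * (c l * (p l * \<tau> k * wint \<gamma> T k) + p l * (\<tau> k * exp 1 * wint \<gamma> T l) / c l)))"
  proof (intro mult_left_mono add_left_mono sum_mono)
    fix l assume l: "l \<in> ?A"
    then have l1: "l \<in> {1..m}" by simp
    have "(LBINT s:{0<..T}. ?V l s) \<le> \<tau> k * exp (\<gamma> * \<tau> k) * (LBINT r:{0<..T}. exp (\<gamma> * r) * w l r)"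
      using delay_nonneg[OF k] \<gamma> by (intro window_exp_le(2) set_integrable_w wn l1)
    \<comment> \<open>The origin of exp 1 in the step size condition:
      \<open>\<gamma> * \<tau> k\<close> is at most 1, so the exponential is bounded uniformly in
      \<gamma>.\<close>
    also have "\<dots> \<le> \<tau> k * exp 1 * wint \<gamma> T l"
      using delay_nonneg[OF k] \<gamma>\<tau> wint_nonneg[OF l1, of \<gamma> T] unfolding wint_def[symmetric]
      by (intro mult_right_mono mult_left_mono) auto
    finally have V: "(LBINT s:{0<..T}. ?V l s) \<le> \<tau> k * exp 1 * wint \<gamma> T l" .
    have "(LBINT s:{0<..T}. M k l * \<eta> l / 2 * (c l * (p l * \<tau> k * ?w s) + p l * ?V l s / c l))
      = M k l * \<eta> l / 2 * (c l * (p l * \<tau> k * wint \<gamma> T k) + p l * (LBINT s:{0<..T}. ?V l s) / c l)"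
      unfolding set_integral_mult_right
        set_integral_add(2)[OF set_integrable_mult_right[OF set_integrable_mult_right[OF iw]]
          set_integrable_divide[OF set_integrable_mult_right[OF iV[OF l]]]]
        set_integral_divide_zero wint_def ..
    also have "\<dots> \<le> M k l * \<eta> l / 2 * (c l * (p l * \<tau> k * wint \<gamma> T k) + p l * (\<tau> k * exp 1 * wint \<gamma> T l) / c l)"
      using V c[OF l1] intensity_pos[OF l1] M_nonneg[OF k l1] step_pos[OF l1] l
      by (intro mult_left_mono add_left_mono divide_right_mono) (auto intro!: mult_nonneg_nonneg)
    finally show "(LBINT s:{0<..T}. M k l * \<eta> l / 2 * (c l * (p l * \<tau> k * ?w s) + p l * ?V l s / c l))
      \<le> M k l * \<eta> l / 2 * (c l * (p l * \<tau> k * wint \<gamma> T k) + p l * (\<tau> k * exp 1 * wint \<gamma> T l) / c l)" .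
  qed (use step_pos[OF k] in simp)
  finally show ?thesis .
qed

lemma weighted_drift_le:
  assumes \<gamma>: "0 \<le> \<gamma>" and \<gamma>\<tau>: "\<And>k. k \<in> {1..m} \<Longrightarrow> \<gamma> * \<tau> k \<le> 1"
    and step: "\<And>k. k \<in> {1..m} \<Longrightarrow> \<eta> k * L k * (1 + (\<Sum>l\<in>{l\<in>{1..m}. adj E G k l}.
        p l * ((\<tau> k * M k l + exp 1 * \<tau> l * M l k) / sqrt (L k * L l)))) \<le> 1"
  shows "(\<Sum>k\<in>{1..m}. p k * (LBINT s:{0<..T}. exp (\<gamma> * s) * expectation (\<Delta> k s)))
    \<le> - (\<Sum>k\<in>{1..m}. p k * \<eta> k * wint \<gamma> T k) / 2"
proof -
  define c where "c = (\<lambda>k l. \<eta> k * L k / (\<eta> l * sqrt (L k * L l)))"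
  have c: "0 < c k l" if "k \<in> {1..m}" "l \<in> {1..m}" for k l
    using step_pos[OF that(1)] step_pos[OF that(2)] L_pos[OF that(1)] L_pos[OF that(2)] by (simp add: c_def)
  have "(\<Sum>k\<in>{1..m}. p k * (LBINT s:{0<..T}. exp (\<gamma> * s) * expectation (\<Delta> k s)))
    \<le> (\<Sum>k\<in>{1..m}. p k * (\<eta> k * (- (1 - L k * \<eta> k / 2) * wint \<gamma> T k + (\<Sum>l\<in>{l\<in>{1..m}. adj E G k l}. M k l * \<eta> l / 2 *
      (c k l * (p l * \<tau> k * wint \<gamma> T k) + p l * (\<tau> k * exp 1 * wint \<gamma> T l) / c k l)))))"
    using intensity_pos by (intro sum_mono mult_left_mono weighted_Delta_le \<gamma> \<gamma>\<tau> c) (auto intro: less_imp_le)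
  also have "\<dots> \<le> - (\<Sum>k\<in>{1..m}. p k * \<eta> k * wint \<gamma> T k) / 2"
    by (rule coupling_sum_le[OF _ adj_commute[OF G_diff] intensity_pos step_pos L_pos wint_nonneg step])
      (simp_all add: c_def)
  finally show ?thesis .
qed

section \<open>Decay of the expected gap\<close>

definition gap :: "real \<Rightarrow> real" where
  "gap s = expectation (\<lambda>\<omega>. G (X s \<omega>)) - G xstar"

lemma gap_nonneg: "0 < s \<Longrightarrow> 0 \<le> gap s"
  using integral_ge_const[OF integrable_G_X, of s "G xstar"] G_min unfolding gap_def by simp

text \<open>Block \<open>k\<close> reads the position of time \<open>s\<close> when it acts at time
  \<open>s + \<tau> k\<close>. Evaluating the blocks at these different times reassembles the full
  gradient at \<open>X s\<close>, to which the Polyak-Lojasiewicz inequality applies.\<close>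

lemma gap_le:
  assumes s: "0 < s"
  shows "2 * \<sigma> * gap s \<le> (\<Sum>k\<in>{1..m}. expectation (\<lambda>\<omega>. (norm (D k (s + \<tau> k) \<omega>))\<^sup>2))"
proof -
  have int: "integrable \<Omega> (\<lambda>\<omega>. (norm (D k (s + \<tau> k) \<omega>))\<^sup>2)" if "k \<in> {1..m}" for k
    using s delay_nonneg[OF that] by (intro integrable_D_sq that) auto
  \<comment> \<open>A block without delay reads the left limit; this equals \<open>X s\<close>
    almost surely, since a fixed time is not a point.\<close>
  have AE: "AE \<omega> in \<Omega>. \<forall>l\<in>{1..m}. s \<notin> P l \<omega>"
    using AE_not_point[of _ s] s by (intro AE_finite_allI) auto
  have "AE \<omega> in \<Omega>. 2 * \<sigma> * (G (X s \<omega>) - G xstar) \<le> (\<Sum>k\<in>{1..m}. (norm (D k (s + \<tau> k) \<omega>))\<^sup>2)"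
    using AE AE_space
  proof eventually_elim
    case (elim \<omega>)
    have "points l {..<s} \<omega> = points l {..s} \<omega>" if "l \<in> {1..m}" for l
      using elim(1) that by (auto simp: less_le)
    then have Y: "Y {..<s} \<omega> = Y {..s} \<omega>" unfolding Y_def by (intro arg_cong2[where f=plus] refl sum.cong) auto
    have "D k (s + \<tau> k) \<omega> = block_grad E G k (X s \<omega>)" for k
      unfolding D_def W_def X_eq[OF elim(2)] using Y by simp
    then have "(\<Sum>k\<in>{1..m}. (norm (D k (s + \<tau> k) \<omega>))\<^sup>2) = (norm (grad G (X s \<omega>)))\<^sup>2"
      by (simp only: block_grad_def norm_sq_eq_sum_orth_proj[of "grad G (X s \<omega>)"])
    then show ?case using polyak_lojasiewicz[OF G_diff G_convex sigma_pos] by simp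
  qed
  then have "expectation (\<lambda>\<omega>. 2 * \<sigma> * (G (X s \<omega>) - G xstar)) \<le> expectation (\<lambda>\<omega>. \<Sum>k\<in>{1..m}. (norm (D k (s + \<tau> k) \<omega>))\<^sup>2)"
    using int integrable_G_X[OF s] by (intro integral_mono_AE) auto
  then show ?thesis
    using int integrable_G_X[OF s] by (simp add: gap_def Bochner_Integration.integral_sum prob_space)
qed

text \<open>Each block is shifted by its own delay and must stay inside \<open>{0<..T}\<close>, so
  the gap is controlled only up to \<open>T - \<tau>max\<close>. The lower bound
  \<open>\<epsilon> k\<close> passes from the mean of \<open>\<xi>\<close> to \<open>w k s\<close>
  because the latter factorises at fixed times.\<close>

lemma gap_integral_le:
  assumes \<gamma>: "0 \<le> \<gamma>" and \<Gamma>: "0 \<le> \<Gamma>" and eps0: "\<And>k. k \<in> {1..m} \<Longrightarrow> 0 \<le> \<epsilon> k"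
    and eps: "\<And>k s. k \<in> {1..m} \<Longrightarrow> 0 \<le> s \<Longrightarrow> \<epsilon> k \<le> expectation (\<xi> k s)"
    and rate: "\<And>k. k \<in> {1..m} \<Longrightarrow> \<Gamma> \<le> \<sigma> * (\<epsilon> k * (p k * \<eta> k))"
    and \<tau>max: "\<And>k. k \<in> {1..m} \<Longrightarrow> \<tau> k \<le> \<tau>max"
  shows "\<Gamma> * (LBINT s:{0<..T - \<tau>max}. exp (\<gamma> * s) * gap s) \<le> (\<Sum>k\<in>{1..m}. p k * \<eta> k * wint \<gamma> T k) / 2"
proof -
  define u where "u = (\<lambda>k s. expectation (\<lambda>\<omega>. (norm (D k s \<omega>))\<^sup>2))"
  have u0: "0 \<le> u k s" for k s unfolding u_def by (rule integral_nonneg_AE) simp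
  define U where "U = (\<lambda>k. LBINT s:{0<..T}. exp (\<gamma> * s) * u k s)"
  \<comment> \<open>Extension by zero off \<open>{0<..T}\<close> lets the change of variable run
    over the whole line; whatever falls outside may be dropped because \<open>f\<close> is
    nonnegative.\<close>
  define f where "f = (\<lambda>k s. indicator {0<..T} s *\<^sub>R (exp (\<gamma> * s) * u k s))"
  define S where "S = T - \<tau>max"
  have iu: "set_integrable lborel {0<..T} (\<lambda>s. exp (\<gamma> * s) * u k s)" if "k \<in> {1..m}" for k
    unfolding u_def by (intro set_integrable_exp_mult set_integrable_D_sq that \<gamma>)
  have f: "integrable lborel (f k)" if "k \<in> {1..m}" for k
    using iu[OF that] unfolding set_integrable_def f_def .
  have f0: "0 \<le> f k s" for k s using u0 by (simp add: f_def)
  have U: "\<epsilon> k * U k \<le> wint \<gamma> T k" if k: "k \<in> {1..m}" for k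
  proof -
    have "(LBINT s:{0<..T}. \<epsilon> k * (exp (\<gamma> * s) * u k s)) \<le> wint \<gamma> T k"
      unfolding wint_def
    proof (rule set_integral_mono)
      show "set_integrable lborel {0<..T} (\<lambda>s. \<epsilon> k * (exp (\<gamma> * s) * u k s))"
        using iu[OF k] by simp
      show "set_integrable lborel {0<..T} (\<lambda>s. exp (\<gamma> * s) * w k s)"
        by (intro set_integrable_exp_mult set_integrable_w k \<gamma>)
      fix s assume "s \<in> {0<..T}"
      then have s: "0 \<le> s" by simp
      have "\<epsilon> k * u k s \<le> expectation (\<xi> k s) * u k s" by (intro mult_right_mono eps k s u0)
      then have "\<epsilon> k * u k s \<le> w k s" by (simp add: w_eq[OF k s] u_def)
      then show "\<epsilon> k * (exp (\<gamma> * s) * u k s) \<le> exp (\<gamma> * s) * w k s"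
        by (simp add: mult.left_commute)
    qed
    then show ?thesis by (simp add: U_def)
  qed
  have shift: "(LBINT s. indicator {0<..S} s *\<^sub>R f k (\<tau> k + 1 * s)) \<le> U k" if k: "k \<in> {1..m}" for k
  proof -
    have "(LBINT s. indicator {0<..S} s *\<^sub>R f k (\<tau> k + 1 * s)) \<le> (LBINT s. f k (\<tau> k + 1 * s))"
    proof (rule integral_mono')
      show "integrable lborel (\<lambda>s. f k (\<tau> k + 1 * s))" by (rule lborel_integrable_real_affine[OF f[OF k]]) simp
      show "indicator {0<..S} s *\<^sub>R f k (\<tau> k + 1 * s) \<le> f k (\<tau> k + 1 * s)" for s
        using f0[of k "\<tau> k + 1 * s"] by (simp add: indicator_def)
    qed (rule f0)
    also have "\<dots> = (LBINT s. f k s)" using lborel_integral_real_affine[of 1 "f k" "\<tau> k"] by simp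
    also have "\<dots> = U k" by (simp add: U_def f_def set_lebesgue_integral_def)
    finally show ?thesis .
  qed
  have ishift: "integrable lborel (\<lambda>s. indicator {0<..S} s *\<^sub>R f k (\<tau> k + 1 * s))" if k: "k \<in> {1..m}" for k
    by (intro integrable_mult_indicator lborel_integrable_real_affine[OF f[OF k]]) auto
  have "(LBINT s:{0<..S}. exp (\<gamma> * s) * gap s) \<le> (LBINT s. (\<Sum>k\<in>{1..m}. indicator {0<..S} s *\<^sub>R f k (\<tau> k + 1 * s)) / (2 * \<sigma>))"
    unfolding set_lebesgue_integral_def
  proof (rule integral_mono')
    show "integrable lborel (\<lambda>s. (\<Sum>k\<in>{1..m}. indicator {0<..S} s *\<^sub>R f k (\<tau> k + 1 * s)) / (2 * \<sigma>))"
      by (intro integrable_divide Bochner_Integration.integrable_sum ishift)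
    fix s
    show "0 \<le> (\<Sum>k\<in>{1..m}. indicator {0<..S} s *\<^sub>R f k (\<tau> k + 1 * s)) / (2 * \<sigma>)"
      using sigma_pos f0 by (intro divide_nonneg_nonneg sum_nonneg) auto
    show "indicator {0<..S} s *\<^sub>R (exp (\<gamma> * s) * gap s) \<le> (\<Sum>k\<in>{1..m}. indicator {0<..S} s *\<^sub>R f k (\<tau> k + 1 * s)) / (2 * \<sigma>)"
    proof (cases "s \<in> {0<..S}")
      case True
      then have s: "0 < s" "s \<le> S" by auto
      have "exp (\<gamma> * s) * (2 * \<sigma> * gap s) \<le> exp (\<gamma> * s) * (\<Sum>k\<in>{1..m}. u k (s + \<tau> k))"
        unfolding u_def using gap_le[OF s(1)] by (intro mult_left_mono) auto
      also have "\<dots> = (\<Sum>k\<in>{1..m}. exp (\<gamma> * s) * u k (s + \<tau> k))" by (rule sum_distrib_left)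
      also have "\<dots> \<le> (\<Sum>k\<in>{1..m}. f k (\<tau> k + 1 * s))"
      proof (rule sum_mono)
        fix k assume k: "k \<in> {1..m}"
        have "0 < \<tau> k + s" "\<tau> k + s \<le> T" using delay_nonneg[OF k] \<tau>max[OF k] s by (auto simp: S_def)
        then have "f k (\<tau> k + 1 * s) = exp (\<gamma> * (\<tau> k + s)) * u k (s + \<tau> k)" by (simp add: f_def add.commute)
        moreover have "exp (\<gamma> * s) \<le> exp (\<gamma> * (\<tau> k + s))" using \<gamma> delay_nonneg[OF k] by (simp add: mult_left_mono)
        ultimately show "exp (\<gamma> * s) * u k (s + \<tau> k) \<le> f k (\<tau> k + 1 * s)" using u0 by (simp add: mult_right_mono)
      qed
      finally have "exp (\<gamma> * s) * gap s * (2 * \<sigma>) \<le> (\<Sum>k\<in>{1..m}. f k (\<tau> k + 1 * s))" by (simp add: mult_ac)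
      then have "exp (\<gamma> * s) * gap s \<le> (\<Sum>k\<in>{1..m}. f k (\<tau> k + 1 * s)) / (2 * \<sigma>)"
        using sigma_pos by (simp add: pos_le_divide_eq)
      then show ?thesis using True by simp
    qed simp
  qed
  also have "\<dots> = (\<Sum>k\<in>{1..m}. LBINT s. indicator {0<..S} s *\<^sub>R f k (\<tau> k + 1 * s)) / (2 * \<sigma>)"
    by (simp only: integral_divide_zero Bochner_Integration.integral_sum[OF ishift])
  also have "\<dots> \<le> (\<Sum>k\<in>{1..m}. U k) / (2 * \<sigma>)"
    using sigma_pos shift by (intro divide_right_mono sum_mono) auto
  finally have "\<Gamma> * (LBINT s:{0<..S}. exp (\<gamma> * s) * gap s) \<le> \<Gamma> * ((\<Sum>k\<in>{1..m}. U k) / (2 * \<sigma>))"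
    using \<Gamma> by (rule mult_left_mono)
  also have "\<dots> = (\<Sum>k\<in>{1..m}. \<Gamma> / \<sigma> * U k) / 2"
    unfolding sum_distrib_left[symmetric] by simp
  also have "\<dots> \<le> (\<Sum>k\<in>{1..m}. p k * \<eta> k * wint \<gamma> T k) / 2"
  proof (intro divide_right_mono sum_mono)
    fix k assume k: "k \<in> {1..m}"
    have U0: "0 \<le> U k"
      unfolding U_def set_lebesgue_integral_def by (rule integral_nonneg_AE) (simp add: u0)
    have "\<Gamma> / \<sigma> \<le> \<epsilon> k * (p k * \<eta> k)" using rate[OF k] sigma_pos by (simp add: field_simps)
    then have "\<Gamma> / \<sigma> * U k \<le> \<epsilon> k * (p k * \<eta> k) * U k" using U0 by (rule mult_right_mono)
    also have "\<dots> = p k * \<eta> k * (\<epsilon> k * U k)" by simp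
    also have "\<dots> \<le> p k * \<eta> k * wint \<gamma> T k"
      using U[OF k] intensity_pos[OF k] step_pos[OF k] by (intro mult_left_mono) auto
    finally show "\<Gamma> / \<sigma> * U k \<le> p k * \<eta> k * wint \<gamma> T k" .
  qed simp
  finally show ?thesis unfolding S_def .
qed

lemma
  assumes \<gamma>: "0 \<le> \<gamma>" and \<gamma>\<Gamma>: "\<gamma> \<le> \<Gamma>"
    and eps0: "\<And>k. k \<in> {1..m} \<Longrightarrow> 0 \<le> \<epsilon> k"
    and eps: "\<And>k s. k \<in> {1..m} \<Longrightarrow> 0 \<le> s \<Longrightarrow> \<epsilon> k \<le> expectation (\<xi> k s)"
    and rate: "\<And>k. k \<in> {1..m} \<Longrightarrow> \<Gamma> \<le> \<sigma> * (\<epsilon> k * (p k * \<eta> k))"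
    and \<tau>max: "\<And>k. k \<in> {1..m} \<Longrightarrow> \<tau> k \<le> \<tau>max" "0 \<le> \<tau>max" and \<gamma>\<tau>: "\<gamma> * \<tau>max < 1"
    and step: "\<And>k. k \<in> {1..m} \<Longrightarrow> \<eta> k * L k * (1 + (\<Sum>l\<in>{l\<in>{1..m}. adj E G k l}.
        p l * ((\<tau> k * M k l + exp 1 * \<tau> l * M l k) / sqrt (L k * L l)))) \<le> 1"
    and T: "0 < T"
  shows set_integrable_exp_gap: "set_integrable lborel {0<..T} (\<lambda>t. exp (\<gamma> * t) * gap t)"
    and exp_gap_integral_le: "(LBINT t:{0<..T}. exp (\<gamma> * t) * gap t) \<le> T * (G x0 - G xstar) / (1 - \<gamma> * \<tau>max)"
proof -
  define b where "b = (\<lambda>s. \<Sum>k\<in>{1..m}. p k * expectation (\<Delta> k s))"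
  have ip: "set_integrable lborel {0<..T} (\<lambda>s. p k * expectation (\<Delta> k s))" if "k \<in> {1..m}" for k T
    by (intro set_integrable_mult_right set_integrable_Delta that)
  have ib: "set_integrable lborel {0<..T} b" for T
    unfolding b_def by (intro set_integral_finite_sum(1) ip)
  have gap: "gap t = (G x0 - G xstar) + (LBINT s:{0<..t}. b s)" if "0 < t" for t
  proof -
    have "(LBINT s:{0<..t}. b s) = (\<Sum>k\<in>{1..m}. LBINT s:{0<..t}. p k * expectation (\<Delta> k s))"
      unfolding b_def by (rule set_integral_finite_sum(2)[OF ip])
    then show ?thesis unfolding gap_def expectation_G_X[OF that] by simp
  qed
  note drift = exp_drift[OF ib gap \<gamma>]
  show int: "set_integrable lborel {0<..T} (\<lambda>t. exp (\<gamma> * t) * gap t)" by (rule drift(1)[OF _ T])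
  let ?\<psi> = "\<lambda>t. exp (\<gamma> * t) * gap t"
  have \<psi>0: "0 \<le> ?\<psi> t" if "0 < t" for t using gap_nonneg[OF that] by simp
  \<comment> \<open>Growth of the weight contributes \<gamma> times the whole integral up to
    \<open>S\<close>, and the descent removes at least as much up to \<open>S - \<tau>max\<close>;
    only the last delay window survives.\<close>
  have key: "?\<psi> S \<le> (G x0 - G xstar) + \<gamma> * (LBINT r:{0<..S}. indicator {S - \<tau>max<..} r * ?\<psi> r)" if S: "0 < S" for S
  proof -
    have i\<psi>: "set_integrable lborel {0<..S} ?\<psi>" by (rule drift(1)[OF _ S])
    have \<gamma>\<tau>': "\<gamma> * \<tau> k \<le> 1" if "k \<in> {1..m}" for k
      using mult_left_mono[OF \<tau>max(1)[OF that] \<gamma>] \<gamma>\<tau> by linarith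
    have "(LBINT s:{0<..S}. exp (\<gamma> * s) * b s) = (\<Sum>k\<in>{1..m}. p k * (LBINT s:{0<..S}. exp (\<gamma> * s) * expectation (\<Delta> k s)))"
    proof -
      have "(LBINT s:{0<..S}. exp (\<gamma> * s) * b s) = (LBINT s:{0<..S}. \<Sum>k\<in>{1..m}. p k * (exp (\<gamma> * s) * expectation (\<Delta> k s)))"
        unfolding b_def by (simp add: sum_distrib_left mult.left_commute)
      also have "\<dots> = (\<Sum>k\<in>{1..m}. LBINT s:{0<..S}. p k * (exp (\<gamma> * s) * expectation (\<Delta> k s)))"
        by (intro set_integral_finite_sum(2) set_integrable_mult_right set_integrable_exp_mult set_integrable_Delta \<gamma>)
      finally show ?thesis by simp
    qed
    also have "\<dots> \<le> - (\<Sum>k\<in>{1..m}. p k * \<eta> k * wint \<gamma> S k) / 2"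
      by (rule weighted_drift_le[OF \<gamma> \<gamma>\<tau>' step])
    also have "\<dots> \<le> - (\<Gamma> * (LBINT s:{0<..S - \<tau>max}. ?\<psi> s))"
      using gap_integral_le[OF \<gamma> order_trans[OF \<gamma> \<gamma>\<Gamma>] eps0 eps rate \<tau>max(1), of S] by simp
    also have "\<dots> \<le> - (\<gamma> * (LBINT s:{0<..S - \<tau>max}. ?\<psi> s))"
    proof -
      have "0 \<le> (LBINT s:{0<..S - \<tau>max}. ?\<psi> s)"
        unfolding set_lebesgue_integral_def by (intro integral_nonneg_AE AE_I2) (auto simp: indicator_def \<psi>0)
      then show ?thesis using \<gamma>\<Gamma> by (simp add: mult_right_mono)
    qed
    finally have db: "(LBINT s:{0<..S}. exp (\<gamma> * s) * b s) \<le> - (\<gamma> * (LBINT s:{0<..S - \<tau>max}. ?\<psi> s))" .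
    have i1: "set_integrable lborel {0<..S} (\<lambda>r. indicator {S - \<tau>max<..} r * ?\<psi> r)"
      by (rule set_integrable_mult_bounded[OF i\<psi>, where B=1]) (auto simp: indicator_def)
    have i2: "set_integrable lborel {0<..S} (\<lambda>r. indicator {..S - \<tau>max} r * ?\<psi> r)"
      by (rule set_integrable_mult_bounded[OF i\<psi>, where B=1]) (auto simp: indicator_def)
    have "(LBINT r:{0<..S}. ?\<psi> r) = (LBINT r:{0<..S}. indicator {S - \<tau>max<..} r * ?\<psi> r + indicator {..S - \<tau>max} r * ?\<psi> r)"
      by (intro set_lebesgue_integral_cong) (auto simp: indicator_def)
    also have "\<dots> = (LBINT r:{0<..S}. indicator {S - \<tau>max<..} r * ?\<psi> r) + (LBINT r:{0<..S}. indicator {..S - \<tau>max} r * ?\<psi> r)"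
      by (rule set_integral_add(2)[OF i1 i2])
    also have "(LBINT r:{0<..S}. indicator {..S - \<tau>max} r * ?\<psi> r) = (LBINT r:{0<..S - \<tau>max}. ?\<psi> r)"
      unfolding set_lebesgue_integral_def using \<tau>max(2)
      by (intro Bochner_Integration.integral_cong) (auto simp: indicator_def)
    finally have "\<gamma> * (LBINT r:{0<..S}. ?\<psi> r) = \<gamma> * (LBINT r:{0<..S}. indicator {S - \<tau>max<..} r * ?\<psi> r) + \<gamma> * (LBINT r:{0<..S - \<tau>max}. ?\<psi> r)"
      by (simp only: distrib_left)
    moreover have "?\<psi> S = (G x0 - G xstar) + \<gamma> * (LBINT t:{0<..S}. ?\<psi> t) + (LBINT s:{0<..S}. exp (\<gamma> * s) * b s)"
      by (rule drift(2)[OF _ S])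
    ultimately show ?thesis using db by linarith
  qed
  let ?I = "LBINT t:{0<..T}. ?\<psi> t"
  \<comment> \<open>The exponential weight already sits in \<open>?\<psi>\<close>, so the exchange
    is used with exponent 0.\<close>
  have win: "set_integrable lborel {0<..T} (\<lambda>s. LBINT r:{0<..s}. indicator {s - \<tau>max<..} r * ?\<psi> r)"
    "(LBINT s:{0<..T}. LBINT r:{0<..s}. indicator {s - \<tau>max<..} r * ?\<psi> r) \<le> \<tau>max * ?I"
    using window_exp_le[OF int \<psi>0 \<tau>max(2) order_refl] by simp_all
  \<comment> \<open>Integrating \<open>key\<close> over \<open>S\<close>: each time lies in the last
    window of \<open>S\<close> for a duration of at most \<open>\<tau>max\<close>, so the window
    term returns as at most \<open>\<gamma> * \<tau>max\<close> times \<open>?I\<close>. This factor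
    is below 1, and the term is absorbed on the left.\<close>
  have "?I \<le> (LBINT S:{0<..T}. (G x0 - G xstar) + \<gamma> * (LBINT r:{0<..S}. indicator {S - \<tau>max<..} r * ?\<psi> r))"
    by (intro set_integral_mono int set_integral_add(1) set_integrable_const_Ioc set_integrable_mult_right win(1) key) simp
  also have "\<dots> = (LBINT S:{0<..T}. G x0 - G xstar) + \<gamma> * (LBINT S:{0<..T}. LBINT r:{0<..S}. indicator {S - \<tau>max<..} r * ?\<psi> r)"
    by (subst set_integral_add(2)) (use win(1) in \<open>auto intro: set_integrable_const_Ioc\<close>)
  also have "(LBINT S:{0<..T}. G x0 - G xstar) = T * (G x0 - G xstar)"
    using T by (simp add: set_lebesgue_integral_def)
  also have "T * (G x0 - G xstar) + \<gamma> * (LBINT S:{0<..T}. LBINT r:{0<..S}. indicator {S - \<tau>max<..} r * ?\<psi> r)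
      \<le> T * (G x0 - G xstar) + \<gamma> * (\<tau>max * ?I)"
    using win(2) \<gamma> by (intro add_left_mono mult_left_mono)
  finally have "(1 - \<gamma> * \<tau>max) * ?I \<le> T * (G x0 - G xstar)" by (simp add: algebra_simps)
  then show "?I \<le> T * (G x0 - G xstar) / (1 - \<gamma> * \<tau>max)"
    using \<gamma>\<tau> by (simp add: pos_le_divide_eq mult.commute)
qed

end

section \<open>The rate\<close>

text \<open>The integrability claims belong to the conclusion because the Bochner integral of a
  non-integrable function is 0 by convention; they ensure that no such default value enters the
  inequality.\<close>

theorem theorem2:
  fixes \<Omega> :: "'w measure"
    and m :: nat
    and E :: "nat \<Rightarrow> 'a::euclidean_space set"
    and G :: "'a \<Rightarrow> real"
    and P :: "nat \<Rightarrow> 'w \<Rightarrow> real set"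
    and p \<tau> \<eta> K L \<epsilon> :: "nat \<Rightarrow> real"
    and M :: "nat \<Rightarrow> nat \<Rightarrow> real"
    and \<xi> :: "nat \<Rightarrow> real \<Rightarrow> 'w \<Rightarrow> real"
    and X :: "real \<Rightarrow> 'w \<Rightarrow> 'a"
    and x0 xstar :: 'a
    and \<sigma> \<gamma> \<tau>max T :: real
  assumes decomp: "orthogonal_decomposition m E"
    and G_diff: "\<forall>x. G differentiable (at x)"
    and sigma_pos: "\<sigma> > 0"
    and G_convex: "strongly_convex \<sigma> G"
    and G_min: "\<forall>x. G xstar \<le> G x"
    and L_pos: "\<forall>k\<in>{1..m}. L k > 0"
    and G_smooth: "\<forall>k\<in>{1..m}. block_smooth E G k (L k)"
    and M_nonneg: "\<forall>k\<in>{1..m}. \<forall>l\<in>{1..m}. adj E G k l \<longrightarrow> 0 \<le> M k l \<and> 0 \<le> M l k"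
    and G_lipschitz: "\<forall>k\<in>{1..m}. \<forall>x y.
          norm (block_grad E G k x - block_grad E G k y)
            \<le> (\<Sum>l\<in>{l\<in>{1..m}. adj E G k l}. M k l * norm (orth_proj (E l) x - orth_proj (E l) y))"
    and prob: "prob_space \<Omega>"
    and p_pos: "\<forall>k\<in>{1..m}. p k > 0"
    and poisson: "independent_poisson_processes \<Omega> m p P"
    and delay_nonneg: "\<forall>k\<in>{1..m}. \<tau> k \<ge> 0"
    and step_pos: "\<forall>k\<in>{1..m}. \<eta> k > 0"
    and xi_01: "\<forall>k\<in>{1..m}. \<forall>t\<ge>0. \<forall>\<omega>\<in>space \<Omega>. \<xi> k t \<omega> \<in> {0, 1}"
    and xi_window: "\<forall>k\<in>{1..m}. \<forall>t\<ge>0.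
          \<xi> k t \<in> borel_measurable (points_sigma \<Omega> P {1..m} {t - \<tau> k..<t})"
    and xi_predictable: "\<forall>k\<in>{1..m}.
          (\<lambda>(t, \<omega>). \<xi> k t \<omega>) \<in> borel_measurable (predictable_sigma \<Omega> m P)"
    and eps_pos: "\<forall>k\<in>{1..m}. \<epsilon> k > 0"
    and xi_lower: "\<forall>k\<in>{1..m}. \<forall>t\<ge>0. (\<integral>\<omega>. \<xi> k t \<omega> \<partial>\<Omega>) \<ge> \<epsilon> k"
    and xi_corr: "\<forall>k\<in>{1..m}. \<forall>l\<in>{1..m}. \<forall>t\<ge>0.
          (\<integral>\<omega>. \<xi> k t \<omega> * real (card (P l \<omega> \<inter> {t - \<tau> k..t})) \<partial>\<Omega>)
            \<le> (\<integral>\<omega>. \<xi> k t \<omega> \<partial>\<Omega>) * (\<integral>\<omega>. real (card (P l \<omega> \<inter> {t - \<tau> k..t})) \<partial>\<Omega>)"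
    and process: "delayed_coordinate_descent \<Omega> m E G P \<tau> \<eta> \<xi> x0 X"
    and step_size: "\<forall>k\<in>{1..m}. \<eta> k = K k / (p k * L k)"
    and K_bound: "\<forall>k\<in>{1..m}.
          K k \<le> p k / (1 + (\<Sum>l\<in>{l\<in>{1..m}. adj E G k l}.
                        p l * ((\<tau> k * M k l + exp 1 * \<tau> l * M l k) / sqrt (L k * L l))))"
    and tau_max: "\<tau>max = (MAX k\<in>{1..m}. \<tau> k)"
    and gamma_nonneg: "\<gamma> \<ge> 0"
    and gamma_less: "\<gamma> < \<sigma> * (MIN k\<in>{1..m}. \<epsilon> k * K k / L k)"
    and gamma_delay: "\<tau>max > 0 \<longrightarrow> \<gamma> < 1 / \<tau>max"
    and start: "G x0 \<noteq> G xstar"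
    and T_pos: "T > 0"
  shows "(\<forall>t\<in>{0..T}. integrable \<Omega> (\<lambda>\<omega>. G (X t \<omega>)))
    \<and> set_integrable lborel {0..T} (\<lambda>t. exp (\<gamma> * t) * (\<integral>\<omega>. (G (X t \<omega>) - G xstar) \<partial>\<Omega>))
    \<and> (LBINT t:{0..T}. exp (\<gamma> * t) * (\<integral>\<omega>. (G (X t \<omega>) - G xstar) \<partial>\<Omega>))
        / (LBINT t:{0..T}. exp (\<gamma> * t) * (G x0 - G xstar))
      \<le> exp (- (\<gamma> * T / 2)) * ((1 + \<tau>max / T) / (1 - \<gamma> * \<tau>max))"
proof -
  let ?S = "\<lambda>k. \<Sum>l\<in>{l\<in>{1..m}. adj E G k l}. p l * ((\<tau> k * M k l + exp 1 * \<tau> l * M l k) / sqrt (L k * L l))"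
  \<comment> \<open>Orthogonal projections do not increase norms, so each block gradient is
    Lipschitz with the sum of its \<open>M k l\<close>, and \<open>C\<close> dominates these sums
    for all blocks.\<close>
  define C where "C = (\<Sum>k\<in>{1..m}. \<Sum>l\<in>{l\<in>{1..m}. adj E G k l}. M k l)"
  interpret prob_space \<Omega> by (rule prob)
  interpret orthogonal_blocks m E by unfold_locales (rule decomp)
  interpret poisson_family \<Omega> m p P
    by unfold_locales (use poisson p_pos in auto)
  have M0: "0 \<le> (\<Sum>l\<in>{l\<in>{1..m}. adj E G k l}. M k l)" if "k \<in> {1..m}" for k
    using M_nonneg that by (intro sum_nonneg) auto
  have lip: "norm (block_grad E G k x - block_grad E G k y) \<le> C * norm (x - y)" if k: "k \<in> {1..m}" for k x y
  proof -
    have "norm (block_grad E G k x - block_grad E G k y)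
        \<le> (\<Sum>l\<in>{l\<in>{1..m}. adj E G k l}. M k l * norm (orth_proj (E l) x - orth_proj (E l) y))"
      using G_lipschitz k by blast
    also have "\<dots> \<le> (\<Sum>l\<in>{l\<in>{1..m}. adj E G k l}. M k l * norm (x - y))"
    proof (intro sum_mono mult_left_mono)
      fix l assume l: "l \<in> {l\<in>{1..m}. adj E G k l}"
      then have sub: "subspace (E l)" using subspace_block by simp
      show "norm (orth_proj (E l) x - orth_proj (E l) y) \<le> norm (x - y)"
        unfolding linear_diff[OF linear_orth_proj[OF sub], symmetric] by (rule norm_orth_proj_le[OF sub])
      show "0 \<le> M k l" using M_nonneg k l by auto
    qed
    also have "\<dots> = (\<Sum>l\<in>{l\<in>{1..m}. adj E G k l}. M k l) * norm (x - y)" by (rule sum_distrib_right[symmetric])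
    also have "\<dots> \<le> C * norm (x - y)"
      unfolding C_def using M0 k by (intro mult_right_mono member_le_sum) auto
    finally show ?thesis .
  qed
  have C0: "0 \<le> C" unfolding C_def by (rule sum_nonneg[OF M0])
  have \<tau>le: "\<tau> k \<le> \<tau>max" if "k \<in> {1..m}" for k
    unfolding tau_max using that by (intro Max_ge) auto
  have \<tau>0: "0 \<le> \<tau>max"
  proof -
    have "1 \<in> {1..m}" using m_pos by simp
    then show ?thesis using \<tau>le delay_nonneg by (meson order_trans)
  qed
  have \<gamma>\<tau>: "\<gamma> * \<tau>max < 1"
    using gamma_delay \<tau>0 by (cases "\<tau>max = 0") (auto simp: field_simps)
  \<comment> \<open>The intensity cancels between \<open>p k\<close> and the step size. The minimum
    in the assumption on \<gamma> thereby bounds \<open>\<epsilon> k * (p k * \<eta> k)\<close>, the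
    form that the descent estimate uses.\<close>
  have p\<eta>: "p k * \<eta> k = K k / L k" if "k \<in> {1..m}" for k
  proof -
    have "0 < p k" "\<eta> k = K k / (p k * L k)" using step_size p_pos that by blast+
    then show ?thesis by simp
  qed
  have rate: "\<sigma> * (MIN k\<in>{1..m}. \<epsilon> k * K k / L k) \<le> \<sigma> * (\<epsilon> k * (p k * \<eta> k))" if k: "k \<in> {1..m}" for k
  proof -
    have "(MIN k\<in>{1..m}. \<epsilon> k * K k / L k) \<le> \<epsilon> k * K k / L k" using k by (intro Min_le) auto
    then show ?thesis using sigma_pos unfolding p\<eta>[OF k] by (intro mult_left_mono) auto
  qed
  have step: "\<eta> k * L k * (1 + ?S k) \<le> 1" if k: "k \<in> {1..m}" for k
  proof -
    have S0: "0 \<le> ?S k"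
    proof (rule sum_nonneg)
      fix l assume l: "l \<in> {l\<in>{1..m}. adj E G k l}"
      then have "0 \<le> M k l" "0 \<le> M l k" using M_nonneg k by auto
      moreover have "0 \<le> \<tau> k" "0 \<le> \<tau> l" "0 < p l" "0 < L k" "0 < L l" using k l delay_nonneg p_pos L_pos by auto
      ultimately show "0 \<le> p l * ((\<tau> k * M k l + exp 1 * \<tau> l * M l k) / sqrt (L k * L l))"
        by (intro mult_nonneg_nonneg divide_nonneg_nonneg add_nonneg_nonneg) auto
    qed
    have pL: "0 < p k" "0 < L k" using p_pos L_pos k by auto
    have "K k \<le> p k / (1 + ?S k)" using K_bound k by blast
    then have "K k * (1 + ?S k) \<le> p k" using S0 by (simp add: pos_le_divide_eq)
    moreover have "\<eta> k * L k = K k / p k" using step_size k pL by simp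
    ultimately show ?thesis using pL by (simp add: pos_divide_le_eq)
  qed
  have eps0: "0 \<le> \<epsilon> k" if "k \<in> {1..m}" for k using eps_pos that by (simp add: less_imp_le)
  have eps: "\<epsilon> k \<le> expectation (\<xi> k s)" if "k \<in> {1..m}" "0 \<le> s" for k s using xi_lower that by blast
  interpret delayed_descent \<Omega> m p P E G C \<sigma> \<tau> \<eta> \<xi> X x0 xstar
  proof unfold_locales
    show "k \<in> {1..m} \<Longrightarrow> 0 \<le> t \<Longrightarrow> \<omega> \<in> space \<Omega> \<Longrightarrow> \<xi> k t \<omega> \<in> {0, 1}" for k t \<omega>
      using xi_01 by blast
  qed (use G_diff sigma_pos G_convex G_min C0 lip delay_nonneg step_pos xi_predictable process in auto)
  interpret delayed_descent_rates \<Omega> m p P E G C \<sigma> \<tau> \<eta> \<xi> X x0 xstar L M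
  proof unfold_locales
    show "k \<in> {1..m} \<Longrightarrow> norm (block_grad E G k x - block_grad E G k y)
        \<le> (\<Sum>l\<in>{l\<in>{1..m}. adj E G k l}. M k l * norm (orth_proj (E l) x - orth_proj (E l) y))" for k x y
      using G_lipschitz by blast
  qed (use L_pos G_smooth M_nonneg xi_window xi_corr in auto)
  note bound = set_integrable_exp_gap[OF gamma_nonneg less_imp_le[OF gamma_less] eps0 eps rate \<tau>le \<tau>0 \<gamma>\<tau> step T_pos]
    exp_gap_integral_le[OF gamma_nonneg less_imp_le[OF gamma_less] eps0 eps rate \<tau>le \<tau>0 \<gamma>\<tau> step T_pos]
  let ?h = "\<lambda>t. exp (\<gamma> * t) * (\<integral>\<omega>. (G (X t \<omega>) - G xstar) \<partial>\<Omega>)"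
  have h: "?h t = exp (\<gamma> * t) * gap t" if "0 < t" for t
    using integrable_G_X[OF that] by (simp add: gap_def prob_space)
  have "set_integrable lborel {0<..T} ?h"
    using bound(1) by (rule set_integrable_cong[THEN iffD1, rotated -1]) (auto simp: h)
  \<comment> \<open>The estimates live on \<open>{0<..T}\<close>, where jumps take place; adding
    time 0 changes a null set only.\<close>
  then have int: "set_integrable lborel {0..T} ?h"
    by (rule set_integrable_discrete_difference[where X="{0}", THEN iffD1, rotated -1]) auto
  have "(LBINT t:{0..T}. ?h t) = (LBINT t:{0<..T}. ?h t)"
    by (rule set_integral_discrete_difference[where X="{0}"]) auto
  also have "\<dots> = (LBINT t:{0<..T}. exp (\<gamma> * t) * gap t)"
    by (intro set_lebesgue_integral_cong) (auto simp: h)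
  also have "\<dots> \<le> T * (G x0 - G xstar) / (1 - \<gamma> * \<tau>max)" by (rule bound(2))
  finally have num: "(LBINT t:{0..T}. ?h t) \<le> T * (G x0 - G xstar) / (1 - \<gamma> * \<tau>max)" .
  have gap0: "0 < G x0 - G xstar" using start G_min[rule_format, of x0] by linarith
  have den: "(LBINT t:{0..T}. exp (\<gamma> * t) * (G x0 - G xstar)) = (LBINT t:{0..T}. exp (\<gamma> * t)) * (G x0 - G xstar)"
    by simp
  let ?I = "LBINT t:{0..T}. exp (\<gamma> * t)"
  have I: "T * exp (\<gamma> * T / 2) \<le> ?I" by (rule exp_integral_ge[OF gamma_nonneg T_pos])
  have I0: "0 < T * exp (\<gamma> * T / 2)" using T_pos by simp
  have Ipos: "0 < ?I" using I I0 by linarith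
  have q: "0 < 1 - \<gamma> * \<tau>max" using \<gamma>\<tau> by simp
  have "(LBINT t:{0..T}. ?h t) / (?I * (G x0 - G xstar)) \<le> (T * (G x0 - G xstar) / (1 - \<gamma> * \<tau>max)) / (?I * (G x0 - G xstar))"
    using num Ipos gap0 by (intro divide_right_mono) auto
  \<comment> \<open>The midpoint bound is inserted in the denominator. The starting gap is positive,
    as \<open>xstar\<close> is a minimizer and the two values differ, so it cancels in the next
    step.\<close>
  also have "\<dots> \<le> (T * (G x0 - G xstar) / (1 - \<gamma> * \<tau>max)) / (T * exp (\<gamma> * T / 2) * (G x0 - G xstar))"
    using I Ipos gap0 q T_pos by (intro divide_left_mono mult_right_mono mult_pos_pos) auto
  also have "\<dots> = exp (- (\<gamma> * T / 2)) * (1 / (1 - \<gamma> * \<tau>max))"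
  proof -
    have "T * a / c / (T * e * a) = inverse e * (1 / c)" if "a > 0" "c > 0" "e > 0" for a c e :: real
      using that T_pos by (simp add: field_simps)
    from this[OF gap0 q exp_gt_zero] show ?thesis by (simp add: exp_minus)
  qed
  \<comment> \<open>Uses \<open>1 \<le> 1 + \<tau>max / T\<close>.\<close>
  also have "\<dots> \<le> exp (- (\<gamma> * T / 2)) * ((1 + \<tau>max / T) / (1 - \<gamma> * \<tau>max))"
    using q \<tau>0 T_pos by (intro mult_left_mono divide_right_mono) auto
  finally have ratio: "(LBINT t:{0..T}. ?h t) / (LBINT t:{0..T}. exp (\<gamma> * t) * (G x0 - G xstar))
      \<le> exp (- (\<gamma> * T / 2)) * ((1 + \<tau>max / T) / (1 - \<gamma> * \<tau>max))"
    unfolding den .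
  have "integrable \<Omega> (\<lambda>\<omega>. G (X t \<omega>))" if "t \<in> {0..T}" for t
  proof (cases "t = 0")
    case True
    have "X 0 \<omega> = x0" if "\<omega> \<in> space \<Omega>" for \<omega>
      using process that unfolding delayed_coordinate_descent_def by simp
    then have "integrable \<Omega> (\<lambda>\<omega>. G (X 0 \<omega>)) = integrable \<Omega> (\<lambda>\<omega>. G x0)"
      by (intro Bochner_Integration.integrable_cong) auto
    then show ?thesis using True by simp
  next
    case False
    then show ?thesis using that by (intro integrable_G_X) auto
  qed
  then show ?thesis using int ratio by blast
qed

end
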